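(* Let $S$ be a finite ordered tree and $A=\{x\in S\colon x\text{ is not the root of }S\text{ and }x\text{ has at most one immediate successor in }S\}$. Then for every finite ordered tree $T$ and every integer $r>0$ there is a finite ordered tree $V$ such that for every coloring $\chi\colon\mathrm{Hom}_{PSC}(S,V)\to r$ there is $(t,j)\in\mathrm{Hom}_{PSC}(T,V)$ such that for every $(s,i)\in\mathrm{Hom}_{PSC}(S,T)$, the color $\chi((t,j)\circ(s,i))$ depends only on the set $B=\{x\in A\colon i_s(x)\neq i(x)\}$. In particular, $rd(S)\leq|\mathcal{P}(A)|$ in $PSC$.
   Context: All trees are finite. A tree is a partial order $(T,\sqsubseteq_T)$ with a least element (the root) such that the predecessors of every element are linearly ordered; $v\wedge_T w$ is the largest common predecessor. A tree is ordered if each set of immediate successors carries a linear order; this induces a linear order $\leq_T$ on $T$: $v\leq_T w$ iff $v\sqsubseteq_T w$, or $w\not\sqsubseteq_T v$ and the immediate successor of $v\wedge w$ below $v$ precedes the one below $w$. An embedding $i\colon S\to T$ sends root to root, satisfies $x<_S y\Rightarrow i(x)<_T i(y)$, and $i(x\wedge y)=i(x)\wedge i(y)$. A map $s\colon T\to S$ is a rigid surjection if there is an embedding $i\colon S\to T$ with $s(i(x))=x$ and $i(s(y))\sqsubseteq_T y$ for all $x,y$; then $i=i_s$, $i_s(x)=\bigwedge s^{-1}(x)$. A connection $(s,i)\colon T\leftrightarrows S$ is a pair with $s\colon T\to S$ a rigid surjection, $i\colon S\to T$ an embedding, and for all $x\in S$: $s(i(x))=x$ and $s(y)\leq_S x$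 for all $y<_T i(x)$. A connection is strong if $i$ sends the $\leq_S$-largest leaf ($\sqsubseteq$-maximal element) of $S$ to the $\leq_T$-largest leaf of $T$. For $v\in T$ let $T^v=\{y\in T\colon y\leq_T v\}$ with the inherited structure (an initial subtree), and for a map $s$ defined on $T$ let $s^v=s\restriction T^v$. $PSC$ is the category whose objects are finite ordered trees, with $\mathrm{Hom}_{PSC}(S,T)=\{(s,i)\colon T^v\leftrightarrows S\mid v\in T,\ (s,i)\text{ a strong connection}\}$; for $(t,j)\colon T^v\leftrightarrows S$ in $\mathrm{Hom}_{PSC}(S,T)$ and $(s,i)\in\mathrm{Hom}_{PSC}(T,V)$ the composite is $(s,i)\circ(t,j)=(t\circ s^{i(v)},\ i^{v}\circ j)$, where $i^v=i\restriction T^v$. Ramsey degree: $rd(A,B)$ is the least $k$ such that for every $r>0$ there is an object $C$ such that every $r$-coloring of $\mathrm{Hom}(A,C)$ admits $f\in\mathrm{Hom}(B,C)$ with at most $k$ colors on $f\circ\mathrm{Hom}(A,B)$; $rd(A)=\sup_B rd(A,B)$. *)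

theory Defs
  imports "HOL-Library.FuncSet" "HOL-Library.Extended_Nat" "HOL-Library.Infinite_Typeclass"
begin

text \<open>\<open>ord T\<close> is the tree order; \<open>sib T x\<close> is the (non-strict) linear order on the immediate
  successors of \<open>x\<close>. Its values at points outside the tree are irrelevant.\<close>

record 'a otree =
  verts :: "'a set"
  ord :: "'a rel"
  sib :: "'a \<Rightarrow> 'a rel"

definition isucc :: "'a otree \<Rightarrow> 'a \<Rightarrow> 'a set" where
  "isucc T x = {y \<in> verts T. (x, y) \<in> ord T \<and> x \<noteq> y \<and>
     (\<forall>z \<in> verts T. (x, z) \<in> ord T \<and> (z, y) \<in> ord T \<longrightarrow> z = x \<or> z = y)}"

definition ordered_tree :: "'a otree \<Rightarrow> bool" where
  "ordered_tree T \<longleftrightarrow>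
     finite (verts T) \<and>
     partial_order_on (verts T) (ord T) \<and>
     (\<exists>r \<in> verts T. \<forall>x \<in> verts T. (r, x) \<in> ord T) \<and>
     (\<forall>x \<in> verts T. total_on {y. (y, x) \<in> ord T} (ord T)) \<and>
     (\<forall>x \<in> verts T. linear_order_on (isucc T x) (sib T x))"

definition root :: "'a otree \<Rightarrow> 'a" where
  "root T = (THE r. r \<in> verts T \<and> (\<forall>x \<in> verts T. (r, x) \<in> ord T))"

definition Meet :: "'a otree \<Rightarrow> 'a set \<Rightarrow> 'a" where
  "Meet T X = (THE u. u \<in> verts T \<and> (\<forall>x \<in> X. (u, x) \<in> ord T) \<and>
     (\<forall>w \<in> verts T. (\<forall>x \<in> X. (w, x) \<in> ord T) \<longrightarrow> (w, u) \<in> ord T))"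

abbreviation meet :: "'a otree \<Rightarrow> 'a \<Rightarrow> 'a \<Rightarrow> 'a" where
  "meet T v w \<equiv> Meet T {v, w}"

definition tle :: "'a otree \<Rightarrow> 'a \<Rightarrow> 'a \<Rightarrow> bool" where
  "tle T v w \<longleftrightarrow> v \<in> verts T \<and> w \<in> verts T \<and>
     ((v, w) \<in> ord T \<or>
      (w, v) \<notin> ord T \<and>
      (\<exists>a \<in> isucc T (meet T v w). \<exists>b \<in> isucc T (meet T v w).
         (a, v) \<in> ord T \<and> (b, w) \<in> ord T \<and> a \<noteq> b \<and> (a, b) \<in> sib T (meet T v w)))"

definition tless :: "'a otree \<Rightarrow> 'a \<Rightarrow> 'a \<Rightarrow> bool" where
  "tless T v w \<longleftrightarrow> tle T v w \<and> v \<noteq> w"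

definition leaves :: "'a otree \<Rightarrow> 'a set" where
  "leaves T = {x \<in> verts T. \<forall>y \<in> verts T. (x, y) \<in> ord T \<longrightarrow> y = x}"

definition max_leaf :: "'a otree \<Rightarrow> 'a" where
  "max_leaf T = (THE l. l \<in> leaves T \<and> (\<forall>m \<in> leaves T. tle T m l))"

definition init_subtree :: "'a otree \<Rightarrow> 'a \<Rightarrow> 'a otree" where
  "init_subtree T v = (let X = {y \<in> verts T. tle T y v} in
     \<lparr>verts = X, ord = Restr (ord T) X, sib = (\<lambda>x. Restr (sib T x) X)\<rparr>)"

text \<open>Maps between trees are extensional functions, so that equal maps are equal terms and
  colourings of hom-sets cannot see values outside the domain.\<close>

definition embedding :: "'a otree \<Rightarrow> 'b otree \<Rightarrow> ('a \<Rightarrow> 'b) \<Rightarrow> bool" where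
  "embedding S T i \<longleftrightarrow> i \<in> verts S \<rightarrow>\<^sub>E verts T \<and>
     i (root S) = root T \<and>
     (\<forall>x \<in> verts S. \<forall>y \<in> verts S. tless S x y \<longrightarrow> tless T (i x) (i y)) \<and>
     (\<forall>x \<in> verts S. \<forall>y \<in> verts S. i (meet S x y) = meet T (i x) (i y))"

definition rigid_surjection :: "'a otree \<Rightarrow> 'b otree \<Rightarrow> ('a \<Rightarrow> 'b) \<Rightarrow> bool" where
  "rigid_surjection T S s \<longleftrightarrow> s \<in> verts T \<rightarrow>\<^sub>E verts S \<and>
     (\<exists>i. embedding S T i \<and> (\<forall>x \<in> verts S. s (i x) = x) \<and>
        (\<forall>y \<in> verts T. (i (s y), y) \<in> ord T))"

text \<open>For a rigid surjection \<open>s\<close> on \<open>T\<close> this is the embedding \<open>i\<^sub>s\<close>; the lemma below shows that it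
  is the unique witness in the definition of rigid surjections.\<close>

definition assoc_emb :: "'a otree \<Rightarrow> ('a \<Rightarrow> 'b) \<Rightarrow> 'b \<Rightarrow> 'a" where
  "assoc_emb T s x = Meet T {y \<in> verts T. s y = x}"

lemma assoc_emb_unique:
  assumes "ordered_tree T" "embedding S T i"
    and "\<forall>x \<in> verts S. s (i x) = x" "\<forall>y \<in> verts T. (i (s y), y) \<in> ord T"
    and "x \<in> verts S"
  shows "assoc_emb T s x = i x"
proof -
  have po: "partial_order_on (verts T) (ord T)"
    using assms(1) by (simp add: ordered_tree_def)
  have ix: "i x \<in> verts T" "s (i x) = x"
    using assms(2,3,5) by (auto simp: embedding_def)
  show ?thesis
    unfolding assoc_emb_def Meet_def
  proof (rule the_equality)
    show "i x \<in> verts T \<and> (\<forall>y \<in> {y \<in> verts T. s y = x}. (i x, y) \<in> ord T) \<and>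
      (\<forall>w \<in> verts T. (\<forall>y \<in> {y \<in> verts T. s y = x}. (w, y) \<in> ord T) \<longrightarrow> (w, i x) \<in> ord T)"
      using ix assms(4) by auto
  next
    fix u
    assume "u \<in> verts T \<and> (\<forall>y \<in> {y \<in> verts T. s y = x}. (u, y) \<in> ord T) \<and>
      (\<forall>w \<in> verts T. (\<forall>y \<in> {y \<in> verts T. s y = x}. (w, y) \<in> ord T) \<longrightarrow> (w, u) \<in> ord T)"
    then have "(u, i x) \<in> ord T" "(i x, u) \<in> ord T"
      using ix assms(4) by auto
    then show "u = i x"
      using po by (meson antisymD partial_order_on_def)
  qed
qed

definition connection :: "'a otree \<Rightarrow> 'b otree \<Rightarrow> ('a \<Rightarrow> 'b) \<Rightarrow> ('b \<Rightarrow> 'a) \<Rightarrow> bool" where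
  "connection T S s i \<longleftrightarrow> rigid_surjection T S s \<and> embedding S T i \<and>
     (\<forall>x \<in> verts S. s (i x) = x \<and>
        (\<forall>y \<in> verts T. tless T y (i x) \<longrightarrow> tle S (s y) x))"

definition strong_connection :: "'a otree \<Rightarrow> 'b otree \<Rightarrow> ('a \<Rightarrow> 'b) \<Rightarrow> ('b \<Rightarrow> 'a) \<Rightarrow> bool" where
  "strong_connection T S s i \<longleftrightarrow> connection T S s i \<and> i (max_leaf S) = max_leaf T"

record ('o, 'm) cat =
  Obj :: "'o set"
  Hom :: "'o \<Rightarrow> 'o \<Rightarrow> 'm set"
  Comp :: "'o \<Rightarrow> 'o \<Rightarrow> 'o \<Rightarrow> 'm \<Rightarrow> 'm \<Rightarrow> 'm"  \<comment> \<open>\<open>Comp X Y Z g f\<close> is \<open>g \<circ> f\<close> for \<open>f : X \<rightarrow> Y\<close>, \<open>g : Y \<rightarrow> Z\<close>\<close>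

text \<open>A morphism \<open>(v, s, i)\<close> from \<open>S\<close> to \<open>T\<close> records, besides the connection \<open>(s, i)\<close>, the vertex
  \<open>v\<close> of \<open>T\<close> such that \<open>s\<close> is defined on the initial subtree \<open>T\<^sup>v\<close>.\<close>

type_synonym 'a psc_mor = "'a \<times> ('a \<Rightarrow> 'a) \<times> ('a \<Rightarrow> 'a)"

definition psc_hom :: "'a otree \<Rightarrow> 'a otree \<Rightarrow> 'a psc_mor set" where
  "psc_hom S T = {(v, s, i). v \<in> verts T \<and> strong_connection (init_subtree T v) S s i}"

text \<open>For \<open>(t, j) : T\<^sup>v \<leftrightarrows> S\<close> and \<open>(s, i) : V\<^sup>w \<leftrightarrows> T\<close> the composite is a connection
  \<open>V\<^bsup>i(v)\<^esup> \<leftrightarrows> S\<close>; the library function \<open>compose X g f\<close> is the composite \<open>g \<circ> f\<close> restricted to \<open>X\<close>.\<close>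

fun psc_comp :: "'a otree \<Rightarrow> 'a otree \<Rightarrow> 'a otree \<Rightarrow> 'a psc_mor \<Rightarrow> 'a psc_mor \<Rightarrow> 'a psc_mor" where
  "psc_comp S T V (w, s, i) (v, t, j) =
     (i v, compose (verts (init_subtree V (i v))) t s, compose (verts S) i j)"

text \<open>Objects are the finite ordered trees with vertices in a fixed type \<open>'a\<close>; if \<open>'a\<close> is infinite,
  every finite ordered tree is isomorphic to one of these.\<close>

definition PSC :: "('a otree, 'a psc_mor) cat" where
  "PSC = \<lparr>Obj = {T. ordered_tree T}, Hom = psc_hom, Comp = psc_comp\<rparr>"

definition ramsey_bound :: "('o, 'm) cat \<Rightarrow> 'o \<Rightarrow> 'o \<Rightarrow> nat \<Rightarrow> bool" where
  "ramsey_bound C A B k \<longleftrightarrow>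
     (\<forall>r::nat. r > 0 \<longrightarrow>
        (\<exists>D \<in> Obj C. \<forall>\<chi> \<in> Hom C A D \<rightarrow> {..<r}. \<exists>f \<in> Hom C B D.
           card (\<chi> ` Comp C A B D f ` Hom C A B) \<le> k))"

text \<open>The infimum over the empty set is \<open>\<infinity>\<close>.\<close>

definition rd2 :: "('o, 'm) cat \<Rightarrow> 'o \<Rightarrow> 'o \<Rightarrow> enat" where
  "rd2 C A B = (INF k \<in> {k. ramsey_bound C A B k}. enat k)"

definition rd :: "('o, 'm) cat \<Rightarrow> 'o \<Rightarrow> enat" where
  "rd C A = (SUP B \<in> Obj C. rd2 C A B)"

definition colour_pts :: "'a otree \<Rightarrow> 'a set" where
  "colour_pts S = {x \<in> verts S. x \<noteq> root S \<and> card (isucc S x) \<le> 1}"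

fun diff_set :: "'a otree \<Rightarrow> 'a otree \<Rightarrow> 'a psc_mor \<Rightarrow> 'a set" where
  "diff_set S T (v, s, i) = {x \<in> colour_pts S. assoc_emb (init_subtree T v) s x \<noteq> i x}"

end

theory Submission
  imports Defs "HOL-Library.List_Lexorder" "HOL-Library.Sublist" "HOL-Library.Countable"
begin

text \<open>
  A strong connection \<open>(s, i)\<close> onto \<open>S\<close> with \<open>B = {x. i\<^sub>s x \<noteq> i x}\<close> is the same as a rigid surjection
  onto the tree \<open>S\<^sub>B\<close> in which every \<open>x \<in> B\<close> receives a new successor, placed between
  \<open>x\<close> and its old successor; the new vertex is mapped to \<open>i x\<close>. Composing with a rigid surjection \<open>t\<close> and its embedding \<open>i\<^sub>t\<close> respects
  the correspondence, so it is enough to prove the dual Ramsey theorem for rigid surjections defined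
  on initial subtrees and to apply it to the finitely many trees \<open>S\<^sub>B\<close> one after another.

  The dual Ramsey theorem is proved by induction on \<open>S\<close>, removing the largest leaf. By a fusion
  argument one has to make the colour constant on all extensions \<open>(s, i)\<close> of a fixed rigid surjection
  \<open>h\<close> onto the smaller tree. Such an extension is determined by the position \<open>u\<close> of the new leaf and
  by the labels \<open>s y\<close> of the vertices \<open>y\<close> between the end \<open>b\<close> of \<open>h\<close> and \<open>u\<close>. The Hales-Jewett theorem
  removes the dependence on the labels of those \<open>y\<close> that are not below \<open>u\<close> in the tree, higher
  vertices being treated before lower ones. What is left is a colouring of words of pairs (label,
  direction) along the branches of a tall homogeneous tree, and a finite Carlson-Simpson theorem
  makes it constant. Directions belong to the alphabet because a vertex with several successors has
  to be mapped to the first occurrence of its variable.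
\<close>

section \<open>Words with variables\<close>

text \<open>A Hales-Jewett line at \<open>y\<close> needs many vertices that may be labelled
  \<open>y\<close>, hence the chain. The embedding uses only one of them, and which one is known
  only after the line has been chosen; labels strictly above the chain would depend on this choice.
  They have to be irrelevant beforehand, which forces the order from higher to lower vertices. On
  the branch this method fails, because the new leaf moves together with its branch: position and
  labels must be controlled at once, so words of all lengths up to a bound have to receive one
  colour. In the fusion the surjection \<open>h\<close> with the smallest end belongs to the
  outermost morphism; everything inside fixes the vertices up to that end, so \<open>h\<close>
  survives. Only the points of \<open>A\<close> contribute to the number of colours:
  \<open>i\<close> and \<open>i\<^sub>s\<close> agree at the root, and if \<open>x\<close> has two
  successors, then the values of \<open>i\<^sub>s\<close> at the successors meet in
  \<open>i\<^sub>s x\<close> while both lie above \<open>i x\<close>, so again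
  \<open>i x = i\<^sub>s x\<close>.\<close>

definition subst :: "'b option list \<Rightarrow> 'b \<Rightarrow> 'b list" where
  "subst P a = map (\<lambda>x. case x of None \<Rightarrow> a | Some b \<Rightarrow> b) P"

text \<open>In a pattern \<open>None\<close> is the variable and \<open>Some b\<close> the letter
  \<open>b\<close>; a list of patterns spans a subspace with one variable per block. Since
  \<open>map2\<close> stops at the shorter list, a word shorter than \<open>ps\<close> fills only an
  initial part of the blocks.\<close>

definition multi_subst :: "'b option list list \<Rightarrow> 'b list \<Rightarrow> 'b list" where
  "multi_subst ps w = concat (map2 subst ps w)"

definition words :: "'b set \<Rightarrow> nat \<Rightarrow> 'b list set" where
  "words A n = {w. set w \<subseteq> A \<and> length w = n}"

abbreviation opts :: "'b set \<Rightarrow> 'b option set" where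
  "opts A \<equiv> insert None (Some ` A)"

lemma subst_simps [simp]:
  "subst [] a = []" "subst (None # P) a = a # subst P a" "subst (Some b # P) a = b # subst P a"
  "subst (P @ Q) a = subst P a @ subst Q a" "subst (map Some w) a = w"
  "subst (replicate n None) a = replicate n a" "subst (replicate n (Some b)) a = replicate n b" "length (subst P a) = length P"
  "subst (concat Ps) a = concat (map (\<lambda>P. subst P a) Ps)"
  by (simp_all add: subst_def o_def map_concat)

lemma subst_set: "set P \<subseteq> opts A \<Longrightarrow> a \<in> A \<Longrightarrow> set (subst P a) \<subseteq> A"
  by (force simp: subst_def split: option.splits)

lemma subst_words: "set P \<subseteq> opts A \<Longrightarrow> length P = n \<Longrightarrow> a \<in> A \<Longrightarrow> subst P a \<in> words A n"
  using subst_set[of P A a] by (simp add: words_def)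

lemma multi_subst_simps [simp]:
  "multi_subst [] w = []" "multi_subst ps [] = []"
  "multi_subst (p # ps) (a # w) = subst p a @ multi_subst ps w"
  by (simp_all add: multi_subst_def)

lemma multi_subst_set:
  "(\<forall>p \<in> set ps. set p \<subseteq> opts A) \<Longrightarrow> set w \<subseteq> A \<Longrightarrow> set (multi_subst ps w) \<subseteq> A"
proof (induction ps arbitrary: w)
  case (Cons p ps)
  then show ?case
    using subst_set[of p A] by (cases w) auto
qed simp

lemma multi_subst_append:
  "length w = length ps \<Longrightarrow> multi_subst (ps @ qs) (w @ v) = multi_subst ps w @ multi_subst qs v"
  by (simp add: multi_subst_def)

lemma multi_subst_snoc:
  "length w < length ps \<Longrightarrow> multi_subst ps (w @ [a]) = multi_subst ps w @ subst (ps ! length w) a"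
proof (induction ps arbitrary: w)
  case (Cons p ps)
  then show ?case by (cases w) auto
qed simp

section \<open>The Hales-Jewett theorem\<close>

lemma finite_words: "finite A \<Longrightarrow> finite (words A n)"
  using finite_lists_length_eq[of A n] by (simp add: words_def)

text \<open>Shelah's step: colourings of long words restrict to a subspace on which the letters \<open>a\<close> and
  \<open>b\<close> cannot be told apart. Within one block the pattern is \<open>a \<dots> a * \<dots> * b \<dots> b\<close>.\<close>

lemma letter_insensitive_subspace:
  fixes A :: "'b set"
  assumes A: "finite A" "a \<in> A" "b \<in> A"
  shows "\<exists>N. \<forall>c::'b list \<Rightarrow> nat. c \<in> words A N \<rightarrow> {..<r} \<longrightarrow>
    (\<exists>ps. length ps = n \<and> (\<forall>p \<in> set ps. None \<in> set p \<and> set p \<subseteq> opts A) \<and>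
      (\<forall>w \<in> words A n. multi_subst ps w \<in> words A N) \<and>
      (\<forall>u v. u @ a # v \<in> words A n \<longrightarrow> c (multi_subst ps (u @ a # v)) = c (multi_subst ps (u @ b # v))))"
proof (induction n arbitrary: r)
  case 0
  show ?case
    by (rule exI[of _ 0], intro allI impI, rule exI[of _ "[]"]) (auto simp: words_def)
next
  case (Suc n)
  \<comment> \<open>A head of length \<open>card F\<close> admits \<open>card F + 1\<close> words
    \<open>xw p\<close>, one more than there are colourings of the tail, so two of them induce the
    same colouring \<open>c2\<close>.\<close>
  define F where "F = words A n \<rightarrow>\<^sub>E {..<r}"
  define H where "H = card F"
  define G where "G = words A H \<rightarrow>\<^sub>E {..<r}"
  have finF: "finite F" and finG: "finite G"
    using finite_words[OF A(1)] by (auto simp: F_def G_def intro!: finite_PiE)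
  obtain g where g: "bij_betw g G {0..<card G}"
    using ex_bij_betw_finite_nat[OF finG] by blast
  obtain N' where N': "\<And>c::'b list \<Rightarrow> nat. c \<in> words A N' \<rightarrow> {..<card G} \<Longrightarrow>
    \<exists>ps. length ps = n \<and> (\<forall>p \<in> set ps. None \<in> set p \<and> set p \<subseteq> opts A) \<and>
      (\<forall>w \<in> words A n. multi_subst ps w \<in> words A N') \<and>
      (\<forall>u v. u @ a # v \<in> words A n \<longrightarrow> c (multi_subst ps (u @ a # v)) = c (multi_subst ps (u @ b # v)))"
    using Suc.IH[of "card G"] by blast
  show ?case
  proof (intro exI[of _ "H + N'"] allI impI)
    fix c :: "'b list \<Rightarrow> nat"
    assume c: "c \<in> words A (H + N') \<rightarrow> {..<r}"
    \<comment> \<open>The tail is coloured by its whole effect on heads, so that insensitivity of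
      the tail holds for every head at once.\<close>
    define c1 where "c1 y = (\<lambda>x \<in> words A H. c (x @ y))" for y
    have c1G: "c1 y \<in> G" if "y \<in> words A N'" for y
      using that c by (fastforce simp: c1_def G_def words_def)
    then have "(\<lambda>y. g (c1 y)) \<in> words A N' \<rightarrow> {..<card G}"
      using g by (auto dest!: bij_betwE)
    from N'[OF this] obtain ps where ps: "length ps = n"
        "\<forall>p \<in> set ps. None \<in> set p \<and> set p \<subseteq> opts A"
        "\<forall>w \<in> words A n. multi_subst ps w \<in> words A N'"
        and gi: "\<forall>u v. u @ a # v \<in> words A n \<longrightarrow>
            g (c1 (multi_subst ps (u @ a # v))) = g (c1 (multi_subst ps (u @ b # v)))"
      by blast
    have ins: "c (x @ multi_subst ps (u @ a # v)) = c (x @ multi_subst ps (u @ b # v))"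
      if "x \<in> words A H" "u @ a # v \<in> words A n" for x u v
    proof -
      have "u @ b # v \<in> words A n"
        using that A by (auto simp: words_def)
      then have "c1 (multi_subst ps (u @ a # v)) = c1 (multi_subst ps (u @ b # v))"
        using gi that ps(3) c1G g by (metis bij_betw_inv_into_left)
      from fun_cong[OF this, of x] that(1) show ?thesis
        by (simp add: c1_def)
    qed
    define xw where "xw p = replicate p a @ replicate (H - p) b" for p
    have xw: "xw p \<in> words A H" if "p \<le> H" for p
      using that A by (auto simp: xw_def words_def)
    define c2 where "c2 x = (\<lambda>w \<in> words A n. c (x @ multi_subst ps w))" for x
    have "c2 (xw p) \<in> F" if "p \<le> H" for p
    proof -
      have "xw p @ multi_subst ps w \<in> words A (H + N')" if "w \<in> words A n" for w
        using xw[OF \<open>p \<le> H\<close>] ps(3) that by (auto simp: words_def)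
      then show ?thesis
        using c by (auto simp: c2_def F_def)
    qed
    then have "(\<lambda>p. c2 (xw p)) ` {..H} \<subseteq> F"
      by auto
    then have "card ((\<lambda>p. c2 (xw p)) ` {..H}) < card {..H}"
      using card_mono[OF finF] by (simp add: H_def le_imp_less_Suc)
    from pigeonhole[OF this] obtain p q where "p \<le> H" "q \<le> H" "p \<noteq> q" "c2 (xw p) = c2 (xw q)"
      by (auto simp: inj_on_def)
    then obtain p q where pq: "p < q" "q \<le> H" "c2 (xw p) = c2 (xw q)"
      by (metis nat_neq_iff)
    define P where "P = map Some (replicate p a) @ replicate (q - p) None @ map Some (replicate (H - q) b)"
    have Pa: "subst P a = xw q"
      using pq by (simp add: P_def xw_def flip: replicate_add)
    have Pb: "subst P b = xw p"
      using pq by (simp add: P_def xw_def flip: replicate_add)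
    have Pset: "None \<in> set P \<and> set P \<subseteq> opts A" "length P = H"
      using pq A by (auto simp: P_def)
    show "\<exists>ps. length ps = Suc n \<and> (\<forall>p \<in> set ps. None \<in> set p \<and> set p \<subseteq> opts A) \<and>
      (\<forall>w \<in> words A (Suc n). multi_subst ps w \<in> words A (H + N')) \<and>
      (\<forall>u v. u @ a # v \<in> words A (Suc n) \<longrightarrow> c (multi_subst ps (u @ a # v)) = c (multi_subst ps (u @ b # v)))"
    proof (intro exI[of _ "P # ps"] conjI allI impI ballI)
      show "length (P # ps) = Suc n" using ps by simp
    next
      fix p' assume "p' \<in> set (P # ps)"
      then show "None \<in> set p'" "set p' \<subseteq> opts A" using ps Pset by auto
    next
      fix w assume "w \<in> words A (Suc n)"
      then obtain d w' where w: "w = d # w'" "d \<in> A" "w' \<in> words A n"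
        by (cases w) (auto simp: words_def)
      then show "multi_subst (P # ps) w \<in> words A (H + N')"
        using ps(3) subst_words[of P A H d] Pset by (auto simp: words_def)
    next
      fix u v assume uv: "u @ a # v \<in> words A (Suc n)"
      show "c (multi_subst (P # ps) (u @ a # v)) = c (multi_subst (P # ps) (u @ b # v))"
      proof (cases u)
        case Nil
        then have "v \<in> words A n" using uv by (auto simp: words_def)
        then show ?thesis
          using Nil fun_cong[OF pq(3), of v] by (simp add: Pa Pb c2_def)
      next
        case (Cons d u')
        then show ?thesis
          using uv ins[of "subst P d" u' v] subst_words[of P A H d] Pset by (auto simp: words_def)
      qed
    qed
  qed
qed

text \<open>Induction on the alphabet. On a subspace that does not distinguish the new letter
  \<open>b\<close> from an old letter \<open>a\<close>, a line that is monochromatic for the old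
  letters stays so when \<open>b\<close> is substituted.\<close>

theorem Hales_Jewett_nat:
  fixes A :: "'b set"
  assumes "finite A" "A \<noteq> {}"
  shows "\<exists>N. \<forall>c::'b list \<Rightarrow> nat. c \<in> words A N \<rightarrow> {..<r} \<longrightarrow>
    (\<exists>P. length P = N \<and> None \<in> set P \<and> set P \<subseteq> opts A \<and>
       (\<forall>a \<in> A. \<forall>b \<in> A. c (subst P a) = c (subst P b)))"
  using assms
proof (induction A arbitrary: r rule: finite_ne_induct)
  case (singleton x)
  show ?case
    by (rule exI[of _ 1], intro allI impI, rule exI[of _ "[None]"]) auto
next
  case (insert b A)
  obtain a where a: "a \<in> A" using insert by blast
  obtain n where n: "\<And>c::'b list \<Rightarrow> nat. c \<in> words A n \<rightarrow> {..<r} \<Longrightarrow>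
    (\<exists>P. length P = n \<and> None \<in> set P \<and> set P \<subseteq> opts A \<and>
       (\<forall>a \<in> A. \<forall>b \<in> A. c (subst P a) = c (subst P b)))"
    using insert.IH[of r] by blast
  let ?A = "insert b A"
  obtain N where N: "\<And>c::'b list \<Rightarrow> nat. c \<in> words ?A N \<rightarrow> {..<r} \<Longrightarrow>
    (\<exists>ps. length ps = n \<and> (\<forall>p \<in> set ps. None \<in> set p \<and> set p \<subseteq> opts ?A) \<and>
      (\<forall>w \<in> words ?A n. multi_subst ps w \<in> words ?A N) \<and>
      (\<forall>u v. u @ a # v \<in> words ?A n \<longrightarrow> c (multi_subst ps (u @ a # v)) = c (multi_subst ps (u @ b # v))))"
    using letter_insensitive_subspace[of ?A a b r n] insert.hyps a by blast
  show ?case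
  proof (intro exI[of _ N] allI impI)
    fix c :: "'b list \<Rightarrow> nat"
    assume c: "c \<in> words ?A N \<rightarrow> {..<r}"
    obtain ps where ps: "length ps = n" "\<forall>p \<in> set ps. None \<in> set p \<and> set p \<subseteq> opts ?A"
      "\<forall>w \<in> words ?A n. multi_subst ps w \<in> words ?A N"
      and ins: "\<And>u v. u @ a # v \<in> words ?A n \<Longrightarrow> c (multi_subst ps (u @ a # v)) = c (multi_subst ps (u @ b # v))"
      using N[OF c] by blast
    have AA: "words A n \<subseteq> words ?A n" by (auto simp: words_def)
    have "(\<lambda>w. c (multi_subst ps w)) \<in> words A n \<rightarrow> {..<r}"
      using c ps(3) AA by blast
    from n[OF this] obtain P where P: "length P = n" "None \<in> set P" "set P \<subseteq> opts A"
      and Pc: "\<And>d e. d \<in> A \<Longrightarrow> e \<in> A \<Longrightarrow> c (multi_subst ps (subst P d)) = c (multi_subst ps (subst P e))"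
      by blast
    \<comment> \<open>The line \<open>P\<close> read inside the subspace: a variable of
      \<open>P\<close> becomes the block with its own variable, a letter \<open>d\<close> becomes
      the block with \<open>d\<close> filled in.\<close>
    define Q where "Q = concat (map2 (\<lambda>p x. case x of None \<Rightarrow> p | Some d \<Rightarrow> map Some (subst p d)) ps P)"
    have QP: "subst Q d = multi_subst ps (subst P d)" for d
    proof -
      have "subst (concat (map2 (\<lambda>p x. case x of None \<Rightarrow> p | Some d \<Rightarrow> map Some (subst p d)) ps' P')) d
          = multi_subst ps' (subst P' d)" for ps' :: "'b option list list" and P'
      proof (induction ps' arbitrary: P')
        case (Cons p ps')
        then show ?case by (cases P'; cases "hd P'") auto
      qed simp
      then show ?thesis by (simp add: Q_def)
    qed
    \<comment> \<open>The occurrences of the variable are changed from \<open>a\<close> to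
      \<open>b\<close> one at a time, from left to right; the part \<open>u\<close> already passed
      may therefore contain both letters.\<close>
    have sw: "c (multi_subst ps (u @ subst P' a)) = c (multi_subst ps (u @ subst P' b))"
      if "set u \<subseteq> ?A" "set P' \<subseteq> opts ?A" "length u + length P' = n" for u P'
      using that
    proof (induction P' arbitrary: u)
      case (Cons x P')
      show ?case
      proof (cases x)
        case None
        have "c (multi_subst ps (u @ a # subst P' a)) = c (multi_subst ps (u @ b # subst P' a))"
          using Cons.prems a subst_set[of P' ?A a] by (intro ins) (auto simp: words_def)
        also have "\<dots> = c (multi_subst ps (u @ b # subst P' b))"
          using Cons.IH[of "u @ [b]"] Cons.prems by simp
        finally show ?thesis using None by simp
      next
        case (Some d)
        then show ?thesis using Cons.IH[of "u @ [d]"] Cons.prems by auto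
      qed
    qed simp
    have Pab: "c (multi_subst ps (subst P b)) = c (multi_subst ps (subst P a))"
    proof -
      have "set P \<subseteq> opts ?A" using P(3) by blast
      then show ?thesis using sw[of "[]" P] P(1) by simp
    qed
    have Qset: "set Q \<subseteq> opts ?A"
    proof
      fix y assume "y \<in> set Q"
      then obtain p x where px: "(p, x) \<in> set (zip ps P)"
        and y: "y \<in> set (case x of None \<Rightarrow> p | Some d \<Rightarrow> map Some (subst p d))"
        by (auto simp: Q_def)
      then have "p \<in> set ps" "x \<in> set P" by (auto dest: set_zip_leftD set_zip_rightD)
      then have "set p \<subseteq> opts ?A" "x \<in> opts A" using ps P by auto
      then show "y \<in> opts ?A"
        using y subst_set[of p ?A] by (cases x) auto
    qed
    have Qnone: "None \<in> set Q"
    proof -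
      obtain l where l: "l < n" "P ! l = None" using P by (metis in_set_conv_nth)
      then have "(ps ! l, None) \<in> set (zip ps P)"
        using ps P by (auto simp: set_zip)
      moreover have "None \<in> set (ps ! l)" using ps l by auto
      ultimately show ?thesis by (force simp: Q_def)
    qed
    have "multi_subst ps (subst P a) \<in> words ?A N"
      using ps(3) subst_words[of P ?A n a] P a by auto
    then have Qlen: "length Q = N"
      using QP[of a] by (auto simp: words_def) (metis subst_simps(8))
    show "\<exists>P. length P = N \<and> None \<in> set P \<and> set P \<subseteq> opts ?A \<and>
       (\<forall>a \<in> ?A. \<forall>b \<in> ?A. c (subst P a) = c (subst P b))"
    proof (intro exI[of _ Q] conjI ballI Qset Qnone Qlen)
      fix d e assume "d \<in> ?A" "e \<in> ?A"
      then have "c (subst Q d) = c (subst Q a)" "c (subst Q e) = c (subst Q a)"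
        using Pab Pc[of _ a] a unfolding QP by blast+
      then show "c (subst Q d) = c (subst Q e)" by simp
    qed
  qed
qed

corollary Hales_Jewett:
  fixes A :: "'b set"
  assumes "finite A" "A \<noteq> {}" "finite F"
  shows "\<exists>N. \<forall>c. c \<in> words A N \<rightarrow> F \<longrightarrow>
    (\<exists>P. length P = N \<and> None \<in> set P \<and> set P \<subseteq> opts A \<and>
       (\<forall>a \<in> A. \<forall>b \<in> A. c (subst P a) = c (subst P b)))"
proof -
  obtain g where g: "bij_betw g F {0..<card F}"
    using ex_bij_betw_finite_nat[OF assms(3)] by blast
  obtain N where N: "\<And>c::'b list \<Rightarrow> nat. c \<in> words A N \<rightarrow> {..<card F} \<Longrightarrow>
    (\<exists>P. length P = N \<and> None \<in> set P \<and> set P \<subseteq> opts A \<and>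
       (\<forall>a \<in> A. \<forall>b \<in> A. c (subst P a) = c (subst P b)))"
    using Hales_Jewett_nat[OF assms(1,2), of "card F"] by blast
  show ?thesis
  proof (intro exI[of _ N] allI impI)
    fix c assume c: "c \<in> words A N \<rightarrow> F"
    then have "(\<lambda>w. g (c w)) \<in> words A N \<rightarrow> {..<card F}"
      using g by (auto dest!: bij_betwE)
    from N[OF this] obtain P where P: "length P = N" "None \<in> set P" "set P \<subseteq> opts A"
      "\<forall>a \<in> A. \<forall>b \<in> A. g (c (subst P a)) = g (c (subst P b))"
      by blast
    have "c (subst P a) = c (subst P b)" if "a \<in> A" "b \<in> A" for a b
      using P that c g subst_words[of P A N] by (metis PiE bij_betw_inv_into_left)
    then show "\<exists>P. length P = N \<and> None \<in> set P \<and> set P \<subseteq> opts A \<and>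
       (\<forall>a \<in> A. \<forall>b \<in> A. c (subst P a) = c (subst P b))"
      using P by blast
  qed
qed

section \<open>A finite Carlson-Simpson theorem\<close>

abbreviation short_words :: "'b set \<Rightarrow> nat \<Rightarrow> 'b list set" where
  "short_words A n \<equiv> {w. set w \<subseteq> A \<and> length w \<le> n}"

text \<open>Left variable words. Because a block begins with its variable, substituting
  \<open>a\<close> makes the word continue with \<open>a\<close> itself: a direction chosen in the
  small tree is the direction taken in the large one, and the vertex carrying a variable is met at
  its first occurrence.\<close>

definition left_var :: "'b set \<Rightarrow> 'b option list \<Rightarrow> bool" where
  "left_var A p \<longleftrightarrow> (\<exists>q. p = None # q \<and> set q \<subseteq> opts A)"

lemma left_var_opts: "left_var A p \<Longrightarrow> set p \<subseteq> opts A"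
  by (auto simp: left_var_def)

text \<open>Induction on the dimension, splitting off the first block. By induction the tail
  influences the colour only through the number of its letters, uniformly in the head; a
  Hales-Jewett line among the heads then removes the dependence on the first letter.\<close>

lemma Carlson_Simpson_by_length:
  fixes A :: "'b set"
  assumes A: "finite A" "A \<noteq> {}"
  shows "\<exists>N. \<forall>c::'b list \<Rightarrow> nat. c \<in> short_words A N \<rightarrow> {..<r} \<longrightarrow>
    (\<exists>w0 ps. length ps = n \<and> set w0 \<subseteq> A \<and> (\<forall>p \<in> set ps. left_var A p) \<and>
      (\<forall>w \<in> short_words A n. length (w0 @ multi_subst ps w) \<le> N \<and>
        (\<forall>v \<in> short_words A n. length v = length w \<longrightarrow>
           c (w0 @ multi_subst ps v) = c (w0 @ multi_subst ps w))))"
proof (induction n arbitrary: r)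
  case 0
  show ?case
    by (rule exI[of _ 0], intro allI impI, rule exI[of _ "[]"], rule exI[of _ "[]"]) auto
next
  case (Suc n)
  obtain a0 where a0: "a0 \<in> A" using A by blast
  have finC: "finite ({..n} \<rightarrow>\<^sub>E {..<r})" by (simp add: finite_PiE)
  \<comment> \<open>A head is coloured by the function that assigns to each number \<open>j\<close>
    of tail letters, from 0 to \<open>n\<close>, the colour of the whole word.\<close>
  obtain H where H: "\<And>c. c \<in> words A H \<rightarrow> ({..n} \<rightarrow>\<^sub>E {..<r}) \<Longrightarrow>
    (\<exists>P. length P = H \<and> None \<in> set P \<and> set P \<subseteq> opts A \<and>
       (\<forall>a \<in> A. \<forall>b \<in> A. c (subst P a) = c (subst P b)))"
    using Hales_Jewett[OF A finC] by blast
  define G where "G = words A H \<rightarrow>\<^sub>E {..<r}"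
  have finG: "finite G"
    using finite_words[OF A(1)] by (auto simp: G_def intro!: finite_PiE)
  obtain g where g: "bij_betw g G {0..<card G}"
    using ex_bij_betw_finite_nat[OF finG] by blast
  obtain N' where N': "\<And>c::'b list \<Rightarrow> nat. c \<in> short_words A N' \<rightarrow> {..<card G} \<Longrightarrow>
    (\<exists>w0 ps. length ps = n \<and> set w0 \<subseteq> A \<and> (\<forall>p \<in> set ps. left_var A p) \<and>
      (\<forall>w \<in> short_words A n. length (w0 @ multi_subst ps w) \<le> N' \<and>
        (\<forall>v \<in> short_words A n. length v = length w \<longrightarrow>
           c (w0 @ multi_subst ps v) = c (w0 @ multi_subst ps w))))"
    using Suc.IH[of "card G"] by blast
  show ?case
  proof (intro exI[of _ "H + N'"] allI impI)
    fix c :: "'b list \<Rightarrow> nat"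
    assume c: "c \<in> short_words A (H + N') \<rightarrow> {..<r}"
    define c1 where "c1 y = (\<lambda>x \<in> words A H. c (x @ y))" for y
    have c1G: "c1 y \<in> G" if "y \<in> short_words A N'" for y
    proof -
      have "x @ y \<in> short_words A (H + N')" if "x \<in> words A H" for x
        using that \<open>y \<in> _\<close> by (auto simp: words_def)
      from funcset_mem[OF c this] show ?thesis by (auto simp: c1_def G_def)
    qed
    then have "(\<lambda>y. g (c1 y)) \<in> short_words A N' \<rightarrow> {..<card G}"
      using g by (fastforce dest!: bij_betwE)
    from N'[OF this] obtain w0 ps where ps: "length ps = n" "set w0 \<subseteq> A" "\<forall>p \<in> set ps. left_var A p"
      and len: "\<And>w. w \<in> short_words A n \<Longrightarrow> length (w0 @ multi_subst ps w) \<le> N'"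
      and gc: "\<And>v w. w \<in> short_words A n \<Longrightarrow> v \<in> short_words A n \<Longrightarrow> length v = length w \<Longrightarrow>
           g (c1 (w0 @ multi_subst ps v)) = g (c1 (w0 @ multi_subst ps w))"
      by blast
    have tailw: "w0 @ multi_subst ps w \<in> short_words A N'" if "w \<in> short_words A n" for w
      using len[OF that] that ps multi_subst_set[of ps A w] by (simp add: left_var_opts)
    have c_eq: "c (x @ w0 @ multi_subst ps v) = c (x @ w0 @ multi_subst ps w)"
      if "x \<in> words A H" "w \<in> short_words A n" "v \<in> short_words A n" "length v = length w" for x v w
    proof -
      have "c1 (w0 @ multi_subst ps v) = c1 (w0 @ multi_subst ps w)"
        using gc[OF that(2-4)] c1G[OF tailw[OF that(2)]] c1G[OF tailw[OF that(3)]] g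
        by (metis bij_betw_inv_into_left)
      from fun_cong[OF this, of x] that(1) show ?thesis by (simp add: c1_def)
    qed
    have repl: "replicate j a0 \<in> short_words A n" if "j \<le> n" for j
      using that a0 by auto
    define c2 where "c2 x = (\<lambda>j \<in> {..n}. c (x @ w0 @ multi_subst ps (replicate j a0)))" for x
    have "c2 \<in> words A H \<rightarrow> ({..n} \<rightarrow>\<^sub>E {..<r})"
    proof
      fix x assume x: "x \<in> words A H"
      have "x @ w0 @ multi_subst ps (replicate j a0) \<in> short_words A (H + N')" if "j \<le> n" for j
        using x tailw[OF repl[OF that]] by (auto simp: words_def)
      from funcset_mem[OF c this] show "c2 x \<in> {..n} \<rightarrow>\<^sub>E {..<r}"
        by (auto simp: c2_def)
    qed
    from H[OF this] obtain P where P: "length P = H" "None \<in> set P" "set P \<subseteq> opts A"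
      and Pc: "\<And>a b. a \<in> A \<Longrightarrow> b \<in> A \<Longrightarrow> c2 (subst P a) = c2 (subst P b)"
      by blast
    \<comment> \<open>The letters before the first variable of the line go into the constant
      beginning, so that the new block starts with its variable.\<close>
    obtain P0 P1 where P01: "P = P0 @ None # P1" "None \<notin> set P0"
      using split_list_first[OF P(2)] by blast
    define p where "p = map the P0"
    have P0p: "P0 = map Some p"
      using P01(2) by (auto simp: p_def o_def intro!: map_idI[symmetric]) (metis not_None_eq option.sel)
    have pA: "set p \<subseteq> A"
      using P(3) P01(1) P0p by auto
    have p1: "set P1 \<subseteq> opts A"
      using P(3) P01(1) by auto
    \<comment> \<open>The constant beginning \<open>w0\<close> of the tail becomes the end of the
      new first block; it appears only once that block has received its letter.\<close>
    define ps' where "ps' = ((None # P1) @ map Some w0) # ps"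
    have eq: "p @ multi_subst ps' (a # w) = subst P a @ w0 @ multi_subst ps w" for a w
      by (simp add: ps'_def P01(1) P0p)
    have main: "length (p @ multi_subst ps' w) \<le> H + N' \<and>
        (\<forall>v \<in> short_words A (Suc n). length v = length w \<longrightarrow>
           c (p @ multi_subst ps' v) = c (p @ multi_subst ps' w))" if w: "w \<in> short_words A (Suc n)" for w
    proof (cases w)
      case Nil
      then show ?thesis using P(1) P01(1) P0p by auto
    next
      case (Cons a w')
      then have w': "a \<in> A" "w' \<in> short_words A n" using w by auto
      have "c (p @ multi_subst ps' v) = c (p @ multi_subst ps' w)"
        if v: "v \<in> short_words A (Suc n)" "length v = length w" for v
      proof -
        obtain b v' where bv: "v = b # v'" "b \<in> A" "v' \<in> short_words A n" "length v' = length w'"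
          using v Cons by (cases v) auto
        let ?j = "length w'"
        have j: "?j \<le> n" using w' by simp
        have pw: "subst P d \<in> words A H" if "d \<in> A" for d
          using subst_words[OF P(3) P(1) that] .
        have "c (p @ multi_subst ps' v) = c (subst P b @ w0 @ multi_subst ps v')"
          by (simp only: bv(1) eq)
        also have "\<dots> = c (subst P b @ w0 @ multi_subst ps (replicate ?j a0))"
          using c_eq[OF pw[OF bv(2)] repl[OF j] bv(3)] bv(4) by simp
        also have "\<dots> = c (subst P a @ w0 @ multi_subst ps (replicate ?j a0))"
          using fun_cong[OF Pc[OF bv(2) w'(1)], of ?j] j by (simp add: c2_def)
        also have "\<dots> = c (subst P a @ w0 @ multi_subst ps w')"
          using c_eq[OF pw[OF w'(1)] w'(2) repl[OF j]] by simp
        also have "\<dots> = c (p @ multi_subst ps' w)"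
          by (simp only: Cons eq)
        finally show ?thesis .
      qed
      then show ?thesis
        using len[OF w'(2)] P(1) by (simp add: Cons eq del: multi_subst_simps(3))
    qed
    have lv: "\<forall>q \<in> set ps'. left_var A q"
      using ps p1 by (auto simp: ps'_def left_var_def)
    show "\<exists>w0 ps. length ps = Suc n \<and> set w0 \<subseteq> A \<and> (\<forall>p \<in> set ps. left_var A p) \<and>
      (\<forall>w \<in> short_words A (Suc n). length (w0 @ multi_subst ps w) \<le> H + N' \<and>
        (\<forall>v \<in> short_words A (Suc n). length v = length w \<longrightarrow>
           c (w0 @ multi_subst ps v) = c (w0 @ multi_subst ps w)))"
    proof (intro exI[of _ p] exI[of _ ps'] conjI)
      show "length ps' = Suc n" using ps(1) by (simp add: ps'_def)
    qed (use pA lv main in blast)+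
  qed
qed

text \<open>Merging consecutive patterns realizes any increasing sequence of lengths.\<close>

lemma multi_subst_regroup:
  assumes "finite A" "\<forall>p \<in> set ps. left_var A p" "k \<le> length ps"
    and "sorted_wrt (<) (k # ls)" "\<forall>l \<in> set ls. l \<le> length ps"
  shows "\<exists>qs. length qs = length ls \<and> (\<forall>q \<in> set qs. left_var A q) \<and>
    (\<forall>w. set w \<subseteq> A \<longrightarrow> length w \<le> length ls \<longrightarrow>
      (\<exists>v. set v \<subseteq> A \<and> length v + k = (k # ls) ! length w \<and>
        multi_subst qs w = multi_subst (drop k ps) v))"
  using assms(3-)
proof (induction ls arbitrary: k)
  case Nil
  then show ?case by (auto intro!: exI[of _ "[]"])
next
  case (Cons l ls)
  have kl: "k < l" "l \<le> length ps" using Cons.prems by auto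
  obtain qs where qs: "length qs = length ls" "\<forall>q \<in> set qs. left_var A q"
    and IH: "\<And>w. set w \<subseteq> A \<Longrightarrow> length w \<le> length ls \<Longrightarrow>
      \<exists>v. set v \<subseteq> A \<and> length v + l = (l # ls) ! length w \<and> multi_subst qs w = multi_subst (drop l ps) v"
    using Cons.IH[of l] Cons.prems kl by auto
  define ms where "ms = take (l - k) (drop k ps)"
  have dk: "drop k ps = ms @ drop l ps"
    using kl by (simp add: ms_def drop_drop) (metis add.commute append_take_drop_id drop_drop le_add_diff_inverse2 less_or_eq_imp_le)
  have ms: "length ms = l - k" "\<forall>p \<in> set ms. left_var A p"
    using kl assms(2) by (auto simp: ms_def dest!: in_set_takeD in_set_dropD)
  have lvm: "left_var A (concat ms)"
    using ms kl by (cases ms) (fastforce simp: left_var_def)+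
  have rep: "multi_subst ms' (replicate (length ms') a) = subst (concat ms') a" for ms' :: "'a option list list" and a
    by (induction ms') auto
  show ?case
  proof (intro exI[of _ "concat ms # qs"] conjI allI impI)
    show "length (concat ms # qs) = length (l # ls)" using qs by simp
    show "\<forall>q \<in> set (concat ms # qs). left_var A q" using qs lvm by simp
    fix w assume w: "set w \<subseteq> A" "length w \<le> length (l # ls)"
    show "\<exists>v. set v \<subseteq> A \<and> length v + k = (k # l # ls) ! length w \<and>
        multi_subst (concat ms # qs) w = multi_subst (drop k ps) v"
    proof (cases w)
      case Nil
      then show ?thesis by (intro exI[of _ "[]"]) simp
    next
      case (Cons a w')
      then obtain v where v: "set v \<subseteq> A" "length v + l = (l # ls) ! length w'"
        "multi_subst qs w' = multi_subst (drop l ps) v"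
        using IH[of w'] w by auto
      have "multi_subst (drop k ps) (replicate (length ms) a @ v) = subst (concat ms) a @ multi_subst (drop l ps) v"
        unfolding dk by (simp add: multi_subst_append rep del: subst_simps)
      then show ?thesis
        using v Cons w ms kl by (intro exI[of _ "replicate (length ms) a @ v"]) (simp add: set_replicate_conv_if)
    qed
  qed
qed

text \<open>Once the colour depends only on the length, \<open>n + 1\<close> lengths of equal colour
  are enough: merging the blocks between consecutive ones gives a subspace of dimension
  \<open>n\<close> whose words realize precisely these lengths.\<close>

theorem Carlson_Simpson:
  fixes A :: "'b set"
  assumes A: "finite A" "A \<noteq> {}" and r: "r > 0"
  shows "\<exists>N. \<forall>c::'b list \<Rightarrow> nat. c \<in> short_words A N \<rightarrow> {..<r} \<longrightarrow>
    (\<exists>w0 ps \<rho>. length ps = n \<and> set w0 \<subseteq> A \<and> (\<forall>p \<in> set ps. left_var A p) \<and>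
      (\<forall>w \<in> short_words A n. length (w0 @ multi_subst ps w) \<le> N \<and> c (w0 @ multi_subst ps w) = \<rho>))"
proof -
  obtain a0 where a0: "a0 \<in> A" using A by blast
  \<comment> \<open>There are \<open>r * n + 1\<close> lengths from 0 to \<open>m\<close>, and
    \<open>r\<close> colours, so one colour occurs at least \<open>n + 1\<close> times.\<close>
  define m where "m = r * n"
  obtain N where N: "\<And>c::'b list \<Rightarrow> nat. c \<in> short_words A N \<rightarrow> {..<r} \<Longrightarrow>
    (\<exists>w0 ps. length ps = m \<and> set w0 \<subseteq> A \<and> (\<forall>p \<in> set ps. left_var A p) \<and>
      (\<forall>w \<in> short_words A m. length (w0 @ multi_subst ps w) \<le> N \<and>
        (\<forall>v \<in> short_words A m. length v = length w \<longrightarrow>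
           c (w0 @ multi_subst ps v) = c (w0 @ multi_subst ps w))))"
    using Carlson_Simpson_by_length[OF A, of r m] by blast
  show ?thesis
  proof (intro exI[of _ N] allI impI)
    fix c :: "'b list \<Rightarrow> nat"
    assume c: "c \<in> short_words A N \<rightarrow> {..<r}"
    obtain w0 ps where ps: "length ps = m" "set w0 \<subseteq> A" "\<forall>p \<in> set ps. left_var A p"
      and len: "\<And>w. w \<in> short_words A m \<Longrightarrow> length (w0 @ multi_subst ps w) \<le> N"
      and ceq: "\<And>v w. w \<in> short_words A m \<Longrightarrow> v \<in> short_words A m \<Longrightarrow> length v = length w \<Longrightarrow>
           c (w0 @ multi_subst ps v) = c (w0 @ multi_subst ps w)"
      using N[OF c] by blast
    have mem: "w0 @ multi_subst ps w \<in> short_words A N" if "w \<in> short_words A m" for w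
      using len[OF that] that ps multi_subst_set[of ps A w] by (simp add: left_var_opts)
    define d where "d l = c (w0 @ multi_subst ps (replicate l a0))" for l
    have repl: "replicate l a0 \<in> short_words A m" if "l \<le> m" for l
      using that a0 by auto
    have dr: "d l < r" if "l \<le> m" for l
      using funcset_mem[OF c mem[OF repl[OF that]]] by (simp add: d_def)
    have "\<exists>\<rho> < r. card {l. l \<le> m \<and> d l = \<rho>} \<ge> Suc n"
    proof (rule ccontr)
      assume "\<not> ?thesis"
      then have le: "card {l. l \<le> m \<and> d l = \<rho>} \<le> n" if "\<rho> < r" for \<rho>
        using that by (meson not_less_eq_eq)
      have "{..m} = (\<Union>\<rho> \<in> {..<r}. {l. l \<le> m \<and> d l = \<rho>})"
        using dr by auto
      then have "Suc m \<le> (\<Sum>\<rho><r. card {l. l \<le> m \<and> d l = \<rho>})"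
        using card_UN_le[of "{..<r}" "\<lambda>\<rho>. {l. l \<le> m \<and> d l = \<rho>}"] by (metis card_atMost finite_lessThan)
      also have "\<dots> \<le> (\<Sum>\<rho><r. n)"
        using le by (intro sum_mono) auto
      finally show False by (simp add: m_def)
    qed
    then obtain \<rho> where \<rho>: "card {l. l \<le> m \<and> d l = \<rho>} \<ge> Suc n" by blast
    define L where "L = sorted_list_of_set {l. l \<le> m \<and> d l = \<rho>}"
    have L: "sorted_wrt (<) L" "length L \<ge> Suc n" "\<And>l. l \<in> set L \<Longrightarrow> l \<le> m \<and> d l = \<rho>"
      using \<rho> by (auto simp: L_def)
    obtain l0 ls where Ll: "take (Suc n) L = l0 # ls"
      using L(2) by (cases L) auto
    have ls: "sorted_wrt (<) (l0 # ls)" "length ls = n" "\<And>l. l \<in> set (l0 # ls) \<Longrightarrow> l \<le> m \<and> d l = \<rho>"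
    proof -
      show "sorted_wrt (<) (l0 # ls)" using L(1) sorted_wrt_take unfolding Ll[symmetric] by blast
      show "length ls = n" using L(2) arg_cong[OF Ll, of length] by simp
      show "l \<le> m \<and> d l = \<rho>" if "l \<in> set (l0 # ls)" for l
        using that L(3) unfolding Ll[symmetric] by (blast dest: in_set_takeD)
    qed
    obtain qs where qs: "length qs = length ls" "\<forall>q \<in> set qs. left_var A q"
      and qw: "\<And>w. set w \<subseteq> A \<Longrightarrow> length w \<le> length ls \<Longrightarrow>
      \<exists>v. set v \<subseteq> A \<and> length v + l0 = (l0 # ls) ! length w \<and> multi_subst qs w = multi_subst (drop l0 ps) v"
      using multi_subst_regroup[OF A(1) ps(3), of l0 ls] ls ps(1) by auto
    \<comment> \<open>The blocks before the smallest chosen length are filled with the fixed letter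
      \<open>a0\<close> and join the constant beginning.\<close>
    define v0 where "v0 = w0 @ multi_subst (take l0 ps) (replicate l0 a0)"
    have l0: "l0 \<le> m" using ls(3) by simp
    have key: "length (v0 @ multi_subst qs w) \<le> N \<and> c (v0 @ multi_subst qs w) = \<rho>" if w: "w \<in> short_words A n" for w
    proof -
      obtain v where v: "set v \<subseteq> A" "length v + l0 = (l0 # ls) ! length w"
        "multi_subst qs w = multi_subst (drop l0 ps) v"
        using qw[of w] w ls(2) by auto
      let ?v = "replicate l0 a0 @ v"
      have "multi_subst ps ?v = multi_subst (take l0 ps) (replicate l0 a0) @ multi_subst (drop l0 ps) v"
        using multi_subst_append[of "replicate l0 a0" "take l0 ps" "drop l0 ps" v] l0 ps(1) by simp
      then have e: "v0 @ multi_subst qs w = w0 @ multi_subst ps ?v"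
        by (simp add: v0_def v(3))
      have "(l0 # ls) ! length w \<in> set (l0 # ls)"
        using w ls(2) by (intro nth_mem) auto
      then have lv: "length ?v \<le> m" "d (length ?v) = \<rho>"
        using ls(3) v(2) by (auto simp: add.commute)
      have vm: "?v \<in> short_words A m" using lv v(1) a0 by auto
      have "c (w0 @ multi_subst ps ?v) = d (length ?v)"
        unfolding d_def by (rule ceq) (use vm repl[OF lv(1)] in auto)
      then show ?thesis
        using e len[OF vm] lv(2) by simp
    qed
    have "set v0 \<subseteq> A"
    proof -
      have "set (multi_subst (take l0 ps) (replicate l0 a0)) \<subseteq> A"
        using ps(3) left_var_opts a0 by (intro multi_subst_set) (auto dest!: in_set_takeD)
      then show ?thesis using ps(2) by (simp add: v0_def)
    qed
    then show "\<exists>w0 ps \<rho>. length ps = n \<and> set w0 \<subseteq> A \<and> (\<forall>p \<in> set ps. left_var A p) \<and>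
      (\<forall>w \<in> short_words A n. length (w0 @ multi_subst ps w) \<le> N \<and> c (w0 @ multi_subst ps w) = \<rho>)"
    proof (intro exI[of _ v0] exI[of _ qs] exI[of _ \<rho>] conjI ballI)
      show "length qs = n" using qs(1) ls(2) by simp
    qed (use qs(2) key in blast)+
  qed
qed

section \<open>Trees of lists\<close>

abbreviation lcp :: "nat list \<Rightarrow> nat list \<Rightarrow> nat list" where
  "lcp \<equiv> longest_common_prefix"

lemma prefix_imp_le: "prefix x y \<Longrightarrow> x \<le> (y::nat list)"
proof (induction x arbitrary: y)
  case (Cons a x)
  then show ?case by (cases y) auto
qed simp

lemma strict_prefix_imp_less: "strict_prefix x y \<Longrightarrow> x < (y::nat list)"
  by (simp add: strict_prefix_def prefix_imp_le order_less_le)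

lemma append_less_cancel [simp]: "p @ x < p @ y \<longleftrightarrow> x < (y::nat list)"
  by (induction p) auto

lemma append_le_cancel [simp]: "p @ x \<le> p @ y \<longleftrightarrow> x \<le> (y::nat list)"
  by (induction p) auto

lemma lcp_append [simp]: "lcp (p @ x) (p @ y) = p @ lcp x y"
  by (induction p) auto

lemma lcp_prefix [simp]: "prefix (lcp x y) x" "prefix (lcp x y) y"
  by (rule longest_common_prefix_prefix1 longest_common_prefix_prefix2)+

lemma lcp_eqI:
  "prefix z x \<Longrightarrow> prefix z y \<Longrightarrow> (\<And>w. prefix w x \<Longrightarrow> prefix w y \<Longrightarrow> prefix w z) \<Longrightarrow> lcp x y = z"
  by (meson longest_common_prefix_max_prefix lcp_prefix prefix_order.antisym)

lemma lcp_commute: "lcp x y = lcp y x"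
  by (intro lcp_eqI) (auto intro: longest_common_prefix_max_prefix)

lemma lcp_eq_left_iff: "lcp x y = x \<longleftrightarrow> prefix x y"
  by (metis lcp_eqI lcp_prefix(2) prefix_order.refl)

lemma lcp_eq_right_iff: "lcp x y = y \<longleftrightarrow> prefix y x"
  by (metis lcp_eq_left_iff lcp_commute)

lemma lcp_diverge: "a \<noteq> b \<Longrightarrow> lcp (p @ a # x) (p @ b # y) = p"
  by simp

lemma less_cases:
  assumes "x < (y::nat list)"
  obtains "strict_prefix x y"
  | p a b q q' where "x = p @ a # q" "y = p @ b # q'" "a < b"
proof -
  let ?p = "lcp x y"
  obtain u v where u: "x = ?p @ u" and v: "y = ?p @ v"
    by (metis lcp_prefix prefixE)
  show thesis
  proof (cases u)
    case Nil
    then show thesis using u assms that(1) lcp_eq_left_iff by (metis append_Nil2 order_less_irrefl strict_prefix_def)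
  next
    case (Cons a q)
    have "u < v" using assms u v append_less_cancel by metis
    then obtain b q' where v': "v = b # q'" using Cons by (cases v) auto
    have "lcp u v = []" using u v by (metis append_self_conv lcp_append)
    then have "a \<noteq> b" using Cons v' by (auto split: if_splits)
    then show thesis using \<open>u < v\<close> Cons v' u v that(2) by auto
  qed
qed

text \<open>The tree order is the prefix order, the linear order is the lexicographic one, and meets are
  longest common prefixes. Labels of siblings need not be consecutive.\<close>

definition ltree :: "nat list set \<Rightarrow> bool" where
  "ltree C \<longleftrightarrow> finite C \<and> [] \<in> C \<and> (\<forall>x \<in> C. \<forall>y. prefix y x \<longrightarrow> y \<in> C)"

definition lemb :: "nat list set \<Rightarrow> (nat list \<Rightarrow> nat list) \<Rightarrow> bool" where
  "lemb S i \<longleftrightarrow> i [] = [] \<and> (\<forall>x \<in> S. \<forall>y \<in> S. x < y \<longrightarrow> i x < i y) \<and>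
     (\<forall>x \<in> S. \<forall>y \<in> S. i (lcp x y) = lcp (i x) (i y))"

definition below :: "nat list set \<Rightarrow> nat list \<Rightarrow> nat list set" where
  "below T v = {y \<in> T. y \<le> v}"

lemma below_iff [simp]: "y \<in> below T v \<longleftrightarrow> y \<in> T \<and> y \<le> v"
  by (simp add: below_def)

lemma ltreeD: "ltree C \<Longrightarrow> finite C" "ltree C \<Longrightarrow> [] \<in> C" "ltree C \<Longrightarrow> x \<in> C \<Longrightarrow> prefix y x \<Longrightarrow> y \<in> C"
  unfolding ltree_def by blast+

lemma ltree_lcp: "ltree C \<Longrightarrow> x \<in> C \<Longrightarrow> lcp x y \<in> C"
  using ltreeD(3) lcp_prefix by blast

lemma ltree_below: "ltree C \<Longrightarrow> ltree (below C v)"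
  unfolding ltree_def below_def by (auto dest: prefix_imp_le order.trans)

lemma ltree_Max: "ltree C \<Longrightarrow> Max C \<in> C" "ltree C \<Longrightarrow> x \<in> C \<Longrightarrow> x \<le> Max C"
  using ltreeD by (auto intro!: Max_in Max_ge)

lemma lembD:
  assumes "lemb S i"
  shows "i [] = []" "x \<in> S \<Longrightarrow> y \<in> S \<Longrightarrow> x < y \<Longrightarrow> i x < i y"
    "x \<in> S \<Longrightarrow> y \<in> S \<Longrightarrow> i (lcp x y) = lcp (i x) (i y)"
  using assms unfolding lemb_def by blast+

lemma lemb_less_iff:
  assumes "lemb S i" "x \<in> S" "y \<in> S"
  shows "i x < i y \<longleftrightarrow> x < y"
  using lembD(2)[OF assms] lembD(2)[OF assms(1,3,2)] by (cases x y rule: linorder_cases) auto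

lemma lemb_le_iff: "lemb S i \<Longrightarrow> x \<in> S \<Longrightarrow> y \<in> S \<Longrightarrow> i x \<le> i y \<longleftrightarrow> x \<le> y"
  by (simp add: lemb_less_iff flip: linorder_not_less)

lemma lemb_eq_iff:
  assumes "lemb S i" "x \<in> S" "y \<in> S"
  shows "i x = i y \<longleftrightarrow> x = y"
  using lembD(2)[OF assms] lembD(2)[OF assms(1,3,2)] by (cases x y rule: linorder_cases) auto

lemma lemb_prefix_iff:
  assumes "lemb S i" "x \<in> S" "y \<in> S" "lcp x y \<in> S"
  shows "prefix (i x) (i y) \<longleftrightarrow> prefix x y"
  using lemb_eq_iff[OF assms(1,4,2)] lembD(3)[OF assms(1-3)]
  unfolding lcp_eq_left_iff[symmetric] by simp

lemma lemb_cong: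
  assumes "ltree S" "\<And>x. x \<in> S \<Longrightarrow> i x = j x"
  shows "lemb S i \<longleftrightarrow> lemb S j"
  using assms(2) assms(2)[OF ltreeD(2)[OF assms(1)]] assms(2)[OF ltree_lcp[OF assms(1)]]
  unfolding lemb_def by simp

lemma lemb_subset: "lemb T i \<Longrightarrow> S \<subseteq> T \<Longrightarrow> lemb S i"
  unfolding lemb_def by blast

lemma lemb_comp: "lemb S i \<Longrightarrow> ltree S \<Longrightarrow> i ` S \<subseteq> T \<Longrightarrow> lemb T j \<Longrightarrow> lemb S (\<lambda>x. j (i x))"
  unfolding lemb_def by (auto simp: image_subset_iff)

text \<open>Images of descendants extend images of children. If \<open>x\<close> and
  \<open>y\<close> diverge above \<open>p\<close>, then comparing the images of the two children of
  \<open>p\<close> below them therefore decides both the order and the meet.\<close>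

lemma lemb_localI:
  assumes S: "ltree S" and nil: "i [] = []"
    and child: "\<And>x a. x @ [a] \<in> S \<Longrightarrow> strict_prefix (i x) (i (x @ [a]))"
    and sibs: "\<And>x a b. x @ [a] \<in> S \<Longrightarrow> x @ [b] \<in> S \<Longrightarrow> a < b \<Longrightarrow>
      i (x @ [a]) < i (x @ [b]) \<and> lcp (i (x @ [a])) (i (x @ [b])) = i x"
  shows "lemb S i"
proof -
  have pre: "prefix (i x) (i (x @ q))" if "x @ q \<in> S" for x q
    using that
  proof (induction q rule: rev_induct)
    case (snoc a q)
    then have "x @ q \<in> S" using ltreeD(3)[OF S] by (metis append_assoc prefixI)
    then show ?case
      using snoc child[of "x @ q" a] by (metis append_assoc prefix_order.trans strict_prefix_def)
  qed simp
  have div: "i (p @ a # q) < i (p @ b # q') \<and> lcp (i (p @ a # q)) (i (p @ b # q')) = i p"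
    if "a < b" and in1: "p @ a # q \<in> S" and in2: "p @ b # q' \<in> S" for p a b q q'
  proof -
    have m: "p @ [a] \<in> S" "p @ [b] \<in> S"
      using ltreeD(3)[OF S in1] ltreeD(3)[OF S in2] by auto
    note s = sibs[OF m \<open>a < b\<close>]
    from child[OF m(1)] child[OF m(2)] obtain u v where uv: "i (p @ [a]) = i p @ u" "i (p @ [b]) = i p @ v" "u \<noteq> []" "v \<noteq> []"
      by (metis append_Nil2 prefixE strict_prefix_def)
    then obtain c u' d v' where cd: "u = c # u'" "v = d # v'" by (meson list.exhaust)
    have "lcp u v = []" using s uv by simp
    then have "c \<noteq> d" using cd by (auto split: if_splits)
    moreover have "u < v" using s uv by simp
    ultimately have "c < d" using cd by auto
    moreover obtain q1 q2 where "i (p @ a # q) = i p @ c # q1" "i (p @ b # q') = i p @ d # q2"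
      using pre[of "p @ [a]" q] pre[of "p @ [b]" q'] in1 in2 uv cd by (auto simp: prefix_def)
    ultimately show ?thesis by simp
  qed
  have str: "i x < i y" if sp: "strict_prefix x y" and "y \<in> S" for x y
  proof -
    obtain a q where y: "y = x @ [a] @ q"
      using sp by (auto elim!: strict_prefixE')
    then have "x @ [a] \<in> S" using ltreeD(3)[OF S that(2)] by simp
    then have "strict_prefix (i x) (i (x @ [a]))" by (rule child)
    moreover have "prefix (i (x @ [a])) (i y)" using pre[of "x @ [a]" q] y that by simp
    ultimately show ?thesis by (meson prefix_order.less_le_trans strict_prefix_imp_less)
  qed
  have lt: "i x < i y \<and> i (lcp x y) = lcp (i x) (i y)" if "x \<in> S" "y \<in> S" "x < y" for x y
    using that(3)
  proof (cases rule: less_cases)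
    case 1
    then have "lcp x y = x" "prefix (i x) (i y)"
      using pre that by (auto simp: lcp_eq_left_iff strict_prefix_def prefix_def)
    then show ?thesis using str[OF 1] that by (metis lcp_eq_left_iff)
  next
    case (2 p a b q q')
    then show ?thesis using div that by (metis lcp_diverge nat_neq_iff)
  qed
  show ?thesis
    unfolding lemb_def
  proof (intro conjI ballI impI nil)
    fix x y assume "x \<in> S" "y \<in> S"
    then show "i (lcp x y) = lcp (i x) (i y)"
      using lt by (metis lcp_commute lcp_eq_left_iff linorder_less_linear prefix_order.refl)
  qed (use lt in blast)
qed

text \<open>The label \<open>lab x a\<close> is the first direction taken by the image when it
  leaves \<open>i x\<close> towards the child \<open>x @ [a]\<close>; distinct first directions make
  the images of siblings meet in \<open>i x\<close>.\<close>

lemma lemb_label_localI: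
  assumes S: "ltree S" and nil: "i [] = []"
    and child: "\<And>x a. x @ [a] \<in> S \<Longrightarrow> prefix (i x @ [lab x a]) (i (x @ [a]))"
    and mono: "\<And>x a b. x @ [a] \<in> S \<Longrightarrow> x @ [b] \<in> S \<Longrightarrow> a < b \<Longrightarrow> lab x a < lab x b"
  shows "lemb S i"
proof (rule lemb_localI)
  show "ltree S" "i [] = []" by (fact S nil)+
  fix x a assume "x @ [a] \<in> S"
  then show "strict_prefix (i x) (i (x @ [a]))"
    using child by (metis append_self_conv not_Cons_self2 prefix_def prefix_order.less_le_trans strict_prefixI)
next
  fix x a b assume "x @ [a] \<in> S" "x @ [b] \<in> S" "a < (b::nat)"
  then show "i (x @ [a]) < i (x @ [b]) \<and> lcp (i (x @ [a])) (i (x @ [b])) = i x"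
    using child[of x a] child[of x b] mono[of x a b] by (auto simp: prefix_def)
qed

section \<open>Rigid surjections on initial subtrees and their composition\<close>

type_synonym lmor = "(nat list \<Rightarrow> nat list) \<times> (nat list \<Rightarrow> nat list)"

text \<open>Pairs of a rigid surjection \<open>s\<close> onto \<open>S\<close> and its embedding \<open>i\<^sub>s\<close>, where \<open>s\<close> is defined on the
  vertices of \<open>T\<close> up to the image of the largest vertex of \<open>S\<close>.\<close>

definition lhom :: "nat list set \<Rightarrow> nat list set \<Rightarrow> lmor set" where
  "lhom S T = {(s, i). i \<in> S \<rightarrow>\<^sub>E T \<and> lemb S i \<and> s \<in> below T (i (Max S)) \<rightarrow>\<^sub>E S \<and>
     (\<forall>x \<in> S. s (i x) = x) \<and> (\<forall>y \<in> below T (i (Max S)). prefix (i (s y)) y)}"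

definition lcomp :: "nat list set \<Rightarrow> nat list set \<Rightarrow> lmor \<Rightarrow> lmor \<Rightarrow> lmor" where
  "lcomp V S g f = ((\<lambda>y \<in> below V (snd g (snd f (Max S))). fst f (fst g y)), (\<lambda>x \<in> S. snd g (snd f x)))"

definition lrestr :: "nat list set \<Rightarrow> nat list set \<Rightarrow> lmor \<Rightarrow> lmor" where
  "lrestr T S f = (restrict (fst f) (below T (snd f (Max S))), restrict (snd f) S)"

text \<open>This is what makes fusion possible: composing with such a morphism leaves every rigid
  surjection that ends at or before \<open>b\<close> as it is.\<close>

definition fixes_below :: "nat list set \<Rightarrow> nat list \<Rightarrow> lmor \<Rightarrow> bool" where
  "fixes_below T b g \<longleftrightarrow> (\<forall>y \<in> below T b. fst g y = y \<and> snd g y = y)"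

lemma lhomI:
  assumes "\<And>x. x \<in> S \<Longrightarrow> i x \<in> T" "i \<in> extensional S" "lemb S i" "s \<in> extensional (below T (i (Max S)))"
    "\<And>x. x \<in> S \<Longrightarrow> s (i x) = x"
    "\<And>y. y \<in> T \<Longrightarrow> y \<le> i (Max S) \<Longrightarrow> s y \<in> S \<and> prefix (i (s y)) y"
  shows "(s, i) \<in> lhom S T"
  using assms unfolding lhom_def by (auto simp: PiE_iff)

lemma lhomD:
  assumes "(s, i) \<in> lhom S T"
  shows "x \<in> S \<Longrightarrow> i x \<in> T" "i \<in> extensional S" "lemb S i" "s \<in> extensional (below T (i (Max S)))"
    "x \<in> S \<Longrightarrow> s (i x) = x"
    "y \<in> T \<Longrightarrow> y \<le> i (Max S) \<Longrightarrow> s y \<in> S" "y \<in> T \<Longrightarrow> y \<le> i (Max S) \<Longrightarrow> prefix (i (s y)) y"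
  using assms unfolding lhom_def by (auto simp: PiE_iff)

lemma lhom_image_le_end:
  "(s, i) \<in> lhom S T \<Longrightarrow> ltree S \<Longrightarrow> x \<in> S \<Longrightarrow> i x \<le> i (Max S)"
  by (metis lemb_le_iff lhomD(3) ltree_Max)

lemma finite_lhom:
  assumes "ltree S" "ltree T"
  shows "finite (lhom S T)"
proof -
  have "lhom S T \<subseteq> (\<Union>v \<in> T. below T v \<rightarrow>\<^sub>E S) \<times> (S \<rightarrow>\<^sub>E T)"
  proof
    fix f assume "f \<in> lhom S T"
    then obtain s i where f: "f = (s, i)" "i \<in> S \<rightarrow>\<^sub>E T" "s \<in> below T (i (Max S)) \<rightarrow>\<^sub>E S"
      by (auto simp: lhom_def)
    moreover from this have "i (Max S) \<in> T" using ltree_Max(1)[OF assms(1)] by blast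
    ultimately show "f \<in> (\<Union>v \<in> T. below T v \<rightarrow>\<^sub>E S) \<times> (S \<rightarrow>\<^sub>E T)" by blast
  qed
  moreover have "finite \<dots>"
    using ltreeD(1)[OF assms(1)] ltreeD(1)[OF assms(2)] ltreeD(1)[OF ltree_below[OF assms(2)]]
    by (intro finite_SigmaI finite_UN_I finite_PiE) auto
  ultimately show ?thesis by (rule finite_subset)
qed

text \<open>As \<open>j (t y)\<close> is a prefix of \<open>y\<close>, it is at most
  \<open>y\<close> and hence at most \<open>j v\<close>, and \<open>j\<close> reflects the order.
  Thus \<open>t\<close> respects initial subtrees, without which composites would not be
  defined.\<close>

lemma lhom_pullback_le:
  assumes g: "(t, j) \<in> lhom T V" and T: "ltree T" and v: "v \<in> T" and y: "y \<in> V" "y \<le> j v"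
  shows "y \<le> j (Max T)" "t y \<in> T" "t y \<le> v" "prefix (j (t y)) y"
proof -
  show 1: "y \<le> j (Max T)" using lhom_image_le_end[OF g T v] y by order
  show 2: "t y \<in> T" using lhomD(6)[OF g y(1) 1] .
  show 3: "prefix (j (t y)) y" using lhomD(7)[OF g y(1) 1] .
  then have "j (t y) \<le> j v" using prefix_imp_le y by (meson order.trans)
  then show "t y \<le> v" using lemb_le_iff[OF lhomD(3)[OF g] 2 v] by simp
qed

lemma lhom_pullback_less:
  assumes g: "(t, j) \<in> lhom T V" and T: "ltree T" and v: "v \<in> T" and y: "y \<in> V" "y < j v"
  shows "t y < v"
proof -
  note p = lhom_pullback_le[OF g T v y(1) order.strict_implies_order[OF y(2)]]
  have "j (t y) < j v" using prefix_imp_le[OF p(4)] y by order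
  then show ?thesis using lemb_less_iff[OF lhomD(3)[OF g] p(2) v] by simp
qed

lemma lcomp_in_lhom:
  assumes S: "ltree S" and T: "ltree T" and f: "f \<in> lhom S T" and g: "g \<in> lhom T V"
  shows "lcomp V S g f \<in> lhom S V"
proof -
  obtain s i t j where [simp]: "f = (s, i)" "g = (t, j)" by (metis surj_pair)
  note fD = lhomD[OF f[simplified]] and gD = lhomD[OF g[simplified]]
  have MS: "Max S \<in> S" using ltree_Max S by blast
  have e: "lemb S (\<lambda>x. j (i x))"
    using lemb_comp[OF fD(3) S _ gD(3)] fD(1) by blast
  show ?thesis
    unfolding lcomp_def \<open>f = _\<close> \<open>g = _\<close> fst_conv snd_conv
  proof (rule lhomI)
    show "lemb S (restrict (\<lambda>x. j (i x)) S)"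
      using e lemb_cong[OF S, of "\<lambda>x. j (i x)" "restrict (\<lambda>x. j (i x)) S"] by simp
  next
    fix x assume x: "x \<in> S"
    then have "j (i x) \<le> j (i (Max S))"
      using lhom_image_le_end[OF f[simplified] S x] lemb_le_iff[OF gD(3)] fD(1) MS by blast
    then show "restrict (\<lambda>y. s (t y)) (below V (j (i (Max S)))) (restrict (\<lambda>x. j (i x)) S x) = x"
      using x fD gD by simp
  next
    fix y assume y: "y \<in> V" "y \<le> restrict (\<lambda>x. j (i x)) S (Max S)"
    then have y': "y \<le> j (i (Max S))" using MS by simp
    note p = lhom_pullback_le[OF g[simplified] T fD(1)[OF MS] y(1) y']
    have st: "s (t y) \<in> S" "prefix (i (s (t y))) (t y)"
      using fD(6,7) p by blast+
    have "prefix (j (i (s (t y)))) (j (t y))"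
      using lemb_prefix_iff[OF gD(3) fD(1)[OF st(1)] p(2)] st ltree_lcp[OF T] fD(1) by blast
    then show "restrict (\<lambda>y. s (t y)) (below V (j (i (Max S)))) y \<in> S \<and>
        prefix (restrict (\<lambda>x. j (i x)) S (restrict (\<lambda>y. s (t y)) (below V (j (i (Max S)))) y)) y"
      using y y' st p(4) prefix_order.trans by auto
  qed (use fD gD MS in auto)
qed

lemma lcomp_assoc:
  assumes S: "ltree S" and T: "ltree T" and U: "ltree U"
    and f: "f \<in> lhom S T" and g: "g \<in> lhom T U" and h: "h \<in> lhom U V"
  shows "lcomp V S h (lcomp U S g f) = lcomp V S (lcomp V T h g) f"
proof -
  obtain s i t j q k where [simp]: "f = (s, i)" "g = (t, j)" "h = (q, k)" by (metis surj_pair)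
  note fD = lhomD[OF f[simplified]] and gD = lhomD[OF g[simplified]] and hD = lhomD[OF h[simplified]]
  have MS: "Max S \<in> S" using ltree_Max S by blast
  have MT: "Max T \<in> T" using ltree_Max T by blast
  have le: "k (j x) \<le> k (j (Max T))" if "x \<in> T" for x
    using lemb_le_iff[OF hD(3) gD(1)[OF that] gD(1)[OF MT]] lhom_image_le_end[OF g[simplified] T that] by simp
  have "y \<le> k (j (Max T)) \<and> q y \<in> U \<and> q y \<le> j (i (Max S))" if "y \<in> V" "y \<le> k (j (i (Max S)))" for y
    using that lhom_pullback_le[OF h[simplified] U gD(1)[OF fD(1)[OF MS]] that] le[OF fD(1)[OF MS]] by simp
  then show ?thesis
    using MS MT fD(1) gD(1) unfolding lcomp_def by (auto simp: restrict_def fun_eq_iff)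
qed

lemma lrestr_lcomp:
  assumes S: "ltree S" and S': "ltree S'" "S' \<subseteq> S" and T: "ltree T" and f: "f \<in> lhom S T" and g: "g \<in> lhom T V"
  shows "lrestr V S' (lcomp V S g f) = lcomp V S' g (lrestr T S' f)"
proof -
  obtain s i t j where [simp]: "f = (s, i)" "g = (t, j)" by (metis surj_pair)
  note fD = lhomD[OF f[simplified]] and gD = lhomD[OF g[simplified]]
  have M: "Max S' \<in> S'" "Max S' \<in> S" using ltree_Max S' by blast+
  have le: "j (i (Max S')) \<le> j (i (Max S))"
    using lemb_le_iff[OF gD(3)] fD(1) M lhom_image_le_end[OF f[simplified] S M(2)] ltree_Max(1)[OF S] by blast
  have "y \<le> j (i (Max S)) \<and> t y \<in> T \<and> t y \<le> i (Max S')" if "y \<in> V" "y \<le> j (i (Max S'))" for y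
    using lhom_pullback_le[OF g[simplified] T fD(1)[OF M(2)] that] le that by simp
  then show ?thesis
    using M S'(2) unfolding lcomp_def lrestr_def by (auto simp: restrict_def fun_eq_iff)
qed

lemma lrestr_in_lhom:
  assumes S: "ltree S" and S': "ltree S'" "S' \<subseteq> S" "\<And>x. x \<in> S \<Longrightarrow> x \<le> Max S' \<Longrightarrow> x \<in> S'"
    and f: "f \<in> lhom S T"
  shows "lrestr T S' f \<in> lhom S' T"
proof -
  obtain s i where [simp]: "f = (s, i)" by (metis surj_pair)
  note fD = lhomD[OF f[simplified]]
  have M: "Max S' \<in> S'" "Max S' \<in> S" using ltree_Max S' by blast+
  have le: "i x \<le> i (Max S')" if "x \<in> S'" for x
    using lemb_le_iff[OF fD(3)] M that S' ltree_Max(2)[OF S'(1)] by (meson subsetD)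
  have leM: "i (Max S') \<le> i (Max S)" using lhom_image_le_end[OF f[simplified] S M(2)] .
  show ?thesis
    unfolding lrestr_def \<open>f = _\<close> fst_conv snd_conv
  proof (rule lhomI)
    show "lemb S' (restrict i S')"
      using lemb_cong[OF S'(1), of i "restrict i S'"] lemb_subset[OF fD(3) S'(2)] by simp
  next
    fix y assume y: "y \<in> T" "y \<le> restrict i S' (Max S')"
    then have y': "y \<le> i (Max S')" "y \<le> i (Max S)" using M leM by auto
    have "s y \<in> S" "prefix (i (s y)) y" using fD(6,7) y y' by blast+
    moreover from this have "i (s y) \<le> i (Max S')" using y' prefix_imp_le by (meson order.trans)
    then have "s y \<le> Max S'" using lemb_le_iff[OF fD(3) \<open>s y \<in> S\<close> M(2)] by simp
    ultimately show "restrict s (below T (i (Max S'))) y \<in> S' \<and> prefix (restrict i S' (restrict s (below T (i (Max S'))) y)) y"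
      using y y' S' by auto
  qed (use fD M le S' in auto)
qed

definition lid :: "nat list set \<Rightarrow> lmor" where
  "lid T = (restrict id T, restrict id T)"

lemma below_Max: "ltree T \<Longrightarrow> below T (Max T) = T"
  using ltree_Max(2) by auto

lemma lid_in_lhom: "ltree T \<Longrightarrow> lid T \<in> lhom T T"
  unfolding lid_def
proof (rule lhomI)
  assume T: "ltree T"
  then show "lemb T (restrict id T)"
    using lemb_cong[OF T, of id "restrict id T"] by (simp add: lemb_def)
qed (auto simp: below_Max ltree_Max)

text \<open>A morphism that ends at or before \<open>b\<close> sees only the vertices of its target
  up to \<open>b\<close>, so it can be carried over to any tree that agrees with the target
  there.\<close>

lemma lhom_below_cong:
  assumes S: "ltree S" and eq: "below T b = below V b" and f: "(s, i) \<in> lhom S T" "i (Max S) \<le> b"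
  shows "(s, i) \<in> lhom S V"
proof -
  note fD = lhomD[OF f(1)]
  have T: "y \<in> T \<longleftrightarrow> y \<in> V" if "y \<le> b" for y using eq that by (auto simp: set_eq_iff)
  have be: "below T (i (Max S)) = below V (i (Max S))" using T f(2) by (auto simp: below_def)
  show ?thesis
  proof (rule lhomI)
    fix x assume "x \<in> S"
    then show "i x \<in> V" using fD(1) T lhom_image_le_end[OF f(1) S] f(2) by (metis order.trans)
  next
    fix y assume "y \<in> V" "y \<le> i (Max S)"
    then show "s y \<in> S \<and> prefix (i (s y)) y" using fD(6,7) T f(2) by (metis order.trans)
  qed (use fD be in auto)
qed

section \<open>Extensions of a rigid surjection by one leaf\<close>

abbreviation pred_tree :: "nat list set \<Rightarrow> nat list set" where
  "pred_tree S \<equiv> S - {Max S}"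

definition ext :: "nat list set \<Rightarrow> nat list set \<Rightarrow> lmor \<Rightarrow> lmor set" where
  "ext S T h = {f \<in> lhom S T. lrestr T (pred_tree S) f = h}"

text \<open>A proper extension of a list is lexicographically larger, so the largest vertex is a
  leaf and its removal leaves an initial subtree.\<close>

lemma pred_tree:
  assumes "ltree S" "S \<noteq> {[]}"
  shows "ltree (pred_tree S)" "x \<in> S \<Longrightarrow> x \<le> Max (pred_tree S) \<Longrightarrow> x \<in> pred_tree S"
    "Max (pred_tree S) \<in> pred_tree S" "Max (pred_tree S) < Max S"
proof -
  obtain x0 where "x0 \<in> S" "x0 \<noteq> []" using assms ltreeD(2) by blast
  then have M: "Max S \<noteq> []"
    using ltree_Max(2)[OF assms(1), of x0] by auto
  show T: "ltree (pred_tree S)"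
    unfolding ltree_def
  proof (intro conjI ballI allI impI)
    show "finite (pred_tree S)" "[] \<in> pred_tree S" using ltreeD[OF assms(1)] M by auto
    fix y z assume *: "y \<in> pred_tree S" "prefix z y"
    then have "z \<le> y" "y \<le> Max S" "y \<noteq> Max S" using ltree_Max(2)[OF assms(1)] prefix_imp_le by auto
    then show "z \<in> pred_tree S" using * ltreeD(3)[OF assms(1)] by auto
  qed
  show m: "Max (pred_tree S) \<in> pred_tree S" using ltree_Max(1)[OF T] .
  then show l: "Max (pred_tree S) < Max S" using ltree_Max(2)[OF assms(1)] by (auto simp: order_less_le)
  show "x \<in> S \<Longrightarrow> x \<le> Max (pred_tree S) \<Longrightarrow> x \<in> pred_tree S" using l by auto
qed

text \<open>The rigid surjection \<open>(sh, ih)\<close> onto the smaller tree is fixed, its target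
  is not: the target grows during the argument while its part up to \<open>b\<close> stays, so it is
  an argument of \<open>adm\<close> and \<open>E\<close>.\<close>

locale extensions =
  fixes S :: "nat list set" and sh ih :: "nat list \<Rightarrow> nat list"
  assumes S: "ltree S" and nontriv: "S \<noteq> {[]}"
begin

abbreviation "S' \<equiv> pred_tree S"
definition "b = ih (Max S')"
abbreviation "E T \<equiv> ext S T (sh, ih)"

text \<open>The constants that may label a vertex \<open>y\<close> lying after \<open>b\<close>.\<close>

definition "consts y = {k \<in> S'. prefix (ih k) y}"

definition adm :: "nat list set \<Rightarrow> bool" where
  "adm T \<longleftrightarrow> ltree T \<and> (sh, ih) \<in> lhom S' T"

lemmas S' = pred_tree[OF S nontriv]

lemma MS: "Max S \<in> S" "Max S \<notin> S'"
  using ltree_Max[OF S] by auto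

lemma admD: "adm T \<Longrightarrow> ltree T" "adm T \<Longrightarrow> (sh, ih) \<in> lhom S' T"
  by (auto simp: adm_def)

lemma adm_cong: "adm T \<Longrightarrow> ltree V \<Longrightarrow> below T b = below V b \<Longrightarrow> adm V"
  unfolding adm_def using lhom_below_cong[OF S'(1)] b_def by auto

lemma ih_le_b: "adm T \<Longrightarrow> k \<in> S' \<Longrightarrow> ih k \<le> b"
  unfolding b_def using lhom_image_le_end[OF admD(2) S'(1)] .

lemma ih_in: "adm T \<Longrightarrow> k \<in> S' \<Longrightarrow> ih k \<in> T"
  using lhomD(1)[OF admD(2)] .

lemma ih_Nil: "adm T \<Longrightarrow> ih [] = []" "[] \<in> S'"
  using lembD(1)[OF lhomD(3)[OF admD(2)]] ltreeD(2)[OF S'(1)] by blast+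

text \<open>Before the end no vertex is labelled \<open>Max S\<close>, since
  \<open>i (Max S)\<close> would be a prefix of that vertex and so not larger. Hence all labels
  between \<open>b\<close> and the end are constants.\<close>

lemma extD:
  assumes "(s, i) \<in> E T"
  shows "(s, i) \<in> lhom S T" "x \<in> S' \<Longrightarrow> i x = ih x" "y \<in> T \<Longrightarrow> y \<le> b \<Longrightarrow> s y = sh y"
    "b < i (Max S)" "i (Max S) \<in> T" "s (i (Max S)) = Max S"
    "y \<in> T \<Longrightarrow> y < i (Max S) \<Longrightarrow> s y \<in> S'" "y \<in> T \<Longrightarrow> y < i (Max S) \<Longrightarrow> prefix (ih (s y)) y"
    "y \<in> T \<Longrightarrow> y < i (Max S) \<Longrightarrow> s y \<in> consts y"
    "k \<in> S' \<Longrightarrow> s (ih k) = k"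
proof -
  show m: "(s, i) \<in> lhom S T" using assms by (simp add: ext_def)
  note D = lhomD[OF m]
  have r: "restrict s (below T (i (Max S'))) = sh" "restrict i S' = ih"
    using assms by (simp_all add: ext_def lrestr_def)
  show i: "i x = ih x" if "x \<in> S'" for x using fun_cong[OF r(2), of x] that by simp
  show "s y = sh y" if "y \<in> T" "y \<le> b" for y
    using fun_cong[OF r(1), of y] that i[OF S'(3)] by (simp add: b_def)
  show "b < i (Max S)" unfolding b_def i[OF S'(3), symmetric]
    using lembD(2)[OF D(3)] S'(3,4) MS by blast
  show "i (Max S) \<in> T" using D(1) MS by blast
  show "s (i (Max S)) = Max S" using D(5) MS by blast
  show *: "s y \<in> S'" if "y \<in> T" "y < i (Max S)" for y
  proof -
    have "prefix (i (s y)) y" "s y \<in> S" using D(6,7)[of y] that by auto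
    then show ?thesis using prefix_imp_le that by fastforce
  qed
  show **: "prefix (ih (s y)) y" if "y \<in> T" "y < i (Max S)" for y
    using D(7)[of y] that i[OF *[OF that]] by simp
  show "s y \<in> consts y" if "y \<in> T" "y < i (Max S)" for y
    using *[OF that] **[OF that] by (simp add: consts_def)
  show "s (ih k) = k" if "k \<in> S'" for k
    using D(5)[of k] i[OF that] that by simp
qed

lemma ext_end_unique:
  assumes "(s, i) \<in> E T" "(s', i') \<in> E T" "i (Max S) = i' (Max S)"
  shows "i = i'"
proof
  fix x
  show "i x = i' x"
    using extD(2)[OF assms(1), of x] extD(2)[OF assms(2), of x] assms(3)
      lhomD(2)[OF extD(1)[OF assms(1)]] lhomD(2)[OF extD(1)[OF assms(2)]]
    by (cases "x \<in> S'"; cases "x \<in> S") (auto simp: extensional_def)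
qed

text \<open>Between \<open>b\<close> and the end, rigidity is a condition on each label separately,
  so these labels may be chosen independently of each other among the constants.\<close>

lemma ext_modify:
  assumes "(s, i) \<in> E T" "adm T" "s' \<in> extensional (below T (i (Max S)))"
    and "\<And>w. w \<in> T \<Longrightarrow> w \<le> b \<Longrightarrow> s' w = s w" "s' (i (Max S)) = Max S"
    and "\<And>w. w \<in> T \<Longrightarrow> b < w \<Longrightarrow> w < i (Max S) \<Longrightarrow> s' w \<in> consts w"
  shows "(s', i) \<in> E T"
proof -
  note D = extD[OF assms(1)] and L = lhomD[OF extD(1)[OF assms(1)]]
  have "(s', i) \<in> lhom S T"
  proof (rule lhomI)
    fix x assume x: "x \<in> S"
    show "s' (i x) = x"
    proof (cases "x = Max S")
      case False
      then have "x \<in> S'" using x by simp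
      then show ?thesis using D(2) L(5)[OF x] assms(4)[of "i x"] ih_le_b[OF assms(2)] L(1)[OF x] by simp
    qed (use assms in simp)
  next
    fix y assume y: "y \<in> T" "y \<le> i (Max S)"
    consider "y \<le> b" | "y = i (Max S)" | "b < y" "y < i (Max S)" using y by fastforce
    then show "s' y \<in> S \<and> prefix (i (s' y)) y"
    proof cases
      case 1
      then show ?thesis using assms(4)[OF y(1)] L(6,7)[OF y] by simp
    next
      case 2
      then show ?thesis using assms(5) MS by simp
    next
      case 3
      then have "s' y \<in> consts y" using assms(6) y by blast
      then show ?thesis using D(2) by (auto simp: consts_def)
    qed
  qed (use L assms in auto)
  moreover have "restrict s' (below T (i (Max S'))) = restrict s (below T (i (Max S')))"
    using assms(4) D(2)[OF S'(3)] by (auto simp: b_def restrict_def fun_eq_iff)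
  ultimately show ?thesis using assms(1) by (simp add: ext_def lrestr_def)
qed

lemma ext_upd:
  assumes "(s, i) \<in> E T" "adm T" "y \<in> T" "b < y" "y < i (Max S)" "k \<in> consts y"
  shows "(s(y := k), i) \<in> E T"
proof (rule ext_modify[OF assms(1,2)])
  show "s(y := k) \<in> extensional (below T (i (Max S)))"
    using lhomD(4)[OF extD(1)[OF assms(1)]] assms(3,5) by (auto simp: extensional_def)
qed (use assms extD[OF assms(1)] in auto)

text \<open>Restriction commutes with composition, and \<open>g\<close> together with the agreement
  of the trees up to \<open>b\<close> does not affect \<open>(sh, ih)\<close>.\<close>

lemma ext_lcomp:
  assumes T: "adm T" and g: "g \<in> lhom T V" and fix_b: "fixes_below T b g" and eq: "below T b = below V b"
    and f: "f \<in> E T"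
  shows "lcomp V S g f \<in> E V"
proof -
  have f': "f \<in> lhom S T" "lrestr T S' f = (sh, ih)" using f by (auto simp: ext_def)
  note h = lhomD[OF admD(2)[OF T]]
  have "ih x \<in> below T b" if "x \<in> S'" for x using ih_le_b[OF T that] ih_in[OF T that] by simp
  then have j: "snd g (ih x) = ih x" if "x \<in> S'" for x using fix_b that by (simp add: fixes_below_def)
  have "lrestr V S' (lcomp V S g f) = lcomp V S' g (sh, ih)"
    using lrestr_lcomp[OF S S'(1) _ admD(1)[OF T] f'(1) g] f'(2) by auto
  also have "\<dots> = (\<lambda>y \<in> below V b. sh (fst g y), \<lambda>x \<in> S'. ih x)"
    using j j[OF S'(3)] unfolding lcomp_def by (auto simp: b_def restrict_def fun_eq_iff)
  also have "(\<lambda>y \<in> below V b. sh (fst g y)) = sh"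
    using fix_b h(4) unfolding fixes_below_def eq[symmetric] by (auto simp: fun_eq_iff restrict_def extensional_def b_def)
  also have "(\<lambda>x \<in> S'. ih x) = ih" using h(2) by (auto simp: fun_eq_iff extensional_def)
  finally have "lrestr V S' (lcomp V S g f) = (sh, ih)" .
  then show ?thesis using lcomp_in_lhom[OF S admD(1)[OF T] f'(1) g] by (simp add: ext_def)
qed

text \<open>The colour of an extension does not depend on the label of \<open>y\<close>, unless \<open>y\<close> lies on the
  branch that leads to the new vertex.\<close>

definition offins :: "(lmor \<Rightarrow> nat) \<Rightarrow> nat list set \<Rightarrow> nat list \<Rightarrow> bool" where
  "offins \<chi> T y \<longleftrightarrow> (\<forall>s i k. (s, i) \<in> E T \<longrightarrow> k \<in> consts y \<longrightarrow> y < i (Max S) \<longrightarrow> \<not> prefix y (i (Max S)) \<longrightarrow>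
     \<chi> (s(y := k), i) = \<chi> (s, i))"

text \<open>The labels on \<open>D\<close> are exchanged one vertex at a time; each intermediate map
  is still an extension because labels are free.\<close>

lemma offins_all:
  assumes "adm T" "(s', i) \<in> E T" "finite D" "(s, i) \<in> E T"
    and "\<And>y. y \<in> D \<Longrightarrow> y \<in> T \<and> b < y \<and> y < i (Max S) \<and> \<not> prefix y (i (Max S)) \<and> offins \<chi> T y"
    and "\<And>y. y \<notin> D \<Longrightarrow> s y = s' y"
  shows "\<chi> (s, i) = \<chi> (s', i)"
  using assms(3-)
proof (induction D arbitrary: s rule: finite_induct)
  case empty
  then have "s = s'" by auto
  then show ?case by simp
next
  case (insert y D)
  have y: "y \<in> T" "b < y" "y < i (Max S)" "\<not> prefix y (i (Max S))" "offins \<chi> T y"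
    using insert.prems(2)[of y] by auto
  have k: "s' y \<in> consts y" using extD(9)[OF assms(2)] y by blast
  have "\<chi> (s(y := s' y), i) = \<chi> (s', i)"
    using insert.prems by (intro insert.IH ext_upd[OF insert.prems(1) assms(1) y(1-3) k]) auto
  moreover have "\<chi> (s(y := s' y), i) = \<chi> (s, i)"
    using y(5) insert.prems(1) k y unfolding offins_def by blast
  ultimately show ?case by simp
qed

end

section \<open>Labels off the branch\<close>

text \<open>At a chain vertex the direction 0 is reserved for the next chain vertex, so the first
  direction of the copied part is raised by one. This also puts the copy to the right of the
  chain.\<close>

definition shift :: "nat list \<Rightarrow> nat list" where
  "shift q = (case q of [] \<Rightarrow> [] | c # q' \<Rightarrow> Suc c # q')"

lemma shift_simps [simp]: "shift [] = []" "shift (c # q) = Suc c # q"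
  by (simp_all add: shift_def)

lemma shift_append: "q \<noteq> [] \<Longrightarrow> shift (q @ r) = shift q @ r"
  by (cases q) auto

text \<open>The vertex \<open>y\<close> is replaced by a chain of length \<open>N\<close>; on top of each vertex of the chain, and to
  the right of the chain, sits a copy of everything above \<open>y\<close>.\<close>

definition node :: "nat list \<Rightarrow> nat \<Rightarrow> nat list \<Rightarrow> nat list" where
  "node y a q = y @ replicate a 0 @ shift q"

definition blowup :: "nat list set \<Rightarrow> nat list \<Rightarrow> nat \<Rightarrow> nat list set" where
  "blowup T y N = {w \<in> T. \<not> prefix y w} \<union> {node y a q |a q. a < N \<and> y @ q \<in> T}"

text \<open>A shifted list never begins with 0, so the number of zeros following \<open>y\<close>
  determines \<open>a\<close>.\<close>

lemma node_inj: "node y a q = node y a' q' \<Longrightarrow> a = a' \<and> q = q'"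
proof -
  have "replicate a 0 @ shift q = replicate a' 0 @ shift q' \<Longrightarrow> a = a' \<and> q = q'"
  proof (induction a arbitrary: a')
    case 0
    then show ?case by (cases a'; cases q; cases q') auto
  next
    case (Suc a)
    show ?case
    proof (cases a')
      case 0
      then show ?thesis using Suc.prems by (cases q') auto
    next
      case (Suc n)
      then show ?thesis using Suc.IH[of n] Suc.prems by simp
    qed
  qed
  then show "node y a q = node y a' q' \<Longrightarrow> a = a' \<and> q = q'" by (simp add: node_def)
qed

definition unnode :: "nat list \<Rightarrow> nat list \<Rightarrow> nat \<times> nat list" where
  "unnode y = inv (\<lambda>(a, q). node y a q)"

lemma unnode_node [simp]: "unnode y (node y a q) = (a, q)"
proof -
  have "inj (\<lambda>(a, q). node y a q)" by (auto simp: inj_def dest: node_inj)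
  from inv_f_f[OF this, of "(a, q)"] show ?thesis by (simp add: unnode_def)
qed

lemma prefix_node [simp]: "prefix y (node y a q)"
  by (simp add: node_def)

lemma node_snoc: "node y a (q @ [c]) = node y a q @ [if q = [] then Suc c else c]"
  by (cases q) (auto simp: node_def)

lemma blowup_cases:
  assumes "w \<in> blowup T y N"
  obtains "w \<in> T" "\<not> prefix y w" | a q where "w = node y a q" "a < N" "y @ q \<in> T"
  using assms by (auto simp: blowup_def)

lemma ltree_blowup:
  assumes T: "ltree T" and y: "y \<in> T" "y \<noteq> []" and N: "N > 0"
  shows "ltree (blowup T y N)"
  unfolding ltree_def
proof (intro conjI ballI allI impI)
  have "{node y a q |a q. a < N \<and> y @ q \<in> T} \<subseteq> (\<lambda>(a, w). node y a (drop (length y) w)) ` ({..<N} \<times> T)"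
    by (force simp: image_iff)
  then show "finite (blowup T y N)"
    using ltreeD(1)[OF T] unfolding blowup_def by (simp add: finite_subset)
  show "[] \<in> blowup T y N" using ltreeD(2)[OF T] y by (simp add: blowup_def)
  fix x z assume x: "x \<in> blowup T y N" and z: "prefix z x"
  from x show "z \<in> blowup T y N"
  proof (cases rule: blowup_cases)
    case 1
    then show ?thesis using z ltreeD(3)[OF T] by (auto simp: blowup_def dest: prefix_order.trans)
  next
    case (2 a q)
    have chain: "y @ replicate a' 0 \<in> blowup T y N" if "a' < N" for a'
      using that y by (auto simp: blowup_def node_def intro!: exI[of _ a'] exI[of _ "[]"])
    from z 2(1) have "prefix z (y @ replicate a 0) \<or> (\<exists>z'. z = y @ replicate a 0 @ z' \<and> prefix z' (shift q))"
      by (auto simp: node_def prefix_append)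
    then show ?thesis
    proof
      assume "prefix z (y @ replicate a 0)"
      then consider "prefix z y" "z \<noteq> y" | a' where "z = y @ replicate a' 0" "a' \<le> a"
        unfolding prefix_append
      proof (elim disjE exE conjE)
        fix us assume us: "z = y @ us" "prefix us (replicate a 0)"
        then have "us = take (length us) (replicate a 0)"
          by (metis append_eq_conv_conj prefix_def)
        then have "us = replicate (length us) 0"
          using prefix_length_le[OF us(2)] by (simp add: min_def)
        then show thesis using that(2)[of "length us"] us prefix_length_le[OF us(2)] by simp
      qed (metis that append_Nil2 le0 replicate_0)
      then show ?thesis
      proof cases
        case 1
        then have "\<not> prefix y z" by auto
        then show ?thesis using 1 ltreeD(3)[OF T y(1)] by (auto simp: blowup_def)
      next
        case 2
        then show ?thesis using chain \<open>a < N\<close> by auto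
      qed
    next
      assume "\<exists>z'. z = y @ replicate a 0 @ z' \<and> prefix z' (shift q)"
      then obtain z' where z': "z = y @ replicate a 0 @ z'" "prefix z' (shift q)" by blast
      then obtain q' where q': "z' = shift q'" "prefix q' q"
        by (cases q; cases z') (auto intro: that[of "[]"] that[of "_ # _"])
      then have "y @ q' \<in> T" using 2 ltreeD(3)[OF T] by (meson same_prefix_prefix)
      then show ?thesis using z' q' 2 by (auto simp: blowup_def node_def)
    qed
  qed
qed

section \<open>Relabelling one vertex under composition, and the morphisms into a blow-up\<close>

context extensions
begin

text \<open>Relabelling \<open>z\<close> before composition changes the labels of all preimages of
  \<open>z\<close>; the assumption \<open>pre\<close> reduces these to the single vertex
  \<open>j z\<close>. The blown-up vertex itself may have several preimages and needs the
  Hales-Jewett theorem instead.\<close>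

lemma lcomp_upd:
  assumes T: "ltree T" and g: "(t, j) \<in> lhom T V" and f: "(s, i) \<in> lhom S T" and z: "z \<in> T" "z < i (Max S)"
    and pre: "\<And>w. w \<in> V \<Longrightarrow> w \<le> j (Max T) \<Longrightarrow> t w = z \<Longrightarrow> w = j z"
  shows "lcomp V S (t, j) (s(z := k), i) =
    ((fst (lcomp V S (t, j) (s, i)))(j z := k), snd (lcomp V S (t, j) (s, i)))"
proof -
  have u: "i (Max S) \<in> T" using lhomD(1)[OF f] MS by blast
  note gD = lhomD[OF g]
  have jz: "j z \<in> V" "j z \<le> j (i (Max S))" "t (j z) = z"
    using gD(1,5) z u lemb_le_iff[OF gD(3) z(1) u] by auto
  have un: "w = j z" if "w \<in> V" "w \<le> j (i (Max S))" "t w = z" for w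
    using pre[OF that(1) _ that(3)] lhom_pullback_le(1)[OF g T u that(1,2)] by blast
  have "(\<lambda>w \<in> below V (j (i (Max S))). (s(z := k)) (t w)) w = ((\<lambda>w \<in> below V (j (i (Max S))). s (t w))(j z := k)) w" for w
  proof (cases "w = j z")
    case True
    then show ?thesis using jz by simp
  next
    case False
    then show ?thesis using un[of w] by (cases "w \<in> below V (j (i (Max S)))") auto
  qed
  then have "(\<lambda>w \<in> below V (j (i (Max S))). (s(z := k)) (t w)) = (\<lambda>w \<in> below V (j (i (Max S))). s (t w))(j z := k)"
    by blast
  then show ?thesis by (simp add: lcomp_def)
qed

text \<open>For insensitivity gained at an earlier vertex to survive later blow-ups: the constants
  of \<open>z\<close> remain constants of \<open>j z\<close>, and an embedding preserves being off
  the branch.\<close>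

lemma offins_transfer:
  assumes T: "adm T" and g: "(t, j) \<in> lhom T V" and fb: "fixes_below T b (t, j)"
    and eq: "below T b = below V b" and z: "z \<in> T" "b < z"
    and pre: "\<And>w. w \<in> V \<Longrightarrow> w \<le> j (Max T) \<Longrightarrow> t w = z \<Longrightarrow> w = j z"
    and ins: "offins \<chi> V (j z)"
  shows "offins (\<lambda>f. \<chi> (lcomp V S (t, j) f)) T z"
  unfolding offins_def
proof (intro allI impI)
  fix s i k assume f: "(s, i) \<in> E T" and k: "k \<in> consts z" and less: "z < i (Max S)"
    and np: "\<not> prefix z (i (Max S))"
  note T' = admD(1)[OF T]
  have u: "i (Max S) \<in> T" using extD(5)[OF f] .
  note gD = lhomD[OF g]
  let ?f = "lcomp V S (t, j) (s, i)"
  have fE: "?f \<in> E V" using ext_lcomp[OF T g fb eq f] .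
  have k': "k \<in> S'" "prefix (ih k) z" using k by (auto simp: consts_def)
  have "ih k \<in> below T b" using ih_le_b[OF T k'(1)] ih_in[OF T k'(1)] by simp
  then have "j (ih k) = ih k" using fb by (simp add: fixes_below_def)
  then have "prefix (ih k) (j z)"
    using lemb_prefix_iff[OF gD(3) ih_in[OF T k'(1)] z(1) ltree_lcp[OF T' ih_in[OF T k'(1)]]] k'(2) by simp
  then have "k \<in> consts (j z)" using k' by (simp add: consts_def)
  moreover have "snd ?f (Max S) = j (i (Max S))" using MS by (simp add: lcomp_def)
  moreover have "j z < j (i (Max S))" using lemb_less_iff[OF gD(3) z(1) u] less by simp
  moreover have "\<not> prefix (j z) (j (i (Max S)))"
    using lemb_prefix_iff[OF gD(3) z(1) u ltree_lcp[OF T' z(1)]] np by simp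
  ultimately have "\<chi> ((fst ?f)(j z := k), snd ?f) = \<chi> (fst ?f, snd ?f)"
    using ins[unfolded offins_def, rule_format, of "fst ?f" "snd ?f" k] fE by simp
  moreover have "lcomp V S (t, j) (s(z := k), i) = ((fst ?f)(j z := k), snd ?f)"
    by (rule lcomp_upd[OF T' g extD(1)[OF f] z(1) less]) (rule pre)
  ultimately show "\<chi> (lcomp V S (t, j) (s(z := k), i)) = \<chi> (lcomp V S (t, j) (s, i))"
    by simp
qed

definition blow_j :: "nat list set \<Rightarrow> nat list \<Rightarrow> nat \<Rightarrow> nat list \<Rightarrow> nat list" where
  "blow_j T y p = (\<lambda>w \<in> T. if prefix y w then node y p (drop (length y) w) else w)"

text \<open>The word \<open>L\<close> decides which chain vertices are mapped to \<open>y\<close>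
  and which to constants, a constant \<open>k\<close> being represented by \<open>ih k\<close>.
  Copies over positions other than \<open>p\<close> collapse to the root, which is an admissible
  label everywhere.\<close>

definition blow_t :: "nat list set \<Rightarrow> nat list set \<Rightarrow> nat list \<Rightarrow> nat \<Rightarrow> nat list option list \<Rightarrow> nat list \<Rightarrow> nat list" where
  "blow_t T V y p L = (\<lambda>w \<in> below V (blow_j T y p (Max T)).
     if prefix y w then
       (case unnode y w of (a, q) \<Rightarrow>
          if q = [] then (case L ! a of None \<Rightarrow> y | Some k \<Rightarrow> ih k)
          else if a = p then y @ q else [])
     else w)"

lemma lemb_blow_j:
  assumes T: "ltree T" and y: "y \<in> T" "y \<noteq> []"
  shows "lemb T (blow_j T y p)"
proof (rule lemb_label_localI[where lab = "\<lambda>x a. if x = y then Suc a else a"])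
  show "ltree T" by (fact T)
  show "blow_j T y p [] = []" using y ltreeD(2)[OF T] by (simp add: blow_j_def)
next
  fix x a assume xa: "x @ [a] \<in> T"
  then have x: "x \<in> T" using ltreeD(3)[OF T xa] by simp
  consider q where "x = y @ q" | "\<not> prefix y x" "x @ [a] = y" | "\<not> prefix y x" "x @ [a] \<noteq> y"
    by (auto simp: prefix_def)
  then show "prefix (blow_j T y p x @ [if x = y then Suc a else a]) (blow_j T y p (x @ [a]))"
  proof cases
    case 1
    then show ?thesis using x xa node_snoc[of y p q a] by (simp add: blow_j_def)
  next
    case 2
    then show ?thesis using x xa by (simp add: blow_j_def) (auto simp: node_def prefix_def)
  next
    case 3
    then have "\<not> prefix y (x @ [a])" by (simp add: prefix_snoc)
    then show ?thesis using 3 x xa by (simp add: blow_j_def)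
  qed
qed auto

text \<open>Rigidity requires \<open>j y\<close> to lie below all preimages of \<open>y\<close>, so
  \<open>p\<close> is the first variable of \<open>L\<close>; a constant may precede it because
  \<open>ih k\<close> is a prefix of \<open>y\<close>. Apart from \<open>y\<close>, no vertex after
  \<open>b\<close> gets a second preimage, as \<open>offins_transfer\<close> demands.\<close>

lemma blowup_lhom:
  assumes T: "adm T" and y: "y \<in> T" "b < y" and L: "length L = N" "set L \<subseteq> opts (consts y)"
    and p: "p < N" "L ! p = None" "\<And>a. a < p \<Longrightarrow> L ! a \<noteq> None"
  defines "V \<equiv> blowup T y N"
  shows "(blow_t T V y p L, blow_j T y p) \<in> lhom T V" "fixes_below T b (blow_t T V y p L, blow_j T y p)"
    and "ltree V" "below T b = below V b"
    and "\<And>w z. z \<in> T \<Longrightarrow> b < z \<Longrightarrow> z \<noteq> y \<Longrightarrow> w \<in> V \<Longrightarrow> w \<le> blow_j T y p (Max T) \<Longrightarrow>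
      blow_t T V y p L w = z \<Longrightarrow> w = blow_j T y p z"
proof -
  note T' = admD(1)[OF T]
  let ?j = "blow_j T y p" and ?t = "blow_t T V y p L"
  have y0: "y \<noteq> []" using y by auto
  show V: "ltree V" unfolding V_def using ltree_blowup[OF T' y(1) y0] p by simp
  have je: "lemb T ?j" using lemb_blow_j[OF T' y(1) y0] .
  have np: "\<not> prefix y w" if "w \<le> b" for w
    using prefix_imp_le y that by fastforce
  have jV: "?j x \<in> V" if "x \<in> T" for x
    using that p(1) by (auto simp: blow_j_def V_def blowup_def prefix_def)
  have jle: "?j x \<le> ?j (Max T)" if "x \<in> T" for x
    using lemb_le_iff[OF je that ltree_Max(1)[OF T']] ltree_Max(2)[OF T' that] by simp
  have jf: "?j x = x" if "x \<in> T" "\<not> prefix y x" for x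
    using that by (simp add: blow_j_def)
  have jn: "?j (y @ q) = node y p q" if "y @ q \<in> T" for q
    using that by (simp add: blow_j_def)
  have k: "ih k \<in> T" "\<not> prefix y (ih k)" "ih k \<le> b" "prefix (ih k) y" if "k \<in> consts y" for k
    using that ih_in[OF T] np[OF ih_le_b[OF T]] ih_le_b[OF T] by (auto simp: consts_def)
  have La: "a < N \<Longrightarrow> L ! a = Some k \<Longrightarrow> k \<in> consts y" for a k
    using L nth_mem[of a L] by force
  show 1: "(?t, ?j) \<in> lhom T V"
  proof (rule lhomI)
    show "?j \<in> extensional T" by (simp add: blow_j_def)
    show "?t \<in> extensional (below V (?j (Max T)))" by (simp add: blow_t_def)
  next
    fix x assume x: "x \<in> T"
    show "?t (?j x) = x"
    proof (cases "prefix y x")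
      case True
      then obtain q where "x = y @ q" by (auto simp: prefix_def)
      then show ?thesis using x jn jV[OF x] jle[OF x] p by (simp add: blow_t_def)
    next
      case False
      then show ?thesis using x jf jV[OF x] jle[OF x] by (simp add: blow_t_def)
    qed
  next
    fix w assume w: "w \<in> V" "w \<le> ?j (Max T)"
    from w(1)[unfolded V_def] show "?t w \<in> T \<and> prefix (?j (?t w)) w"
    proof (cases rule: blowup_cases)
      case 1
      then show ?thesis using w jf by (simp add: blow_t_def)
    next
      case (2 a q)
      show ?thesis
      proof (cases "q = []")
        case False
        then show ?thesis
          using 2 w jn jf[OF ltreeD(2)[OF T']] y0 ltreeD(2)[OF T'] by (simp add: blow_t_def)
      next
        case q: True
        show ?thesis
        proof (cases "L ! a")
          case None
          then have "p \<le> a" using p(3) by (meson not_le)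
          then have "prefix (node y p []) (node y a [])"
            by (auto simp: node_def prefix_def intro!: exI[of _ "replicate (a - p) 0"] simp flip: replicate_add)
          then show ?thesis using 2 w q None jn[of "[]"] y by (simp add: blow_t_def)
        next
          case (Some k')
          then have "k' \<in> consts y" using La 2 by blast
          then show ?thesis
            using 2 w q Some jf k[of k'] prefix_order.trans[OF k(4) prefix_node] by (simp add: blow_t_def)
        qed
      qed
    qed
  qed (use jV je in auto)
  show eq: "below T b = below V b"
  proof -
    have "\<not> node y a q \<le> b" for a q
      using np[of "node y a q"] by auto
    then show ?thesis using np by (auto simp: V_def blowup_def)
  qed
  show "fixes_below T b (?t, ?j)"
    unfolding fixes_below_def
  proof
    fix x assume x: "x \<in> below T b"
    then have "x \<in> T" "\<not> prefix y x" using np by auto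
    then show "fst (?t, ?j) x = x \<and> snd (?t, ?j) x = x"
      using lhomD(5)[OF 1, of x] jf by simp
  qed
  fix w z assume z: "z \<in> T" "b < z" "z \<noteq> y" and w: "w \<in> V" "w \<le> ?j (Max T)" "?t w = z"
  from w(1)[unfolded V_def] show "w = ?j z"
  proof (cases rule: blowup_cases)
    case 1
    then show ?thesis using w jf by (simp add: blow_t_def)
  next
    case (2 a q)
    show ?thesis
    proof (cases "q = []")
      case q: True
      have "z = y \<or> (\<exists>k \<in> consts y. z = ih k)"
        using 2 w q La by (auto simp: blow_t_def split: option.splits)
      then show ?thesis using z k(3) not_le by blast
    next
      case False
      then have "z = (if a = p then y @ q else [])"
        using 2 w by (simp add: blow_t_def split: if_splits)
      then show ?thesis using 2 z jn by (auto split: if_splits)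
    qed
  qed
qed

text \<open>Since all vertices strictly above the chain may be relabelled at will, the colour does not reveal
  which copy is in use, and the Hales-Jewett theorem applies to the labels of the chain.\<close>

lemma blowup_offins:
  assumes T: "adm T" and y: "y \<in> T" "b < y" and r: "r > 0"
  shows "\<exists>N > 0. \<forall>\<chi> \<in> lhom S (blowup T y N) \<rightarrow> {..<r}.
    (\<forall>a q. a < N \<longrightarrow> q \<noteq> [] \<longrightarrow> y @ q \<in> T \<longrightarrow> offins \<chi> (blowup T y N) (node y a q)) \<longrightarrow>
    (\<exists>p < N. \<exists>L. length L = N \<and> set L \<subseteq> opts (consts y) \<and> L ! p = None \<and> (\<forall>a < p. L ! a \<noteq> None) \<and>
      offins (\<lambda>f. \<chi> (lcomp (blowup T y N) S (blow_t T (blowup T y N) y p L, blow_j T y p) f)) T y)"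
proof -
  note T' = admD(1)[OF T]
  have finK: "finite (consts y)" using ltreeD(1)[OF S'(1)] by (simp add: consts_def)
  have neK: "consts y \<noteq> {}" using ih_Nil(1)[OF T] ih_Nil(2) by (auto simp: consts_def)
  \<comment> \<open>The colour of a word of chain labels is a function on all morphisms from
    \<open>S\<close> to \<open>T\<close>, so that one line serves all extensions
    simultaneously.\<close>
  define F where "F = lhom S T \<rightarrow>\<^sub>E {..<r}"
  have finF: "finite F" unfolding F_def by (intro finite_PiE finite_lhom[OF S T']) auto
  obtain N where N: "\<And>c. c \<in> words (consts y) N \<rightarrow> F \<Longrightarrow>
    (\<exists>P. length P = N \<and> None \<in> set P \<and> set P \<subseteq> opts (consts y) \<and>
       (\<forall>a \<in> consts y. \<forall>b \<in> consts y. c (subst P a) = c (subst P b)))"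
    using Hales_Jewett[OF finK neK finF] by blast
  define V where "V = blowup T y N"
  \<comment> \<open>A normal form: the chain is labelled by \<open>W\<close>, everything strictly
    above it by the root, and the rest as by \<open>s\<close>. It involves neither \<open>p\<close>
    nor the label \<open>s y\<close>, so it can be coloured before the line is known.\<close>
  define R where "R s i W = ((\<lambda>w \<in> below V (i (Max S)).
      if prefix y w then (case unnode y w of (a, q) \<Rightarrow> if q = [] then W ! a else []) else s w), i)"
    for s i :: "nat list \<Rightarrow> nat list" and W
  have main: "\<exists>p < N. \<exists>L. length L = N \<and> set L \<subseteq> opts (consts y) \<and> L ! p = None \<and> (\<forall>a < p. L ! a \<noteq> None) \<and>
      offins (\<lambda>f. \<chi> (lcomp V S (blow_t T V y p L, blow_j T y p) f)) T y"
    if chi: "\<chi> \<in> lhom S V \<rightarrow> {..<r}"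
      and ins: "\<And>a q. a < N \<Longrightarrow> q \<noteq> [] \<Longrightarrow> y @ q \<in> T \<Longrightarrow> offins \<chi> V (node y a q)" for \<chi>
  proof -
    define col where "col W = (\<lambda>f \<in> lhom S T. if R (fst f) (snd f) W \<in> lhom S V then \<chi> (R (fst f) (snd f) W) else 0)" for W
    have "col \<in> words (consts y) N \<rightarrow> F"
      using chi r by (auto simp: col_def F_def dest: funcset_mem)
    from N[OF this] obtain L where L: "length L = N" "None \<in> set L" "set L \<subseteq> opts (consts y)"
      and Lc: "\<And>a b. a \<in> consts y \<Longrightarrow> b \<in> consts y \<Longrightarrow> col (subst L a) = col (subst L b)"
      by blast
    define p where "p = (LEAST a. L ! a = None)"
    have "\<exists>a < N. L ! a = None" using L by (metis in_set_conv_nth)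
    then have p: "p < N" "L ! p = None" "\<And>a. a < p \<Longrightarrow> L ! a \<noteq> None"
      unfolding p_def by (auto intro: LeastI dest: not_less_Least) (meson Least_le order.strict_trans1)
    let ?t = "blow_t T V y p L" and ?j = "blow_j T y p"
    note B = blowup_lhom[OF T y L(1,3) p, folded V_def]
    note gD = lhomD[OF B(1)]
    have V: "adm V" using adm_cong[OF T B(3,4)] .
    \<comment> \<open>Off the cone of \<open>y\<close> the composite agrees with \<open>s\<close>,
      and along the chain it spells \<open>subst L (s y)\<close>; strictly above the chain its
      labels can be replaced by the root without changing the colour. So the colour is that of the
      normal form.\<close>
    have key: "R s i (subst L (s y)) \<in> lhom S V \<and> \<chi> (lcomp V S (?t, ?j) (s, i)) = \<chi> (R s i (subst L (s y)))"
      if f: "(s, i) \<in> E T" and less: "y < i (Max S)" and np: "\<not> prefix y (i (Max S))" for s i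
    proof -
      note fD = extD[OF f]
      let ?u = "i (Max S)"
      have ju: "?j ?u = ?u" using fD(5) np by (simp add: blow_j_def)
      have jx: "?j (i x) = i x" if "x \<in> S" for x
      proof (cases "x = Max S")
        case False
        then have "x \<in> S'" using that by simp
        then have "i x \<le> b" "i x \<in> T" using fD(2) ih_le_b[OF T] ih_in[OF T] by auto
        then show ?thesis using B(2) by (simp add: fixes_below_def)
      qed (use ju in simp)
      define s1 where "s1 = (\<lambda>w \<in> below V ?u. s (?t w))"
      have "(\<lambda>x \<in> S. ?j (i x)) = i" using jx lhomD(2)[OF fD(1)] by (auto simp: fun_eq_iff extensional_def)
      then have f1: "lcomp V S (?t, ?j) (s, i) = (s1, i)" by (simp add: lcomp_def s1_def ju)
      have f1E: "(s1, i) \<in> E V" using ext_lcomp[OF T B(1,2,4) f] f1 by simp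
      have sy: "s y \<in> consts y" using fD(9)[OF y(1) less] .
      define s2 where "s2 = fst (R s i (subst L (s y)))"
      have s2: "R s i (subst L (s y)) = (s2, i)" by (simp add: s2_def R_def)
      have uM: "?u \<le> ?j (Max T)"
        using lemb_le_iff[OF gD(3) fD(5) ltree_Max(1)[OF T']] ltree_Max(2)[OF T' fD(5)] ju by simp
      have tw: "?t w = w" if "w \<in> V" "w \<le> ?u" "\<not> prefix y w" for w
        using that uM by (auto simp: blow_t_def)
      have off: "s1 w = s2 w" if "\<not> prefix y w" for w
        using that tw by (auto simp: s1_def s2_def R_def)
      have nle: "node y a q \<noteq> ?u" for a q using np prefix_node by metis
      have chain: "s1 (node y a []) = s2 (node y a [])" if "a < N" for a
      proof (cases "node y a [] \<in> below V ?u")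
        case True
        have "k \<in> S'" if "L ! a = Some k" for k
          using L nth_mem[of a L] \<open>a < N\<close> that by (force simp: consts_def)
        then have "s (case L ! a of None \<Rightarrow> y | Some k \<Rightarrow> ih k) = subst L (s y) ! a"
          using L that fD(10) by (simp add: subst_def split: option.splits)
        then show ?thesis using True order.trans[OF _ uM] by (simp add: s1_def s2_def R_def blow_t_def)
      qed (auto simp: s1_def s2_def R_def)
      have s2E: "(s2, i) \<in> E V"
      proof (rule ext_modify[OF f1E V])
        show "s2 \<in> extensional (below V ?u)" by (simp add: s2_def R_def)
        show "s2 w = s1 w" if "w \<in> V" "w \<le> b" for w
          using that y(2) prefix_imp_le[of y w] by (intro off[symmetric]) auto
        show "s2 (i (Max S)) = Max S" using off[OF np] extD(6)[OF f1E] by simp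
        fix w assume w: "w \<in> V" "b < w" "w < i (Max S)"
        have s1w: "s1 w \<in> consts w" using extD(9)[OF f1E w(1,3)] .
        from w(1)[unfolded V_def] show "s2 w \<in> consts w"
        proof (cases rule: blowup_cases)
          case 1
          then show ?thesis using s1w off by simp
        next
          case (2 a q)
          then show ?thesis
            using s1w chain w ih_Nil(1)[OF T] ih_Nil(2) by (cases "q = []") (auto simp: s2_def R_def consts_def)
        qed
      qed
      \<comment> \<open>The two maps differ only strictly above the chain and off the branch to the
        new leaf, where \<chi> is insensitive by assumption.\<close>
      have "\<chi> (s1, i) = \<chi> (s2, i)"
      proof (rule offins_all[OF V s2E _ f1E])
        let ?D = "{w \<in> V. w < ?u \<and> (\<exists>a q. w = node y a q \<and> a < N \<and> q \<noteq> [] \<and> y @ q \<in> T)}"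
        show "finite ?D" using ltreeD(1)[OF B(3)] by simp
        show "w \<in> V \<and> b < w \<and> w < i (Max S) \<and> \<not> prefix w (i (Max S)) \<and> offins \<chi> V w" if w: "w \<in> ?D" for w
        proof -
          obtain a q where aq: "w = node y a q" "a < N" "q \<noteq> []" "y @ q \<in> T" using w by blast
          have "b < w" using prefix_imp_le[OF prefix_node[of y a q]] aq y by simp
          moreover have "\<not> prefix w ?u" using np prefix_order.trans[OF prefix_node] aq by blast
          ultimately show ?thesis using w ins aq by blast
        qed
        fix w assume w: "w \<notin> ?D"
        show "s1 w = s2 w"
        proof (cases "w \<in> below V ?u \<and> prefix y w")
          case True
          then obtain a q where aq: "w = node y a q" "a < N" "y @ q \<in> T"
            unfolding V_def by (auto elim!: blowup_cases)
          have "w < ?u" using True nle aq by (auto simp: order_less_le)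
          then have "q = []" using w aq True by auto
          then show ?thesis using chain aq by simp
        next
          case False
          then show ?thesis
            using off[of w] by (cases "prefix y w") (auto simp: s1_def s2_def R_def)
        qed
      qed
      then show ?thesis using extD(1)[OF s2E] f1 s2 by simp
    qed
    have "offins (\<lambda>f. \<chi> (lcomp V S (?t, ?j) f)) T y"
      unfolding offins_def
    proof (intro allI impI)
      fix s i k assume f: "(s, i) \<in> E T" and k: "k \<in> consts y" and less: "y < i (Max S)"
        and np: "\<not> prefix y (i (Max S))"
      have f': "(s(y := k), i) \<in> E T" using ext_upd[OF f T y less k] .
      have R: "R (s(y := k)) i W = R s i W" for W
        unfolding R_def by (auto simp: fun_eq_iff)
      have sy: "s y \<in> consts y" using extD(9)[OF f y(1) less] .
      note k1 = key[OF f less np] and k2 = key[OF f' less np]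
      have "col (subst L k) (s, i) = col (subst L (s y)) (s, i)" using Lc[OF k sy] by simp
      then show "\<chi> (lcomp V S (?t, ?j) (s(y := k), i)) = \<chi> (lcomp V S (?t, ?j) (s, i))"
        using k1 k2 extD(1)[OF f] by (simp add: col_def R)
    qed
    then show ?thesis using p L(1,3) by (intro exI[of _ p] exI[of _ L] conjI) auto
  qed
  \<comment> \<open>A line for the constant colouring contains a variable, so its length
    \<open>N\<close> is not 0.\<close>
  have "(\<lambda>f \<in> lhom S T. 0) \<in> F" using r by (simp add: F_def)
  then have "(\<lambda>_. \<lambda>f \<in> lhom S T. 0) \<in> words (consts y) N \<rightarrow> F" by simp
  from N[OF this] obtain P :: "nat list option list" where "length P = N" "None \<in> set P" by blast
  then have "N > 0" by (cases P) auto
  show ?thesis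
  proof (rule exI[of _ N], intro conjI ballI impI)
    show "N > 0" by fact
    fix \<chi> assume "\<chi> \<in> lhom S (blowup T y N) \<rightarrow> {..<r}"
      "\<forall>a q. a < N \<longrightarrow> q \<noteq> [] \<longrightarrow> y @ q \<in> T \<longrightarrow> offins \<chi> (blowup T y N) (node y a q)"
    then show "\<exists>p < N. \<exists>L. length L = N \<and> set L \<subseteq> opts (consts y) \<and> L ! p = None \<and> (\<forall>a < p. L ! a \<noteq> None) \<and>
      offins (\<lambda>f. \<chi> (lcomp (blowup T y N) S (blow_t T (blowup T y N) y p L, blow_j T y p) f)) T y"
      using main[unfolded V_def, of \<chi>] by blast
  qed
qed

end

section \<open>Insensitivity at all vertices after \<open>b\<close>, by height\<close>

definition ht_less :: "nat list set \<Rightarrow> nat list \<Rightarrow> nat \<Rightarrow> bool" where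
  "ht_less T y n \<longleftrightarrow> (\<forall>q. y @ q \<in> T \<longrightarrow> length q < n)"

lemma lcomp_pi:
  assumes "ltree S" "ltree T" "g \<in> lhom T V" "\<chi> \<in> lhom S V \<rightarrow> {..<r}"
  shows "(\<lambda>f. \<chi> (lcomp V S g f)) \<in> lhom S T \<rightarrow> {..<r}"
  using lcomp_in_lhom[OF assms(1,2) _ assms(3)] assms(4) by blast

lemma fixes_below_lcomp:
  assumes "ltree T" "ltree U" "g \<in> lhom T U" "h \<in> lhom U V"
    and fg: "fixes_below T b g" and fh: "fixes_below U b h" and eq: "below T b = below U b"
  shows "fixes_below T b (lcomp V T h g)"
  unfolding fixes_below_def
proof
  fix y assume y: "y \<in> below T b"
  have m: "lcomp V T h g \<in> lhom T V" by (rule lcomp_in_lhom) (use assms in auto)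
  have "snd (lcomp V T h g) y = y"
    using fg fh y eq unfolding fixes_below_def lcomp_def by auto
  moreover from this have "fst (lcomp V T h g) y = y"
    using lhomD(5)[of "fst (lcomp V T h g)" "snd (lcomp V T h g)" T V y] m y by simp
  ultimately show "fst (lcomp V T h g) y = y \<and> snd (lcomp V T h g) y = y" by blast
qed

context extensions
begin

lemma offins_cong:
  assumes "adm T" "y \<in> T" "b < y" "\<And>f. f \<in> E T \<Longrightarrow> \<chi> f = \<chi>' f"
  shows "offins \<chi> T y \<longleftrightarrow> offins \<chi>' T y"
  unfolding offins_def using assms(4) ext_upd[OF _ assms(1-3)] by simp

definition insensitizable :: "nat list set \<Rightarrow> nat \<Rightarrow> nat list set \<Rightarrow> bool" where
  "insensitizable T r Y \<longleftrightarrow> (\<exists>V. ltree V \<and> below T b = below V b \<and>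
     (\<forall>\<chi> \<in> lhom S V \<rightarrow> {..<r}. \<exists>g \<in> lhom T V. fixes_below T b g \<and>
        (\<forall>y \<in> Y. offins (\<lambda>f. \<chi> (lcomp V S g f)) T y)))"

lemma insensitizable_empty: "adm T \<Longrightarrow> insensitizable T r {}"
  unfolding insensitizable_def
proof (intro exI[of _ T] conjI ballI)
  assume T: "adm T"
  show "ltree T" using admD(1)[OF T] .
  show "\<exists>g \<in> lhom T T. fixes_below T b g \<and> (\<forall>y \<in> {}. offins (\<lambda>f. \<chi> (lcomp T S g f)) T y)" for \<chi>
    using lid_in_lhom[OF admD(1)[OF T]] by (intro bexI[of _ "lid T"]) (simp add: fixes_below_def lid_def)
qed simp

text \<open>An induction on the number of vertices of the current height that remain. One of them,
  \<open>y\<close>, is blown up, and the larger tree is treated before \<open>y\<close>. The blow-up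
  creates no new task at this height: the copies strictly above the chain are of smaller height, and
  nothing is required at the chain vertices themselves.\<close>

lemma insensitizable_level:
  assumes IH: "\<And>T. adm T \<Longrightarrow> insensitizable T r {y \<in> T. b < y \<and> ht_less T y n}" and r: "r > 0"
  shows "finite D \<Longrightarrow> adm T \<Longrightarrow> D \<subseteq> {y \<in> T. b < y \<and> ht_less T y (Suc n)} \<Longrightarrow>
    insensitizable T r ({y \<in> T. b < y \<and> ht_less T y n} \<union> D)"
proof (induction "card D" arbitrary: D T rule: less_induct)
  case less
  note T = \<open>adm T\<close>
  note T' = admD(1)[OF T]
  show ?case
  proof (cases "D \<subseteq> {y \<in> T. b < y \<and> ht_less T y n}")
    case True
    then have "{y \<in> T. b < y \<and> ht_less T y n} \<union> D = {y \<in> T. b < y \<and> ht_less T y n}" by blast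
    then show ?thesis using IH[OF T] by simp
  next
    case False
    then obtain y where y: "y \<in> D" "y \<in> T" "b < y" "ht_less T y (Suc n)" "\<not> ht_less T y n"
      using less.prems by blast
    obtain N where N: "N > 0"
      and line: "\<forall>\<chi> \<in> lhom S (blowup T y N) \<rightarrow> {..<r}.
        (\<forall>a q. a < N \<longrightarrow> q \<noteq> [] \<longrightarrow> y @ q \<in> T \<longrightarrow> offins \<chi> (blowup T y N) (node y a q)) \<longrightarrow>
        (\<exists>p < N. \<exists>L. length L = N \<and> set L \<subseteq> opts (consts y) \<and> L ! p = None \<and> (\<forall>a < p. L ! a \<noteq> None) \<and>
          offins (\<lambda>f. \<chi> (lcomp (blowup T y N) S (blow_t T (blowup T y N) y p L, blow_j T y p) f)) T y)"
      using blowup_offins[OF T y(2,3) r] by (elim exE conjE) (rule that)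
    define V1 where "V1 = blowup T y N"
    note B0 = blowup_lhom[OF T y(2,3), of "replicate N None" N 0, folded V1_def]
    have V1: "ltree V1" "below T b = below V1 b" using B0(3,4) N by (auto simp: set_replicate_conv_if)
    have aV1: "adm V1" using adm_cong[OF T V1] .
    define D1 where "D1 = {w \<in> D. \<not> prefix y w}"
    \<comment> \<open>Vertices strictly below \<open>y\<close> have greater height than all vertices
      treated here; they are the only vertices surviving from \<open>T\<close> whose cones change in
      the blow-up.\<close>
    have height_up: "m > Suc n" if "prefix z y" "z \<noteq> y" "ht_less T z m" for z m
    proof -
      obtain q where q: "y @ q \<in> T" "length q \<ge> n" using y(5) by (auto simp: ht_less_def not_less)
      obtain q' where q': "y = z @ q'" "q' \<noteq> []" using \<open>prefix z y\<close> \<open>z \<noteq> y\<close> by (auto simp: prefix_def)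
      then have "z @ (q' @ q) \<in> T" using q(1) by simp
      then have "length (q' @ q) < m" using that(3) unfolding ht_less_def by blast
      then show ?thesis using q(2) q'(2) by (cases q') auto
    qed
    have inV1: "z \<in> V1" if "z \<in> T" "\<not> prefix y z" for z
      using that by (simp add: V1_def blowup_def)
    have htV1: "ht_less V1 z m" if "\<not> prefix y z" "\<not> prefix z y" "ht_less T z m" for z m
      unfolding ht_less_def
    proof (intro allI impI)
      fix q assume "z @ q \<in> V1"
      then have "z @ q \<in> T"
        unfolding V1_def
      proof (cases rule: blowup_cases)
        case (2 a q')
        then have "prefix y (z @ q)" by simp
        then show ?thesis using that(1,2) by (auto simp: prefix_append)
      qed
      then show "length q < m" using that(3) by (simp add: ht_less_def)
    qed
    have Dheight: "\<not> prefix z y" if "z \<in> D1" for z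
    proof
      assume "prefix z y"
      moreover have "z \<noteq> y" using that by (auto simp: D1_def)
      moreover have "ht_less T z (Suc n)" using that less.prems by (auto simp: D1_def)
      ultimately show False using height_up[of z "Suc n"] by simp
    qed
    have "card D1 < card D"
      using y(1) \<open>finite D\<close> by (intro psubset_card_mono) (auto simp: D1_def)
    moreover have "D1 \<subseteq> {w \<in> V1. b < w \<and> ht_less V1 w (Suc n)}"
      using Dheight htV1 inV1 less.prems(3) by (auto simp: D1_def)
    moreover have "finite D1" using \<open>finite D\<close> by (simp add: D1_def)
    ultimately have "insensitizable V1 r ({w \<in> V1. b < w \<and> ht_less V1 w n} \<union> D1)"
      using less.hyps[of D1 V1] aV1 by blast
    then obtain V where V: "ltree V" "below V1 b = below V b"
      and Vg: "\<And>\<chi>. \<chi> \<in> lhom S V \<rightarrow> {..<r} \<Longrightarrow> \<exists>g \<in> lhom V1 V. fixes_below V1 b g \<and>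
        (\<forall>w \<in> {w \<in> V1. b < w \<and> ht_less V1 w n} \<union> D1. offins (\<lambda>f. \<chi> (lcomp V S g f)) V1 w)"
      unfolding insensitizable_def by blast
    show ?thesis
      unfolding insensitizable_def
    proof (intro exI[of _ V] conjI ballI)
      show "ltree V" "below T b = below V b" using V V1 by auto
      fix \<chi> assume chi: "\<chi> \<in> lhom S V \<rightarrow> {..<r}"
      obtain g1 where g1: "g1 \<in> lhom V1 V" "fixes_below V1 b g1"
        and ins1: "\<And>w. w \<in> V1 \<Longrightarrow> b < w \<Longrightarrow> ht_less V1 w n \<Longrightarrow> offins (\<lambda>f. \<chi> (lcomp V S g1 f)) V1 w"
          "\<And>w. w \<in> D1 \<Longrightarrow> offins (\<lambda>f. \<chi> (lcomp V S g1 f)) V1 w"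
        using Vg[OF chi] by blast
      define \<chi>1 where "\<chi>1 f = \<chi> (lcomp V S g1 f)" for f
      have chi1: "\<chi>1 \<in> lhom S V1 \<rightarrow> {..<r}"
        unfolding \<chi>1_def using lcomp_pi[OF S V1(1) g1(1) chi] .
      \<comment> \<open>Strictly above the chain all heights are smaller than \<open>n\<close>, so
        these copies belong to the part that has been made insensitive already.\<close>
      have insn: "offins \<chi>1 V1 (node y a q)" if "a < N" "q \<noteq> []" "y @ q \<in> T" for a q
        unfolding \<chi>1_def
      proof (rule ins1(1))
        show "node y a q \<in> V1" using that by (auto simp: V1_def blowup_def)
        show "b < node y a q" using prefix_imp_le[OF prefix_node[of y a q]] y(3) by simp
        show "ht_less V1 (node y a q) n"
          unfolding ht_less_def
        proof (intro allI impI)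
          fix q' assume "node y a q @ q' \<in> V1"
          then have "node y a (q @ q') \<in> V1" using shift_append[OF that(2)] by (simp add: node_def)
          then have "y @ (q @ q') \<in> T"
            unfolding V1_def by (cases rule: blowup_cases) (auto dest: node_inj)
          then have "length (q @ q') < Suc n" using y(4) unfolding ht_less_def by blast
          then show "length q' < n" using that(2) by (cases q) auto
        qed
      qed
      obtain p L where p: "p < N" "L ! p = None" "\<And>a. a < p \<Longrightarrow> L ! a \<noteq> None" and L: "length L = N" "set L \<subseteq> opts (consts y)"
        and yins: "offins (\<lambda>f. \<chi>1 (lcomp V1 S (blow_t T V1 y p L, blow_j T y p) f)) T y"
      proof -
        have "\<forall>a q. a < N \<longrightarrow> q \<noteq> [] \<longrightarrow> y @ q \<in> T \<longrightarrow> offins \<chi>1 V1 (node y a q)" using insn by blast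
        from line[folded V1_def, THEN bspec, OF chi1, THEN mp, OF this] show thesis
          by (elim exE conjE) (rule that, simp_all)
      qed
      define g2 where "g2 = (blow_t T V1 y p L, blow_j T y p)"
      note B = blowup_lhom[OF T y(2,3) L p, folded V1_def]
      have g2: "g2 \<in> lhom T V1" "fixes_below T b g2" using B(1,2) by (simp_all add: g2_def)
      define g where "g = lcomp V T g1 g2"
      have g: "g \<in> lhom T V" unfolding g_def using lcomp_in_lhom[OF T' V1(1) g2(1) g1(1)] .
      have comp: "\<chi> (lcomp V S g f) = \<chi>1 (lcomp V1 S g2 f)" if "f \<in> E T" for f
        unfolding \<chi>1_def g_def using lcomp_assoc[OF S T' V1(1) _ g2(1) g1(1), of f] that by (simp add: ext_def)
      have fin: "offins (\<lambda>f. \<chi> (lcomp V S g f)) T z" if z: "z \<in> {y \<in> T. b < y \<and> ht_less T y n} \<union> D" for z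
      proof -
        have zT: "z \<in> T" "b < z" using z less.prems by auto
        have "offins (\<lambda>f. \<chi>1 (lcomp V1 S g2 f)) T z"
        proof (cases "z = y")
          case True
          then show ?thesis using yins by (simp add: g2_def)
        next
          case False
          \<comment> \<open>A vertex above \<open>y\<close> goes into the copy over position
            \<open>p\<close>; every other vertex is fixed, and is either of height below
            \<open>n\<close> or a member of \<open>D1\<close>.\<close>
          have "offins \<chi>1 V1 (blow_j T y p z)"
          proof (cases "prefix y z")
            case True
            then obtain q where q: "z = y @ q" "q \<noteq> []" using \<open>z \<noteq> y\<close> by (auto simp: prefix_def)
            then show ?thesis using insn[OF p(1) q(2)] zT by (simp add: blow_j_def)
          next
            case np: False
            then have j: "blow_j T y p z = z" using zT by (simp add: blow_j_def)
            show ?thesis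
            proof (cases "ht_less T z n")
              case True
              then have "\<not> prefix z y" using height_up[of z n] zT \<open>z \<noteq> y\<close> by fastforce
              then show ?thesis
                unfolding j \<chi>1_def using ins1(1) inV1[OF zT(1) np] htV1[OF np _ True] zT by blast
            next
              case False
              then have "z \<in> D1" using z np by (auto simp: D1_def)
              then show ?thesis unfolding j \<chi>1_def by (rule ins1(2))
            qed
          qed
          then show ?thesis
            unfolding g2_def
            by (intro offins_transfer[OF T B(1,2,4) zT]) (use B(5) zT False in blast)+
        qed
        then show ?thesis using offins_cong[OF T zT comp] by simp
      qed
      then show "\<exists>g \<in> lhom T V. fixes_below T b g \<and>
          (\<forall>z \<in> {y \<in> T. b < y \<and> ht_less T y n} \<union> D. offins (\<lambda>f. \<chi> (lcomp V S g f)) T z)"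
        using g fixes_below_lcomp[OF T' V1(1) g2(1) g1(1) g2(2) g1(2) V1(2), folded g_def] by blast
    qed
  qed
qed

lemma insensitizable_ht: "adm T \<Longrightarrow> r > 0 \<Longrightarrow> insensitizable T r {y \<in> T. b < y \<and> ht_less T y n}"
proof (induction n arbitrary: T)
  case 0
  have "{y \<in> T. b < y \<and> ht_less T y 0} = {}" by (auto simp: ht_less_def) (metis append_Nil2)
  then show ?case using insensitizable_empty[OF 0(1)] by (simp only:)
next
  case (Suc n)
  let ?D = "{y \<in> T. b < y \<and> ht_less T y (Suc n)}"
  have "insensitizable T r ({y \<in> T. b < y \<and> ht_less T y n} \<union> ?D)"
    using ltreeD(1)[OF admD(1)[OF Suc.prems(1)]] Suc by (intro insensitizable_level) auto
  moreover have "{y \<in> T. b < y \<and> ht_less T y n} \<union> ?D = ?D"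
    by (auto simp: ht_less_def less_Suc_eq)
  ultimately show ?case by (simp only:)
qed

theorem insensitizable_all:
  assumes "adm T" "r > 0"
  shows "insensitizable T r {y \<in> T. b < y}"
proof -
  define n where "n = Suc (Max (length ` T))"
  have "ht_less T y n" for y
    unfolding ht_less_def
  proof (intro allI impI)
    fix q assume "y @ q \<in> T"
    then have "length (y @ q) \<le> Max (length ` T)"
      using ltreeD(1)[OF admD(1)[OF assms(1)]] by (intro Max_ge imageI) auto
    then show "length q < n" by (simp add: n_def)
  qed
  then have "{y \<in> T. b < y} = {y \<in> T. b < y \<and> ht_less T y n}" by blast
  then show ?thesis using insensitizable_ht[OF assms] by (simp only:)
qed

end

section \<open>Labels on the branch\<close>

lemma less_append_Cons [simp]: "p < p @ c # (q :: nat list)"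
  using append_less_cancel[of p "[]" "c # q"] by simp

lemma subst_map_snd: "snd a = snd a' \<Longrightarrow> map snd (subst p a) = map snd (subst p a')"
  by (auto simp: subst_def split: option.splits)

lemma multi_subst_map_snd:
  "map snd w = map snd w' \<Longrightarrow> map snd (multi_subst ps w) = map snd (multi_subst ps w')"
proof (induction ps arbitrary: w w')
  case (Cons p ps)
  show ?case
  proof (cases w)
    case Nil
    then show ?thesis using Cons.prems by simp
  next
    case (Cons a v)
    then obtain a' v' where "w' = a' # v'" "snd a = snd a'" "map snd v = map snd v'"
      using Cons.prems by (cases w') auto
    then show ?thesis using Cons Cons.IH[of v v'] subst_map_snd[of a a' p] by simp
  qed
qed simp

lemma strict_mono_pick:
  assumes "finite (C :: nat set)" "k \<le> card C"
  obtains \<sigma> where "\<And>a. a < k \<Longrightarrow> \<sigma> a \<in> C" "\<And>a b. a < b \<Longrightarrow> b < k \<Longrightarrow> \<sigma> a < \<sigma> b"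
proof
  let ?L = "sorted_list_of_set C"
  have L: "length ?L = card C" "sorted_wrt (<) ?L" "set ?L = C" using assms(1) by simp_all
  show "?L ! a \<in> C" if "a < k" for a using L(1,3) assms(2) that nth_mem[of a ?L] by simp
  show "?L ! a < ?L ! b" if "a < b" "b < k" for a b
    using sorted_wrt_nth_less[OF L(2), of a b] L(1) assms(2) that by simp
qed

section \<open>The region that receives the new leaf\<close>

context extensions
begin

text \<open>The image of the parent of the new leaf: as \<open>Max S'\<close> lies in the cone of
  this parent, the parent is its meet with \<open>Max S\<close>. The number \<open>m0\<close>
  defined next is the least direction at \<open>zv\<close> that leads beyond \<open>b\<close>, and
  \<open>region\<close> consists of the vertices reached through such directions.\<close>

definition "zv = ih (lcp (Max S) (Max S'))"
definition "m0 = (if b = zv then 0 else Suc (b ! length zv))"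

definition region :: "nat list \<Rightarrow> bool" where
  "region w \<longleftrightarrow> prefix zv w \<and> length zv < length w \<and> m0 \<le> w ! length zv"

lemma region_iff [simp]: "region (zv @ c # q) \<longleftrightarrow> m0 \<le> c"
  by (auto simp: region_def)

lemma regionE:
  assumes "region w"
  obtains c q where "w = zv @ c # q" "m0 \<le> c"
proof -
  obtain u where u: "w = zv @ u" using assms by (auto simp: region_def prefix_def)
  then show thesis using assms that by (cases u) (auto simp: region_def)
qed

lemma region_up: "region w \<Longrightarrow> prefix w w' \<Longrightarrow> region w'"
  by (erule regionE) (auto simp: prefix_def)

lemma lcp_in: "lcp (Max S) (Max S') \<in> S'"
  using ltreeD(3)[OF S'(1,3)] by simp

lemma zv:
  assumes "adm T"
  shows "zv \<in> T" "prefix zv b" "zv \<le> b"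
proof -
  show "zv \<in> T" unfolding zv_def using ih_in[OF assms lcp_in] .
  have "prefix (lcp (Max S) (Max S')) (Max S')" by simp
  then show "prefix zv b"
    unfolding zv_def b_def
    using lemb_prefix_iff[OF lhomD(3)[OF admD(2)[OF assms]] lcp_in S'(3) ltree_lcp[OF S'(1) lcp_in]] by blast
  then show "zv \<le> b" by (rule prefix_imp_le)
qed

lemma region_gt_b: "adm T \<Longrightarrow> region w \<Longrightarrow> b < w"
proof (erule regionE)
  fix c q assume T: "adm T" and w: "w = zv @ c # q" "m0 \<le> c"
  obtain v where v: "b = zv @ v" using zv(2)[OF T] by (auto simp: prefix_def)
  then show "b < w" using w by (cases v) (auto simp: m0_def)
qed

text \<open>The embedding sends the meet of \<open>Max S\<close> and \<open>Max S'\<close> to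
  \<open>zv\<close>. So the new leaf leaves the branch of \<open>b\<close> exactly at
  \<open>zv\<close>, and since it comes after \<open>b\<close>, it does so to the right, or above
  \<open>b\<close> when \<open>b = zv\<close>.\<close>

lemma region_end:
  assumes T: "adm T" and f: "(s, i) \<in> E T"
  shows "region (i (Max S))"
proof -
  note D = extD[OF f] and L = lhomD[OF extD(1)[OF f]]
  have M': "Max S' \<in> S" using S'(3) by blast
  have "i (lcp (Max S) (Max S')) = lcp (i (Max S)) (i (Max S'))"
    using lembD(3)[OF L(3) MS(1) M'] .
  then have l: "lcp (i (Max S)) b = zv" using D(2)[OF lcp_in] D(2)[OF S'(3)] by (simp add: zv_def b_def)
  from D(4) show ?thesis
  proof (cases rule: less_cases)
    case 1
    then have "b = zv" using l by (metis lcp_eq_right_iff strict_prefix_def)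
    then show ?thesis using 1 by (auto simp: m0_def elim!: strict_prefixE')
  next
    case (2 p a c q q')
    then have "p = zv" using l by simp
    then have "m0 = Suc a" using 2 by (auto simp: m0_def)
    then show ?thesis using 2 \<open>p = zv\<close> by simp
  qed
qed

text \<open>The points \<open>ih k\<close> are at most \<open>b\<close> and so outside the region;
  being prefixes of a vertex of the region, they are prefixes of \<open>zv\<close>. Hence a single
  alphabet of labels works throughout the region.\<close>

lemma consts_region:
  assumes T: "adm T" and w: "region w"
  shows "consts w = consts zv"
proof -
  obtain c q where cq: "w = zv @ c # q" "m0 \<le> c" using w by (rule regionE)
  have "prefix (ih k) zv" if k: "k \<in> S'" "prefix (ih k) w" for k
  proof -
    have "\<not> region (ih k)" using region_gt_b[OF T] ih_le_b[OF T k(1)] by fastforce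
    then show ?thesis using k(2) cq by (auto simp: prefix_append prefix_Cons)
  qed
  moreover have "prefix zv w" using cq by simp
  ultimately show ?thesis by (auto simp: consts_def dest: prefix_order.trans)
qed

text \<open>A vertex of the region together with the labels of the vertices on the branch leading to it is a
  word of pairs (label, direction).\<close>

definition matches :: "nat \<Rightarrow> (nat list \<times> nat) list \<Rightarrow> lmor \<Rightarrow> bool" where
  "matches c w f \<longleftrightarrow> snd f (Max S) = zv @ c # map snd w \<and>
     (\<forall>m < length w. fst f (zv @ c # map snd (take m w)) = fst (w ! m))"

text \<open>Labels up to \<open>b\<close> come from \<open>sh\<close>, those on the branch from the
  word, and the others are irrelevant by insensitivity. So a word has a well-defined colour.\<close>

lemma matches_unique:
  assumes T: "adm T" and ins: "\<And>y. y \<in> T \<Longrightarrow> b < y \<Longrightarrow> offins \<chi> T y"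
    and f: "f \<in> E T" "matches c w f" and f': "f' \<in> E T" "matches c w f'"
  shows "\<chi> f = \<chi> f'"
proof -
  obtain s i s' i' where ff: "f = (s, i)" "f' = (s', i')" by (metis surj_pair)
  have m: "i (Max S) = zv @ c # map snd w" "i' (Max S) = zv @ c # map snd w"
    using f(2) f'(2) by (auto simp: ff matches_def)
  then have ii: "i' = i" using ext_end_unique[of s' i' T s i] f f' by (simp add: ff)
  have fE: "(s, i) \<in> E T" "(s', i) \<in> E T" using f f' by (auto simp: ff ii)
  let ?u = "i (Max S)"
  let ?D = "{y \<in> T. b < y \<and> y < ?u \<and> \<not> prefix y ?u}"
  have "\<chi> (s, i) = \<chi> (s', i)"
  proof (rule offins_all[OF T fE(2) _ fE(1)])
    show "finite ?D" using ltreeD(1)[OF admD(1)[OF T]] by simp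
    show "y \<in> T \<and> b < y \<and> y < ?u \<and> \<not> prefix y ?u \<and> offins \<chi> T y" if "y \<in> ?D" for y
      using that ins by blast
    fix y assume y: "y \<notin> ?D"
    consider "y \<notin> below T ?u" | "y \<in> T" "y \<le> b" | "y = ?u" | "y \<in> T" "b < y" "y < ?u" "prefix y ?u"
      using y by fastforce
    then show "s y = s' y"
    proof cases
      case 1
      then show ?thesis
        using lhomD(4)[OF extD(1)[OF fE(1)]] lhomD(4)[OF extD(1)[OF fE(2)]] by (auto simp: extensional_def)
    next
      case 2
      then show ?thesis using extD(3)[OF fE(1)] extD(3)[OF fE(2)] by simp
    next
      case 3
      then show ?thesis using extD(6)[OF fE(1)] extD(6)[OF fE(2)] by simp
    next
      case 4
      have "\<not> prefix y zv" using prefix_imp_le zv(3)[OF T] 4(2) by fastforce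
      then obtain r where r: "y = zv @ c # r" "prefix r (map snd w)"
        using 4(4) m(1) by (auto simp: prefix_append prefix_Cons)
      have "y \<noteq> ?u" using 4(3) by blast
      then have "strict_prefix r (map snd w)" using r m(1) by (auto simp: strict_prefix_def)
      then have lt: "length r < length w" using prefix_length_less by fastforce
      have "r = map snd (take (length r) w)"
        using r(2) by (metis append_eq_conv_conj prefix_def take_map)
      then have "s y = fst (w ! length r)" "s' y = fst (w ! length r)"
        using f(2) f'(2) lt r(1) unfolding matches_def ff by (metis fst_conv)+
      then show ?thesis by simp
    qed
  qed
  then show ?thesis by (simp add: ff ii)
qed

text \<open>The region is replaced by \<open>M\<close> full trees with \<open>k\<close> directions
  at each vertex and height \<open>N\<close>. In such a tree every word of pairs (label, direction)
  up to length \<open>N\<close> describes an actual position.\<close>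

definition tower :: "nat list set \<Rightarrow> nat \<Rightarrow> nat \<Rightarrow> nat \<Rightarrow> nat list set" where
  "tower T k M N = {w \<in> T. \<not> region w} \<union>
     (\<lambda>(c, q). zv @ c # q) ` ({m0..<m0 + M} \<times> {q. set q \<subseteq> {..<k} \<and> length q \<le> N})"

lemma tower_cases:
  assumes "w \<in> tower T k M N"
  obtains "w \<in> T" "\<not> region w" | c q where "w = zv @ c # q" "m0 \<le> c" "c < m0 + M" "set q \<subseteq> {..<k}" "length q \<le> N"
  using assms by (auto simp: tower_def)

lemma tower:
  assumes T: "adm T"
  shows "ltree (tower T k M N)" "below T b = below (tower T k M N) b"
proof -
  note T' = admD(1)[OF T]
  have nr: "\<not> region w" if "w \<le> b" for w using region_gt_b[OF T] that by fastforce
  show "ltree (tower T k M N)"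
    unfolding ltree_def
  proof (intro conjI ballI allI impI)
    show "finite (tower T k M N)"
      using ltreeD(1)[OF T'] finite_lists_length_le[of "{..<k}" N] by (simp add: tower_def)
    show "[] \<in> tower T k M N" using ltreeD(2)[OF T'] nr by (simp add: tower_def)
    fix x y assume x: "x \<in> tower T k M N" and y: "prefix y x"
    from x show "y \<in> tower T k M N"
    proof (cases rule: tower_cases)
      case 1
      then show ?thesis using y ltreeD(3)[OF T'] region_up by (auto simp: tower_def)
    next
      case (2 c q)
      show ?thesis
      proof (cases "prefix y zv")
        case True
        then have "y \<le> b" using zv(3)[OF T] prefix_imp_le by (meson order.trans)
        then show ?thesis using True ltreeD(3)[OF T' zv(1)[OF T]] nr by (simp add: tower_def)
      next
        case False
        then obtain r where r: "y = zv @ c # r" "prefix r q"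
          using y 2(1) by (auto simp: prefix_append prefix_Cons)
        have "set r \<subseteq> {..<k} \<and> length r \<le> N"
          using r(2) 2 set_mono_prefix[OF r(2)] prefix_length_le[OF r(2)] by auto
        then show ?thesis using 2 r by (auto simp: tower_def)
      qed
    qed
  qed
  have "w \<notin> (\<lambda>(c, q). zv @ c # q) ` ({m0..<m0 + M} \<times> {q. set q \<subseteq> {..<k} \<and> length q \<le> N})" if "w \<le> b" for w
    using nr[OF that] by auto
  then have "w \<in> T \<longleftrightarrow> w \<in> tower T k M N" if "w \<le> b" for w
    using nr[OF that] that unfolding tower_def by blast
  then show "below T b = below (tower T k M N) b" by auto
qed

end

section \<open>The morphism into the tower given by Carlson-Simpson subspaces\<close>

lemma strict_prefix_map_take: "m < length xs \<Longrightarrow> strict_prefix (map f (take m xs)) (map f xs)"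
proof -
  assume m: "m < length xs"
  have "map f xs = map f (take m xs) @ map f (drop m xs)" by (simp flip: map_append)
  moreover have "map f (drop m xs) \<noteq> []" using m by simp
  ultimately show ?thesis by (metis append_self_conv prefixI strict_prefixI)
qed

text \<open>The numbers \<open>k\<close> and \<open>n\<close> bound the entries and the heights of
  \<open>T\<close>. Each direction \<open>c\<close> at \<open>zv\<close> has its own subspace,
  because the step from \<open>zv\<close> carries no label and is not a letter of the word;
  \<open>\<sigma>\<close> chooses the directions at \<open>zv\<close> that are used.\<close>

locale branching = extensions +
  fixes T :: "nat list set" and k n N M :: nat and \<sigma> :: "nat \<Rightarrow> nat"
    and w0 :: "nat \<Rightarrow> (nat list \<times> nat) list" and ps :: "nat \<Rightarrow> (nat list \<times> nat) option list list"
  assumes T: "adm T"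
    and entries: "x \<in> T \<Longrightarrow> set x \<subseteq> {..<k}" and heights: "x \<in> T \<Longrightarrow> length x < n"
    and sig: "a < k \<Longrightarrow> \<sigma> a \<in> {m0..<m0 + M}" and sig_mono: "a < a' \<Longrightarrow> a' < k \<Longrightarrow> \<sigma> a < \<sigma> a'"
    and ps_len: "c \<in> {m0..<m0 + M} \<Longrightarrow> length (ps c) = n"
    and w0: "c \<in> {m0..<m0 + M} \<Longrightarrow> set (w0 c) \<subseteq> consts zv \<times> {..<k}"
    and ps: "c \<in> {m0..<m0 + M} \<Longrightarrow> p \<in> set (ps c) \<Longrightarrow> left_var (consts zv \<times> {..<k}) p"
    and len: "c \<in> {m0..<m0 + M} \<Longrightarrow> w \<in> short_words (consts zv \<times> {..<k}) n \<Longrightarrow>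
      length (w0 c @ multi_subst (ps c) w) \<le> N"
begin

abbreviation "A \<equiv> consts zv \<times> {..<k}"
abbreviation "V \<equiv> tower T k M N"

definition "iota c w = w0 c @ multi_subst (ps c) w"
text \<open>The directions of an image word depend only on the directions of the given word, so the
  label \<open>[]\<close> serves as a dummy. This is why \<open>j\<close> can be defined without
  knowing any labels.\<close>

definition "dirs c q = map snd (iota c (map (Pair []) q))"

definition j :: "nat list \<Rightarrow> nat list" where
  "j = (\<lambda>w \<in> T. if region w
     then zv @ \<sigma> (w ! length zv) # dirs (\<sigma> (w ! length zv)) (drop (Suc (length zv)) w) else w)"

text \<open>A new vertex \<open>w\<close> is labelled by the pattern that starts at the last image of a vertex of \<open>T\<close>
  below \<open>w\<close>.\<close>

definition bel :: "nat list \<Rightarrow> nat list set" where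
  "bel w = {u \<in> T. region u \<and> prefix (j u) w}"

text \<open>At a variable the label is the vertex \<open>u\<close> whose image starts the pattern; a
  constant \<open>k\<close> is represented by \<open>ih k\<close>, which every extension sends to
  \<open>k\<close>. The directions of \<open>w\<close> beyond \<open>j u\<close> are not compared
  with the pattern, since vertices off the images of branches need labels too; past the end of the
  pattern the root is taken.\<close>

definition label :: "nat list \<Rightarrow> nat list" where
  "label w = (let c = w ! length zv; P = bel w in
     if P = {} then
       (let l = length w - Suc (length zv) in if l < length (w0 c) then ih (fst (w0 c ! l)) else [])
     else
       (let u = Max P; l = length w - length (j u); p = ps c ! (length u - Suc (length zv)) in
        if l < length p then (case p ! l of None \<Rightarrow> u | Some e \<Rightarrow> ih (fst e)) else []))"

definition t :: "nat list \<Rightarrow> nat list" where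
  "t = (\<lambda>w \<in> below V (j (Max T)). if region w then label w else w)"

lemma T': "ltree T" using admD(1)[OF T] .

lemma map_snd_iota: "map snd (iota c w) = dirs c (map snd w)"
  unfolding dirs_def iota_def using multi_subst_map_snd[of w "map (Pair []) (map snd w)" "ps c"]
  by (simp add: o_def)

lemma iota_snoc: "c \<in> {m0..<m0 + M} \<Longrightarrow> length w < n \<Longrightarrow> iota c (w @ [a]) = iota c w @ subst (ps c ! length w) a"
  using ps_len by (simp add: iota_def multi_subst_snoc)

lemma ps_nth: "c \<in> {m0..<m0 + M} \<Longrightarrow> l < n \<Longrightarrow> left_var A (ps c ! l)"
  using ps ps_len nth_mem by metis

lemma dirs_snoc:
  assumes "c \<in> {m0..<m0 + M}" "length q < n"
  shows "\<exists>r. dirs c (q @ [a]) = dirs c q @ a # r"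
proof -
  obtain p where "ps c ! length q = None # p" using ps_nth[OF assms] by (auto simp: left_var_def)
  then show ?thesis using iota_snoc[OF assms(1), of "map (Pair []) q" "([], a)"] assms(2) by (simp add: dirs_def)
qed

lemma iota_words:
  assumes "c \<in> {m0..<m0 + M}" "w \<in> short_words A n"
  shows "iota c w \<in> short_words A N"
  using len[OF assms] w0[OF assms(1)] assms(2) multi_subst_set[of "ps c" A w] ps[OF assms(1)] left_var_opts
  unfolding iota_def by (fastforce simp del: subst_simps)

lemma T_region:
  assumes "zv @ c # q \<in> T"
  shows "c < k" "\<sigma> c \<in> {m0..<m0 + M}" "set q \<subseteq> {..<k}" "length q < n"
  using entries[OF assms] heights[OF assms] sig by auto

lemma j_region: "zv @ c # q \<in> T \<Longrightarrow> m0 \<le> c \<Longrightarrow> j (zv @ c # q) = zv @ \<sigma> c # dirs (\<sigma> c) q"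
  by (simp add: j_def)

lemma j_id: "x \<in> T \<Longrightarrow> \<not> region x \<Longrightarrow> j x = x"
  by (simp add: j_def)

lemma Nil_A: "set q \<subseteq> {..<k} \<Longrightarrow> set (map (Pair []) q) \<subseteq> A"
  using ih_Nil(1)[OF T] ih_Nil(2) by (auto simp: consts_def)

lemma j_in: "x \<in> T \<Longrightarrow> j x \<in> V"
proof (cases "region x")
  case True
  assume x: "x \<in> T"
  obtain c q where cq: "x = zv @ c # q" "m0 \<le> c" using True by (rule regionE)
  note R = T_region[OF x[unfolded cq(1)]]
  have "iota (\<sigma> c) (map (Pair []) q) \<in> short_words A N"
    using iota_words[OF R(2)] Nil_A[OF R(3)] R(4) by simp
  then have "set (dirs (\<sigma> c) q) \<subseteq> {..<k}" "length (dirs (\<sigma> c) q) \<le> N" by (auto simp: dirs_def)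
  then show ?thesis using j_region x R(2) cq by (auto simp: tower_def)
qed (simp add: j_id tower_def)

text \<open>A block begins with its variable, so above \<open>zv\<close> directions are kept. At
  \<open>zv\<close> the directions from \<open>m0\<close> on are replaced by their values under
  \<open>\<sigma>\<close>, which is increasing with values at least \<open>m0\<close>, so the
  smaller directions stay to the left.\<close>

lemma lemb_j: "lemb T j"
proof (rule lemb_label_localI[where lab = "\<lambda>x a. if x = zv \<and> m0 \<le> a then \<sigma> a else a"])
  show "ltree T" by (rule T')
  show "j [] = []" using j_id[OF ltreeD(2)[OF T']] by (simp add: region_def)
next
  fix x a assume xa: "x @ [a] \<in> T"
  then have x: "x \<in> T" using ltreeD(3)[OF T' xa] by simp
  consider c q where "x = zv @ c # q" "m0 \<le> c" | "\<not> region x" "region (x @ [a])" | "\<not> region (x @ [a])"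
    by (metis regionE)
  then show "prefix (j x @ [if x = zv \<and> m0 \<le> a then \<sigma> a else a]) (j (x @ [a]))"
  proof cases
    case 1
    note R = T_region[OF x[unfolded 1(1)]]
    show ?thesis
      using dirs_snoc[OF R(2) R(4), of a] j_region[of c q] j_region[of c "q @ [a]"] x xa 1 by auto
  next
    case 2
    then obtain c q where cq: "x @ [a] = zv @ c # q" "m0 \<le> c" by (metis regionE)
    have "q = []"
    proof (rule ccontr)
      assume "q \<noteq> []"
      then obtain q' d where "q = q' @ [d]" by (metis rev_exhaust)
      then have "x @ [a] = (zv @ c # q') @ [d]" using cq(1) by simp
      then have "x = zv @ c # q'" by (simp only: append1_eq_conv)
      then show False using 2(1) cq(2) by simp
    qed
    then have "x = zv" "a = c" using cq(1) by simp_all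
    moreover have "j (zv @ [c]) = zv @ \<sigma> c # dirs (\<sigma> c) []" using j_region[of c "[]"] xa cq calculation by simp
    moreover have "prefix (zv @ [\<sigma> c]) (zv @ \<sigma> c # dirs (\<sigma> c) [])" by simp
    ultimately show ?thesis using cq(2) j_id[OF x 2(1)] by (simp only: if_True simp_thms)
  next
    case 3
    then have "\<not> region x" using region_up[of x "x @ [a]"] by auto
    moreover have "\<not> (x = zv \<and> m0 \<le> a)" using 3 by auto
    ultimately show ?thesis using j_id[OF xa 3] j_id[OF x] by (simp only: if_False) simp
  qed
next
  fix x a a' assume "x @ [a] \<in> T" "x @ [a'] \<in> T" "a < a'"
  moreover have "a' < k" using entries[OF \<open>x @ [a'] \<in> T\<close>] by simp
  ultimately show "(if x = zv \<and> m0 \<le> a then \<sigma> a else a) < (if x = zv \<and> m0 \<le> a' then \<sigma> a' else a')"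
    using sig[of a'] sig_mono[of a a'] by auto
qed

lemma j_le: "x \<in> T \<Longrightarrow> j x \<le> j (Max T)"
  using lemb_le_iff[OF lemb_j _ ltree_Max(1)[OF T']] ltree_Max(2)[OF T'] by blast

lemma j_prefix_iff: "x \<in> T \<Longrightarrow> y \<in> T \<Longrightarrow> prefix (j x) (j y) \<longleftrightarrow> prefix x y"
  using lemb_prefix_iff[OF lemb_j _ _ ltree_lcp[OF T']] by blast

lemma consts_zv:
  assumes "x \<in> consts zv"
  shows "ih x \<in> T" "j (ih x) = ih x" "prefix (ih x) zv" "x \<in> S'"
proof -
  show x: "x \<in> S'" "prefix (ih x) zv" using assms by (auto simp: consts_def)
  show "ih x \<in> T" using ih_in[OF T x(1)] .
  moreover have "\<not> region (ih x)" using region_gt_b[OF T] ih_le_b[OF T x(1)] by fastforce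
  ultimately show "j (ih x) = ih x" by (rule j_id)
qed

lemma Max_P:
  assumes "finite P" "u \<in> P" "\<And>u'. u' \<in> P \<Longrightarrow> prefix u' u"
  shows "Max P = (u :: nat list)"
  using assms prefix_imp_le by (intro Max_eqI) auto

lemma finP: "finite (bel w)"
  using ltreeD(1)[OF T'] by (simp add: bel_def)

lemma label_eq:
  assumes "Max (bel w) = u" "bel w \<noteq> {}" "w ! length zv = c" "length w - length (j u) = l"
    "length u - Suc (length zv) = l'" "l < length (ps c ! l')"
  shows "label w = (case ps c ! l' ! l of None \<Rightarrow> u | Some e \<Rightarrow> ih (fst e))"
  using assms by (simp add: label_def)

lemma label_ok:
  assumes w: "w \<in> V" "region w"
  shows "label w \<in> T \<and> prefix (j (label w)) w"
proof -
  obtain c q where cq: "w = zv @ c # q" "m0 \<le> c" using w(2) by (rule regionE)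
  have c: "c \<in> {m0..<m0 + M}" using w(1) cq by (auto elim!: tower_cases)
  have pw: "prefix zv w" using cq by simp
  have nil: "[] \<in> T \<and> prefix (j []) w"
    using ltreeD(2)[OF T'] lembD(1)[OF lemb_j] by simp
  have const: "ih x \<in> T \<and> prefix (j (ih x)) w" if "x \<in> consts zv" for x
    using consts_zv[OF that] pw prefix_order.trans by metis
  let ?P = "bel w"
  show ?thesis
  proof (cases "?P = {}")
    case True
    have "fst (w0 c ! l) \<in> consts zv" if "l < length (w0 c)" for l
      using w0[OF c] nth_mem[OF that] by auto
    then show ?thesis using nil const True cq by (simp add: label_def Let_def)
  next
    case False
    define u where "u = Max ?P"
    have "u \<in> ?P" unfolding u_def using Max_in[OF finP False] .
    then have u: "u \<in> T" "region u" "prefix (j u) w" by (auto simp: bel_def)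
    obtain c' q' where u': "u = zv @ c' # q'" using u(2) by (rule regionE)
    define p where "p = ps c ! (length u - Suc (length zv))"
    have "left_var A p" unfolding p_def u' using ps_nth[OF c] T_region(4) u(1) u' by simp
    then have "fst e \<in> consts zv" if "p ! l = Some e" "l < length p" for l e
      using left_var_opts nth_mem[OF that(2)] that(1) by fastforce
    then show ?thesis
      using nil const u False unfolding label_def Let_def u_def[symmetric] p_def[symmetric]
      using cq p_def by (auto split: option.split)
  qed
qed

text \<open>At \<open>j x\<close> the last image is that of \<open>x\<close> and the pattern is at
  its position 0, which is a variable because blocks are left variable words. The bound
  \<open>n\<close> on heights guarantees that there is such a next block.\<close>

lemma t_j: "x \<in> T \<Longrightarrow> t (j x) = x"
proof (cases "region x")
  case True
  assume x: "x \<in> T"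
  obtain c q where cq: "x = zv @ c # q" "m0 \<le> c" using True by (rule regionE)
  note R = T_region[OF x[unfolded cq(1)]]
  have jx: "j x = zv @ \<sigma> c # dirs (\<sigma> c) q" using j_region x cq by simp
  let ?P = "bel (j x)"
  have "Max ?P = x"
    using x True j_prefix_iff by (intro Max_P[OF finP]) (auto simp: bel_def)
  moreover have "?P \<noteq> {}" using x True by (auto simp: bel_def)
  moreover obtain p where "ps (\<sigma> c) ! length q = None # p" using ps_nth[OF R(2,4)] by (auto simp: left_var_def)
  ultimately have "label (j x) = x" unfolding label_def Let_def using jx cq by simp
  then show ?thesis using jx R(2) j_in[OF x] j_le[OF x] by (simp add: t_def)
next
  case False
  assume x: "x \<in> T"
  then show ?thesis using False j_id j_in[OF x] j_le[OF x] by (simp add: t_def)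
qed

lemma tj_lhom: "(t, j) \<in> lhom T V"
proof (rule lhomI)
  show "j \<in> extensional T" "t \<in> extensional (below V (j (Max T)))" by (simp_all add: j_def t_def)
  fix y assume y: "y \<in> V" "y \<le> j (Max T)"
  show "t y \<in> T \<and> prefix (j (t y)) y"
  proof (cases "region y")
    case True
    then show ?thesis using label_ok y by (simp add: t_def)
  next
    case False
    then have "y \<in> T" using y(1) by (auto elim!: tower_cases)
    then show ?thesis using y False j_id by (simp add: t_def)
  qed
qed (use j_in lemb_j t_j in auto)

lemma tj_fixes: "fixes_below T b (t, j)"
  unfolding fixes_below_def
proof
  fix y assume y: "y \<in> below T b"
  then have "\<not> region y" using region_gt_b[OF T] by fastforce
  then show "fst (t, j) y = y \<and> snd (t, j) y = y" using y j_id[of y] t_j[of y] by simp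
qed

definition word :: "(nat list \<Rightarrow> nat list) \<Rightarrow> nat \<Rightarrow> nat list \<Rightarrow> (nat list \<times> nat) list" where
  "word s c q = map (\<lambda>l. (s (zv @ c # take l q), q ! l)) [0..<length q]"

lemma word_snoc: "word s c (q @ [a]) = word s c q @ [(s (zv @ c # q), a)]"
  by (auto simp: word_def nth_append)

lemma word_simps [simp]: "length (word s c q) = length q" "map snd (word s c q) = q"
  by (auto simp: word_def o_def intro: nth_equalityI)

text \<open>Between \<open>j x\<close> and the image of a child of \<open>x\<close> the last image
  is that of \<open>x\<close>, so \<open>t\<close> takes the value \<open>x\<close> at the variables
  of the current block and \<open>s\<close> turns this into \<open>s x\<close>. This is exactly the
  letter substituted into that block by \<open>word\<close>.\<close>

lemma branch_labels:
  assumes f: "(s, i) \<in> E T" and c: "m0 \<le> c"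
  shows "zv @ c # q \<in> T \<Longrightarrow> m < length (iota (\<sigma> c) (word s c q)) \<Longrightarrow>
    s (t (zv @ \<sigma> c # map snd (take m (iota (\<sigma> c) (word s c q))))) = fst (iota (\<sigma> c) (word s c q) ! m)"
proof (induction q arbitrary: m rule: rev_induct)
  case Nil
  note R = T_region[OF Nil(1)]
  let ?x = "zv @ [c]"
  have iota0: "iota (\<sigma> c) (word s c []) = w0 (\<sigma> c)" by (simp add: iota_def word_def)
  let ?w = "zv @ \<sigma> c # map snd (take m (w0 (\<sigma> c)))"
  have m: "m < length (w0 (\<sigma> c))" using Nil(2) iota0 by simp
  have jx: "j ?x = zv @ \<sigma> c # map snd (w0 (\<sigma> c))"
    using j_region[OF Nil(1) c] iota0 by (simp add: dirs_def word_def iota_def)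
  have pw: "strict_prefix ?w (j ?x)"
    using strict_prefix_map_take[OF m, of snd] unfolding jx by (simp add: strict_prefix_def)
  \<comment> \<open>An image below \<open>?w\<close> would come from a proper prefix of
    \<open>?x\<close>, hence from a vertex at or below \<open>zv\<close>, and such vertices are
    outside the region. So the constant beginning \<open>w0\<close> is being read.\<close>
  have P: "bel ?w = {}"
  proof -
    have False if u: "u \<in> T" "region u" "prefix (j u) ?w" for u
    proof -
      have "prefix (j u) (j ?x)" "j u \<noteq> j ?x" using u pw by (auto simp: strict_prefix_def dest: prefix_order.trans prefix_order.antisym)
      then have "prefix u ?x" "u \<noteq> ?x" using j_prefix_iff[OF u(1) Nil(1)] by auto
      then have "prefix u zv" by (simp add: prefix_snoc)
      then show False using u(2) prefix_length_le by (fastforce simp: region_def)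
    qed
    then show ?thesis by (auto simp: bel_def)
  qed
  have wV: "?w \<in> V" using ltreeD(3)[OF tower(1)[OF T] j_in[OF Nil(1)]] pw by (simp add: strict_prefix_def)
  have wle: "?w \<le> j (Max T)" using strict_prefix_imp_less[OF pw] j_le[OF Nil(1)] by simp
  have "label ?w = ih (fst (w0 (\<sigma> c) ! m))"
    using P m unfolding label_def Let_def by simp
  then have "t ?w = ih (fst (w0 (\<sigma> c) ! m))" using wV wle R(2) by (simp add: t_def)
  moreover have "fst (w0 (\<sigma> c) ! m) \<in> consts zv" using w0[OF R(2)] nth_mem[OF m] by auto
  ultimately show ?case using extD(10)[OF f] consts_zv(4) iota0 by simp
next
  case (snoc a q)
  let ?c = "\<sigma> c"
  let ?x = "zv @ c # q" and ?xa = "zv @ c # (q @ [a])"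
  have xT: "?x \<in> T" using ltreeD(3)[OF T' snoc.prems(1), of ?x] by simp
  note R = T_region[OF xT]
  let ?p = "ps ?c ! length q"
  let ?y = "(s ?x, a)"
  have io: "iota ?c (word s c (q @ [a])) = iota ?c (word s c q) @ subst ?p ?y"
    using iota_snoc[OF R(2), of "word s c q" ?y] R(4) by (simp add: word_snoc)
  show ?case
  proof (cases "m < length (iota ?c (word s c q))")
    case True
    then show ?thesis using snoc.IH[OF xT True] io by (simp add: nth_append)
  next
    case False
    define l where "l = m - length (iota ?c (word s c q))"
    have m: "m = length (iota ?c (word s c q)) + l" using False by (simp add: l_def)
    have l: "l < length ?p" using snoc.prems(2) m io by simp
    let ?w = "zv @ ?c # map snd (take m (iota ?c (word s c (q @ [a]))))"
    have jx: "j ?x = zv @ ?c # map snd (iota ?c (word s c q))"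
      using j_region[OF xT c] map_snd_iota by simp
    have jxa: "j ?xa = zv @ ?c # map snd (iota ?c (word s c (q @ [a])))"
      using j_region[OF snoc.prems(1) c] map_snd_iota by simp
    have w: "?w = j ?x @ map snd (take l (subst ?p ?y))" unfolding jx io m by simp
    have pw: "strict_prefix ?w (j ?xa)"
      using strict_prefix_map_take[OF snoc.prems(2), of snd] unfolding jxa by (simp add: strict_prefix_def)
    have x_bel: "?x \<in> bel ?w" unfolding w using xT c by (simp add: bel_def)
    \<comment> \<open>Images below \<open>?w\<close> come from proper prefixes of
      \<open>?xa\<close>, the longest of which is \<open>?x\<close>; so the current block is the one
      with index \<open>length q\<close>.\<close>
    have "Max (bel ?w) = ?x"
    proof (rule Max_P[OF finP])
      show "?x \<in> bel ?w" by (rule x_bel)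
      fix u assume "u \<in> bel ?w"
      then have u: "u \<in> T" "prefix (j u) ?w" by (simp_all add: bel_def)
      then have "prefix (j u) (j ?xa)" "j u \<noteq> j ?xa"
        using pw by (auto simp: strict_prefix_def dest: prefix_order.trans prefix_order.antisym)
      then have "prefix u ((zv @ c # q) @ [a])" "u \<noteq> (zv @ c # q) @ [a]" using j_prefix_iff[of u ?xa] u snoc.prems(1) by auto
      then show "prefix u ?x" by (simp only: prefix_snoc) blast
    qed
    moreover have "bel ?w \<noteq> {}" using x_bel by blast
    moreover have "?w ! length zv = ?c" by simp
    moreover have "length ?w - length (j ?x) = l" unfolding w using l by simp
    moreover have "length ?x - Suc (length zv) = length q" by simp
    ultimately have lab: "label ?w = (case ?p ! l of None \<Rightarrow> ?x | Some e \<Rightarrow> ih (fst e))"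
      using l by (rule label_eq)
    have wV: "?w \<in> V" using ltreeD(3)[OF tower(1)[OF T] j_in[OF snoc.prems(1)]] pw by (simp add: strict_prefix_def)
    have wle: "?w \<le> j (Max T)" using strict_prefix_imp_less[OF pw] j_le[OF snoc.prems(1)] by simp
    have "region ?w" using R(2) by simp
    then have "t ?w = (case ?p ! l of None \<Rightarrow> ?x | Some e \<Rightarrow> ih (fst e))" using wV wle lab by (simp add: t_def)
    moreover have "fst e \<in> consts zv" if "?p ! l = Some e" for e
      using left_var_opts[OF ps_nth[OF R(2) R(4)]] nth_mem[OF l] that by fastforce
    ultimately have "s (t ?w) = fst (subst ?p ?y ! l)"
      using extD(10)[OF f] consts_zv(4) l by (auto simp: subst_def split: option.splits)
    then show ?thesis using io m by simp
  qed
qed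

lemma word_A:
  assumes f: "(s, i) \<in> E T" and q: "i (Max S) = zv @ c # q" "m0 \<le> c"
  shows "word s c q \<in> short_words A n"
proof -
  have u: "zv @ c # q \<in> T" using extD(5)[OF f] q by simp
  note R = T_region[OF u]
  have "s (zv @ c # take l q) \<in> consts zv" if "l < length q" for l
  proof -
    let ?y = "zv @ c # take l q"
    have p: "strict_prefix ?y (zv @ c # q)" using strict_prefix_map_take[OF that, of id] by (simp add: strict_prefix_def)
    then have "?y \<in> T" using ltreeD(3)[OF T' u] by (simp add: strict_prefix_def)
    then have "s ?y \<in> consts ?y" using extD(9)[OF f] strict_prefix_imp_less[OF p] q by simp
    then show ?thesis using consts_region[OF T, of ?y] q(2) by simp
  qed
  moreover have "q ! l < k" if "l < length q" for l using R(3) nth_mem[OF that] by auto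
  ultimately show ?thesis using R(4) by (auto simp: word_def)
qed

text \<open>Composition with \<open>(t, j)\<close> thus acts on words as \<open>iota\<close>, and
  one colour on the subspace means one colour on the extensions.\<close>

lemma lcomp_matches:
  assumes f: "(s, i) \<in> E T" and q: "i (Max S) = zv @ c # q" "m0 \<le> c"
  shows "matches (\<sigma> c) (iota (\<sigma> c) (word s c q)) (lcomp V S (t, j) (s, i))"
proof -
  have u: "zv @ c # q \<in> T" using extD(5)[OF f] q by simp
  let ?w = "iota (\<sigma> c) (word s c q)"
  have ju: "j (i (Max S)) = zv @ \<sigma> c # map snd ?w"
    using j_region[OF u q(2)] q map_snd_iota by simp
  have "(\<lambda>y \<in> below V (j (i (Max S))). s (t y)) (zv @ \<sigma> c # map snd (take m ?w)) = fst (?w ! m)" if m: "m < length ?w" for m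
  proof -
    have "prefix (zv @ \<sigma> c # map snd (take m ?w)) (j (i (Max S)))"
      unfolding ju using strict_prefix_map_take[OF m, of snd] by (simp add: strict_prefix_def)
    then have "zv @ \<sigma> c # map snd (take m ?w) \<in> below V (j (i (Max S)))"
      using ltreeD(3)[OF tower(1)[OF T] j_in[OF extD(5)[OF f]]] prefix_imp_le by simp
    then show ?thesis using branch_labels[OF f q(2) u m] by simp
  qed
  then show ?thesis using MS ju by (simp add: matches_def lcomp_def)
qed

end

section \<open>Homogeneity for the extensions of one rigid surjection\<close>

context extensions
begin

text \<open>Insensitivity turns the colouring of extensions into one colouring of words for each
  direction at \<open>zv\<close>. Each has a monochromatic subspace, and a final pigeonhole argument
  selects directions whose subspaces have the same colour.\<close>

lemma branch_homogeneous:
  assumes T: "adm T" and r: "(r::nat) > 0"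
  shows "\<exists>V. ltree V \<and> below T b = below V b \<and>
    (\<forall>\<chi> \<in> lhom S V \<rightarrow> {..<r}. (\<forall>y \<in> V. b < y \<longrightarrow> offins \<chi> V y) \<longrightarrow>
      (\<exists>g \<in> lhom T V. fixes_below T b g \<and>
        (\<forall>f \<in> E T. \<forall>f' \<in> E T. \<chi> (lcomp V S g f) = \<chi> (lcomp V S g f'))))"
proof -
  note T' = admD(1)[OF T]
  obtain k :: nat where k: "k > 0" "\<And>x. x \<in> T \<Longrightarrow> set x \<subseteq> {..<k}"
  proof
    have fin: "finite (\<Union>(set ` T))" using ltreeD(1)[OF T'] by simp
    show "set x \<subseteq> {..<Suc (Max (insert 0 (\<Union>(set ` T))))}" if "x \<in> T" for x
    proof
      fix a assume "a \<in> set x"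
      then have "a \<le> Max (insert 0 (\<Union>(set ` T)))" using that fin by (intro Max_ge) auto
      then show "a \<in> {..<Suc (Max (insert 0 (\<Union>(set ` T))))}" by simp
    qed
  qed simp
  define n where "n = Suc (Max (length ` T))"
  have n: "length x < n" if "x \<in> T" for x
    using Max_ge[OF _ imageI[OF that, of length]] ltreeD(1)[OF T'] by (simp add: n_def less_Suc_eq_le)
  define A where "A = consts zv \<times> {..<k}"
  have finA: "finite A" using ltreeD(1)[OF S'(1)] by (simp add: A_def consts_def)
  have neA: "A \<noteq> {}" using k(1) ih_Nil(1)[OF T] ih_Nil(2) by (auto simp: A_def consts_def)
  obtain N where N: "\<And>c::(nat list \<times> nat) list \<Rightarrow> nat. c \<in> short_words A N \<rightarrow> {..<r} \<Longrightarrow>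
    (\<exists>w0 ps \<rho>. length ps = n \<and> set w0 \<subseteq> A \<and> (\<forall>p \<in> set ps. left_var A p) \<and>
      (\<forall>w \<in> short_words A n. length (w0 @ multi_subst ps w) \<le> N \<and> c (w0 @ multi_subst ps w) = \<rho>))"
    using Carlson_Simpson[OF finA neA r, of n] by (elim exE) (rule that, blast)
  \<comment> \<open>With \<open>r * k\<close> directions and \<open>r\<close> colours, some colour
    is shared by at least \<open>k\<close> directions, as many as \<open>T\<close> can use at
    \<open>zv\<close>.\<close>
  define M where "M = r * k"
  define V where "V = tower T k M N"
  have V: "ltree V" "below T b = below V b" unfolding V_def using tower[OF T] by blast+
  have aV: "adm V" using adm_cong[OF T V] .
  have main: "\<exists>g \<in> lhom T V. fixes_below T b g \<and>
        (\<forall>f \<in> E T. \<forall>f' \<in> E T. \<chi> (lcomp V S g f) = \<chi> (lcomp V S g f'))"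
    if chi: "\<chi> \<in> lhom S V \<rightarrow> {..<r}" and ins: "\<And>y. y \<in> V \<Longrightarrow> b < y \<Longrightarrow> offins \<chi> V y" for \<chi>
  proof -
    \<comment> \<open>The choice of the extension is immaterial by \<open>matches_unique\<close>; a
      word that no extension realizes gets 0, which is a colour since \<open>r > 0\<close>.\<close>
    define d where "d c w = (if \<exists>f. f \<in> E V \<and> matches c w f
      then \<chi> (SOME f. f \<in> E V \<and> matches c w f) else 0)" for c w
    have d_eq: "d c w = \<chi> f" if f: "f \<in> E V" "matches c w f" for c w f
    proof -
      have "(SOME f. f \<in> E V \<and> matches c w f) \<in> E V \<and> matches c w (SOME f. f \<in> E V \<and> matches c w f)"
        by (rule someI[of "\<lambda>f. f \<in> E V \<and> matches c w f" f]) (use f in blast)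
      then show ?thesis using f matches_unique[OF aV ins] unfolding d_def by meson
    qed
    have dr: "d c w < r" for c w
    proof (cases "\<exists>f. f \<in> E V \<and> matches c w f")
      case True
      then obtain f where f: "f \<in> E V" "matches c w f" by blast
      then have "f \<in> lhom S V" by (simp add: ext_def)
      then show ?thesis using funcset_mem[OF chi] d_eq[OF f] by simp
    next
      case False
      then show ?thesis unfolding d_def using r by (simp only: if_False)
    qed
    define Q where "Q c w0 ps \<rho> \<longleftrightarrow> length ps = n \<and> set w0 \<subseteq> A \<and> (\<forall>p \<in> set ps. left_var A p) \<and>
      (\<forall>w \<in> short_words A n. length (w0 @ multi_subst ps w) \<le> N \<and> d c (w0 @ multi_subst ps w) = \<rho>)"
      for c w0 ps \<rho>
    have "\<forall>c. \<exists>w0 ps \<rho>. Q c w0 ps \<rho>"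
      unfolding Q_def using N dr by simp
    then obtain w0 ps \<rho> where Q: "\<And>c. Q c (w0 c) (ps c) (\<rho> c)" by metis
    have \<rho>r: "\<rho> c < r" for c
    proof -
      have "[] \<in> short_words A n" by simp
      then have "d c (w0 c @ multi_subst (ps c) []) = \<rho> c" using Q[of c] unfolding Q_def by blast
      then show ?thesis using dr by metis
    qed
    have "\<exists>\<rho>0. card {c \<in> {m0..<m0 + M}. \<rho> c = \<rho>0} \<ge> k"
    proof (rule ccontr)
      assume "\<not> ?thesis"
      then have "\<not> k \<le> card {c \<in> {m0..<m0 + M}. \<rho> c = \<rho>0}" for \<rho>0 by blast
      then have le: "card {c \<in> {m0..<m0 + M}. \<rho> c = \<rho>0} \<le> k - 1" for \<rho>0
        using k(1) by (metis Suc_diff_1 less_Suc_eq_le not_le)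
      have U: "{m0..<m0 + M} = (\<Union>\<rho>0 \<in> {..<r}. {c \<in> {m0..<m0 + M}. \<rho> c = \<rho>0})"
        using \<rho>r by auto
      have "M = card {m0..<m0 + M}" by simp
      also have "\<dots> \<le> (\<Sum>\<rho>0<r. card {c \<in> {m0..<m0 + M}. \<rho> c = \<rho>0})"
        by (rule ord_eq_le_trans[OF arg_cong[OF U, of card] card_UN_le[OF finite_lessThan]])
      also have "\<dots> \<le> (\<Sum>\<rho>0<r. k - 1)" by (intro sum_mono le)
      also have "\<dots> < M" using k(1) r by (simp add: M_def)
      finally show False by simp
    qed
    then obtain \<rho>0 where \<rho>0: "k \<le> card {c \<in> {m0..<m0 + M}. \<rho> c = \<rho>0}" by blast
    obtain \<sigma> where \<sigma>: "\<And>a. a < k \<Longrightarrow> \<sigma> a \<in> {c \<in> {m0..<m0 + M}. \<rho> c = \<rho>0}"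
      "\<And>a b. a < b \<Longrightarrow> b < k \<Longrightarrow> \<sigma> a < \<sigma> b"
      by (rule strict_mono_pick[OF _ \<rho>0]) auto
    interpret br: branching S sh ih T k n N M \<sigma> w0 ps
    proof unfold_locales
      show "adm T" by fact
      show "\<And>x. x \<in> T \<Longrightarrow> set x \<subseteq> {..<k}" by (rule k(2))
      show "\<And>x. x \<in> T \<Longrightarrow> length x < n" by (rule n)
      show "\<And>a. a < k \<Longrightarrow> \<sigma> a \<in> {m0..<m0 + M}" using \<sigma>(1) by blast
      show "\<And>a a'. a < a' \<Longrightarrow> a' < k \<Longrightarrow> \<sigma> a < \<sigma> a'" by (rule \<sigma>(2))
    qed (use Q in \<open>unfold Q_def A_def, blast\<close>)+
    have col: "\<chi> (lcomp V S (br.t, br.j) f) = \<rho>0" if f: "f \<in> E T" for f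
    proof -
      obtain s i where si: "f = (s, i)" by (metis surj_pair)
      obtain c q where cq: "i (Max S) = zv @ c # q" "m0 \<le> c"
        using region_end[OF T] f si by (metis regionE)
      have f': "(s, i) \<in> E T" using f si by simp
      note m = br.lcomp_matches[OF f' cq, folded V_def]
      have u: "zv @ c # q \<in> T" using extD(5)[OF f'] cq by simp
      have "lcomp V S (br.t, br.j) (s, i) \<in> E V"
        using ext_lcomp[OF T br.tj_lhom[folded V_def] br.tj_fixes V(2) f'] .
      then have "\<chi> (lcomp V S (br.t, br.j) (s, i)) = d (\<sigma> c) (br.iota (\<sigma> c) (br.word s c q))"
        using d_eq m by simp
      also have "\<dots> = \<rho> (\<sigma> c)"
        using Q[of "\<sigma> c"] br.word_A[OF f' cq] unfolding Q_def br.iota_def A_def by blast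
      also have "\<dots> = \<rho>0" using \<sigma>(1) br.T_region(1)[OF u] by blast
      finally show ?thesis by (simp add: si)
    qed
    then show ?thesis
      using br.tj_lhom[folded V_def] br.tj_fixes by (intro bexI[of _ "(br.t, br.j)"]) auto
  qed
  show ?thesis using V main by (intro exI[of _ V]) blast
qed

text \<open>The tower over \<open>T\<close> is built before insensitivity is arranged, because
  insensitivity is needed at all vertices of the tower: \<open>U\<close> is the tower and
  \<open>V\<close> makes colourings insensitive on \<open>U\<close>.\<close>

theorem extension_pigeonhole:
  assumes T: "adm T" and r: "(r::nat) > 0"
  shows "\<exists>V. ltree V \<and> below T b = below V b \<and>
    (\<forall>\<chi> \<in> lhom S V \<rightarrow> {..<r}. \<exists>g \<in> lhom T V. fixes_below T b g \<and>
        (\<forall>f \<in> E T. \<forall>f' \<in> E T. \<chi> (lcomp V S g f) = \<chi> (lcomp V S g f')))"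
proof -
  note T' = admD(1)[OF T]
  obtain U where U: "ltree U" "below T b = below U b"
    and hom: "\<And>\<chi> :: lmor \<Rightarrow> nat. \<chi> \<in> lhom S U \<rightarrow> {..<r} \<Longrightarrow> (\<forall>y \<in> U. b < y \<longrightarrow> offins \<chi> U y) \<Longrightarrow>
      (\<exists>g \<in> lhom T U. fixes_below T b g \<and>
        (\<forall>f \<in> E T. \<forall>f' \<in> E T. \<chi> (lcomp U S g f) = \<chi> (lcomp U S g f')))"
    using branch_homogeneous[OF T r] by (elim exE conjE) (rule that, blast+)
  have aU: "adm U" using adm_cong[OF T U] .
  obtain V where V: "ltree V" "below U b = below V b"
    and ins: "\<And>\<chi> :: lmor \<Rightarrow> nat. \<chi> \<in> lhom S V \<rightarrow> {..<r} \<Longrightarrow> \<exists>g \<in> lhom U V. fixes_below U b g \<and>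
        (\<forall>y \<in> {y \<in> U. b < y}. offins (\<lambda>f. \<chi> (lcomp V S g f)) U y)"
    using insensitizable_all[OF aU r] unfolding insensitizable_def by (elim exE conjE) (rule that, blast+)
  show ?thesis
  proof (intro exI[of _ V] conjI ballI)
    show "ltree V" "below T b = below V b" using U V by auto
    fix \<chi> assume chi: "\<chi> \<in> lhom S V \<rightarrow> {..<r}"
    obtain g1 where g1: "g1 \<in> lhom U V" "fixes_below U b g1"
      "\<forall>y \<in> {y \<in> U. b < y}. offins (\<lambda>f. \<chi> (lcomp V S g1 f)) U y"
      using ins[OF chi] by blast
    have "(\<lambda>f. \<chi> (lcomp V S g1 f)) \<in> lhom S U \<rightarrow> {..<r}" by (rule lcomp_pi[OF S U(1) g1(1) chi])
    from hom[OF this] g1(3) obtain g2 where g2: "g2 \<in> lhom T U" "fixes_below T b g2"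
      "\<forall>f \<in> E T. \<forall>f' \<in> E T. \<chi> (lcomp V S g1 (lcomp U S g2 f)) = \<chi> (lcomp V S g1 (lcomp U S g2 f'))"
      by blast
    let ?g = "lcomp V T g1 g2"
    have as: "lcomp V S ?g f = lcomp V S g1 (lcomp U S g2 f)" if "f \<in> E T" for f
      using lcomp_assoc[OF S T' U(1) _ g2(1) g1(1), of f] that by (simp add: ext_def)
    have "\<chi> (lcomp V S ?g f) = \<chi> (lcomp V S ?g f')" if "f \<in> E T" "f' \<in> E T" for f f'
      unfolding as[OF that(1)] as[OF that(2)] using g2(3) that by blast
    then show "\<exists>g \<in> lhom T V. fixes_below T b g \<and> (\<forall>f \<in> E T. \<forall>f' \<in> E T. \<chi> (lcomp V S g f) = \<chi> (lcomp V S g f'))"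
      using lcomp_in_lhom[OF T' U(1) g2(1) g1(1)]
        fixes_below_lcomp[OF T' U(1) g2(1) g1(1) g2(2) g1(2) U(2)] by blast
  qed
qed

end

section \<open>The dual Ramsey theorem\<close>

text \<open>The surjection \<open>h\<close> with the smallest end is split off. The others are
  handled inside by a morphism fixing everything up to the end of \<open>h\<close>, so extensions of
  \<open>h\<close> are sent to extensions of \<open>h\<close> in \<open>U\<close>, where the outer
  morphism makes them homogeneous. Pulling the colouring back along the outer morphism beforehand
  takes care of the others.\<close>

lemma extensions_homogeneous:
  assumes S: "ltree S" "S \<noteq> {[]}" and r: "(r::nat) > 0"
  shows "finite H \<Longrightarrow> ltree T \<Longrightarrow> H \<subseteq> lhom (pred_tree S) T \<Longrightarrow>
    (\<forall>h \<in> H. b \<le> snd h (Max (pred_tree S))) \<Longrightarrow>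
    \<exists>V. ltree V \<and> below T b = below V b \<and>
    (\<forall>\<chi> \<in> lhom S V \<rightarrow> {..<r}. \<exists>g \<in> lhom T V. fixes_below T b g \<and>
      (\<forall>h \<in> H. \<forall>f \<in> ext S T h. \<forall>f' \<in> ext S T h. \<chi> (lcomp V S g f) = \<chi> (lcomp V S g f')))"
proof (induction "card H" arbitrary: H T b)
  case 0
  have "lid T \<in> lhom T T" "fixes_below T b (lid T)"
    using lid_in_lhom[OF 0(3)] by (auto simp: fixes_below_def lid_def)
  then show ?case using 0 by auto
next
  case (Suc m)
  let ?S' = "pred_tree S"
  define e where "e h = snd h (Max ?S')" for h :: lmor
  have "H \<noteq> {}" using Suc.hyps(2) by auto
  then have "Min (e ` H) \<in> e ` H" using Suc.prems(1) by (intro Min_in) auto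
  then obtain h where h: "h \<in> H" "e h = Min (e ` H)" by auto
  have min: "e h \<le> e h'" if "h' \<in> H" for h'
    using Min_le[of "e ` H" "e h'"] that Suc.prems(1) h(2) by simp
  have bh: "b \<le> e h" using Suc.prems(4) h(1) by (simp add: e_def)
  let ?H = "H - {h}"
  have c: "m = card ?H" "finite ?H" "?H \<subseteq> lhom ?S' T"
    using Suc h by auto
  have mn: "\<forall>h' \<in> ?H. e h \<le> snd h' (Max ?S')"
    using min by (simp add: e_def)
  obtain U where U: "ltree U" "below T (e h) = below U (e h)"
    and homU: "\<And>\<chi> :: lmor \<Rightarrow> nat. \<chi> \<in> lhom S U \<rightarrow> {..<r} \<Longrightarrow> \<exists>g \<in> lhom T U. fixes_below T (e h) g \<and>
      (\<forall>h \<in> ?H. \<forall>f \<in> ext S T h. \<forall>f' \<in> ext S T h. \<chi> (lcomp U S g f) = \<chi> (lcomp U S g f'))"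
    using Suc.hyps(1)[OF c(1,2) Suc.prems(2) c(3) mn] by (elim exE conjE) (rule that, blast+)
  interpret extensions S "fst h" "snd h" by unfold_locales (use S in auto)
  have b': "local.b = e h" by (simp add: b_def e_def)
  have aT: "adm T" using Suc.prems(2,3) h by (auto simp: adm_def)
  have aU: "adm U" using adm_cong[OF aT U(1)] U(2) b' by simp
  obtain V where V: "ltree V" "below U (e h) = below V (e h)"
    and homV: "\<And>\<chi> :: lmor \<Rightarrow> nat. \<chi> \<in> lhom S V \<rightarrow> {..<r} \<Longrightarrow> \<exists>g \<in> lhom U V. fixes_below U (e h) g \<and>
        (\<forall>f \<in> ext S U h. \<forall>f' \<in> ext S U h. \<chi> (lcomp V S g f) = \<chi> (lcomp V S g f'))"
    using extension_pigeonhole[OF aU r] unfolding b' prod.collapse by (elim exE conjE) (rule that, blast+)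
  have le_b: "below X b = {y \<in> below X (e h). y \<le> b}" for X
    using bh by auto
  show ?case
  proof (intro exI[of _ V] conjI ballI)
    show "ltree V" by fact
    show "below T b = below V b" using U(2) V(2) le_b by metis
    fix \<chi> assume chi: "\<chi> \<in> lhom S V \<rightarrow> {..<r}"
    obtain g1 where g1: "g1 \<in> lhom U V" "fixes_below U (e h) g1"
      and g1h: "\<And>f f'. f \<in> ext S U h \<Longrightarrow> f' \<in> ext S U h \<Longrightarrow> \<chi> (lcomp V S g1 f) = \<chi> (lcomp V S g1 f')"
      using homV[OF chi] by blast
    have "(\<lambda>f. \<chi> (lcomp V S g1 f)) \<in> lhom S U \<rightarrow> {..<r}" by (rule lcomp_pi[OF S(1) U(1) g1(1) chi])
    from homU[OF this] obtain g2 where g2: "g2 \<in> lhom T U" "fixes_below T (e h) g2"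
      and g2h: "\<And>h' f f'. h' \<in> ?H \<Longrightarrow> f \<in> ext S T h' \<Longrightarrow> f' \<in> ext S T h' \<Longrightarrow>
        \<chi> (lcomp V S g1 (lcomp U S g2 f)) = \<chi> (lcomp V S g1 (lcomp U S g2 f'))"
      by blast
    let ?g = "lcomp V T g1 g2"
    have as: "lcomp V S ?g f = lcomp V S g1 (lcomp U S g2 f)" if "f \<in> ext S T h'" for f h'
      using lcomp_assoc[OF S(1) Suc.prems(2) U(1) _ g2(1) g1(1)] that by (simp add: ext_def)
    have "\<chi> (lcomp V S ?g f) = \<chi> (lcomp V S ?g f')" if "h' \<in> H" "f \<in> ext S T h'" "f' \<in> ext S T h'" for h' f f'
    proof (cases "h' = h")
      case True
      then have "lcomp U S g2 f \<in> ext S U h" "lcomp U S g2 f' \<in> ext S U h"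
        using ext_lcomp[OF aT g2(1), unfolded b', OF g2(2) U(2)] that by simp_all
      then show ?thesis unfolding as[OF that(2)] as[OF that(3)] by (rule g1h)
    next
      case False
      then show ?thesis unfolding as[OF that(2)] as[OF that(3)] using g2h[OF _ that(2,3)] that(1) by blast
    qed
    moreover have "fixes_below T (e h) ?g"
      by (rule fixes_below_lcomp[OF Suc.prems(2) U(1) g2(1) g1(1) g2(2) g1(2) U(2)])
    then have "fixes_below T b ?g" using bh unfolding fixes_below_def by (meson below_iff order.trans)
    ultimately show "\<exists>g \<in> lhom T V. fixes_below T b g \<and>
      (\<forall>h \<in> H. \<forall>f \<in> ext S T h. \<forall>f' \<in> ext S T h. \<chi> (lcomp V S g f) = \<chi> (lcomp V S g f'))"
      using lcomp_in_lhom[OF Suc.prems(2) U(1) g2(1) g1(1)] by blast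
  qed
qed

lemma lhom_root_unique:
  assumes "ltree T" "f \<in> lhom {[]} T" "f' \<in> lhom {[]} T"
  shows "f = f'"
proof -
  have "g = ((\<lambda>y \<in> {[]}. []), (\<lambda>y \<in> {[]}. []))" if g: "g \<in> lhom {[]} T" for g
  proof -
    obtain s i where si: "g = (s, i)" by (metis surj_pair)
    note D = lhomD[OF g[unfolded si]]
    have i: "i = (\<lambda>y \<in> {[]}. [])" using D(2) lembD(1)[OF D(3)] by (auto simp: fun_eq_iff extensional_def)
    have "below T [] = {[]}" using ltreeD(2)[OF assms(1)] by auto
    then have "s = (\<lambda>y \<in> {[]}. [])"
      using D(4) D(5)[of "[]"] i by (auto simp: fun_eq_iff extensional_def)
    then show ?thesis using i si by simp
  qed
  then show ?thesis using assms by metis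
qed

text \<open>When all extensions of each \<open>h\<close> have one colour, the colouring of morphisms
  from \<open>S\<close> descends to a colouring of their restrictions to the smaller tree, to which
  the induction hypothesis applies.\<close>

theorem dual_Ramsey_ltree:
  assumes "ltree S" "ltree T" "(r::nat) > 0"
  shows "\<exists>V. ltree V \<and> (\<forall>\<chi> \<in> lhom S V \<rightarrow> {..<r}. \<exists>g \<in> lhom T V.
    \<forall>f \<in> lhom S T. \<forall>f' \<in> lhom S T. \<chi> (lcomp V S g f) = \<chi> (lcomp V S g f'))"
  using assms
proof (induction "card S" arbitrary: S rule: less_induct)
  case less
  note S = less.prems(1) and T = less.prems(2) and r = less.prems(3)
  show ?case
  proof (cases "S = {[]}")
    case True
    have un: "f = f'" if "f \<in> lhom S T" "f' \<in> lhom S T" for f f'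
      using lhom_root_unique[OF T] True that by simp
    show ?thesis
    proof (intro exI[of _ T] conjI ballI bexI[of _ "lid T"])
      fix \<chi> :: "lmor \<Rightarrow> nat" and f f' assume "f \<in> lhom S T" "f' \<in> lhom S T"
      then show "\<chi> (lcomp T S (lid T) f) = \<chi> (lcomp T S (lid T) f')" using un[of f f'] by simp
    qed (use T lid_in_lhom[OF T] in auto)
  next
    case False
    let ?S' = "pred_tree S"
    note S' = pred_tree[OF S False]
    have "card ?S' < card S"
      using ltreeD(1)[OF S] ltree_Max(1)[OF S] by (intro psubset_card_mono) auto
    from less.hyps[OF this S'(1) T r] obtain U where U: "ltree U"
      and homU: "\<And>\<chi> :: lmor \<Rightarrow> nat. \<chi> \<in> lhom ?S' U \<rightarrow> {..<r} \<Longrightarrow> \<exists>g \<in> lhom T U.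
        \<forall>f \<in> lhom ?S' T. \<forall>f' \<in> lhom ?S' T. \<chi> (lcomp U ?S' g f) = \<chi> (lcomp U ?S' g f')"
      by (elim exE conjE) (rule that, blast+)
    \<comment> \<open>The empty list is the least vertex, so with it as \<open>b\<close> the
      condition on ends holds for every \<open>h\<close>.\<close>
    have Nil: "\<forall>h \<in> lhom ?S' U. [] \<le> snd h (Max ?S')" by simp
    obtain V where V: "ltree V"
      and homV: "\<forall>\<chi> \<in> lhom S V \<rightarrow> {..<r}. \<exists>g \<in> lhom U V. fixes_below U [] g \<and>
        (\<forall>h \<in> lhom ?S' U. \<forall>f \<in> ext S U h. \<forall>f' \<in> ext S U h. \<chi> (lcomp V S g f) = \<chi> (lcomp V S g f'))"
      using extensions_homogeneous[OF S False r finite_lhom[OF S'(1) U] U order.refl Nil]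
      by (elim exE conjE) (rule that)
    show ?thesis
    proof (intro exI[of _ V] conjI ballI)
      show "ltree V" by fact
      fix \<chi> assume chi: "\<chi> \<in> lhom S V \<rightarrow> {..<r}"
      obtain g1 where g1: "g1 \<in> lhom U V"
        and hom1: "\<And>h f f'. h \<in> lhom ?S' U \<Longrightarrow> f \<in> ext S U h \<Longrightarrow> f' \<in> ext S U h \<Longrightarrow>
          \<chi> (lcomp V S g1 f) = \<chi> (lcomp V S g1 f')"
        using bspec[OF homV chi] by blast
      \<comment> \<open>A rigid surjection without extensions gets the default colour 0.\<close>
      define c where "c h = (if ext S U h = {} then 0 else \<chi> (lcomp V S g1 (SOME f. f \<in> ext S U h)))" for h
      have c: "c h = \<chi> (lcomp V S g1 f)" if "h \<in> lhom ?S' U" "f \<in> ext S U h" for h f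
      proof -
        have "(SOME f. f \<in> ext S U h) \<in> ext S U h" using that(2) by (rule someI)
        from hom1[OF that(1) this that(2)] that(2) show ?thesis by (simp only: c_def) auto
      qed
      have "c \<in> lhom ?S' U \<rightarrow> {..<r}"
      proof
        fix h assume h: "h \<in> lhom ?S' U"
        show "c h \<in> {..<r}"
        proof (cases "ext S U h = {}")
          case False
          then obtain f where f: "f \<in> ext S U h" by blast
          then have "f \<in> lhom S U" by (simp add: ext_def)
          then show ?thesis using c[OF h f] funcset_mem[OF lcomp_pi[OF S U g1 chi]] by simp
        qed (simp add: c_def r)
      qed
      from homU[OF this] obtain g2 where g2: "g2 \<in> lhom T U"
        and hom2: "\<And>f f'. f \<in> lhom ?S' T \<Longrightarrow> f' \<in> lhom ?S' T \<Longrightarrow> c (lcomp U ?S' g2 f) = c (lcomp U ?S' g2 f')"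
        by blast
      have key: "\<chi> (lcomp V S (lcomp V T g1 g2) f) = c (lcomp U ?S' g2 (lrestr T ?S' f)) \<and> lrestr T ?S' f \<in> lhom ?S' T"
        if f: "f \<in> lhom S T" for f
      proof -
        have r1: "lrestr T ?S' f \<in> lhom ?S' T" by (rule lrestr_in_lhom[OF S S'(1) _ S'(2) f]) auto
        have f1: "lcomp U S g2 f \<in> lhom S U" by (rule lcomp_in_lhom[OF S T f g2])
        have "lrestr U ?S' (lcomp U S g2 f) = lcomp U ?S' g2 (lrestr T ?S' f)"
          by (rule lrestr_lcomp[OF S S'(1) _ T f g2]) auto
        then have "lcomp U S g2 f \<in> ext S U (lcomp U ?S' g2 (lrestr T ?S' f))" using f1 by (simp add: ext_def)
        then show ?thesis
          using c[OF lcomp_in_lhom[OF S'(1) T r1 g2]] lcomp_assoc[OF S T U f g2 g1] r1 by simp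
      qed
      show "\<exists>g \<in> lhom T V. \<forall>f \<in> lhom S T. \<forall>f' \<in> lhom S T. \<chi> (lcomp V S g f) = \<chi> (lcomp V S g f')"
      proof (intro bexI[of _ "lcomp V T g1 g2"] ballI)
        show "lcomp V T g1 g2 \<in> lhom T V" by (rule lcomp_in_lhom[OF T U g2 g1])
        fix f f' assume "f \<in> lhom S T" "f' \<in> lhom S T"
        then show "\<chi> (lcomp V S (lcomp V T g1 g2) f) = \<chi> (lcomp V S (lcomp V T g1 g2) f')"
          using key[of f] key[of f'] hom2 by simp
      qed
    qed
  qed
qed

text \<open>Homogeneity for \<open>i\<close> on all morphisms into \<open>U\<close> is inherited by
  those that factor through \<open>g2\<close>, so treating the remaining indices inside does not
  destroy it.\<close>

corollary dual_Ramsey_ltree_family: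
  assumes "finite I" "\<forall>i \<in> I. ltree (P i)" "ltree T" "(r::nat) > 0"
  shows "\<exists>V. ltree V \<and> (\<forall>\<chi>. (\<forall>i \<in> I. \<chi> i \<in> lhom (P i) V \<rightarrow> {..<r}) \<longrightarrow> (\<exists>g \<in> lhom T V.
    \<forall>i \<in> I. \<forall>f \<in> lhom (P i) T. \<forall>f' \<in> lhom (P i) T. \<chi> i (lcomp V (P i) g f) = \<chi> i (lcomp V (P i) g f')))"
  using assms(1,2)
proof (induction I rule: finite_induct)
  case empty
  show ?case
    using assms(3) lid_in_lhom[OF assms(3)] by (intro exI[of _ T] conjI allI impI bexI[of _ "lid T"]) simp_all
next
  case (insert i I)
  have Pi: "ltree (P i)" and PI: "\<forall>k \<in> I. ltree (P k)" using insert.prems by auto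
  obtain U where U: "ltree U"
    and homU: "\<And>\<chi> :: _ \<Rightarrow> lmor \<Rightarrow> nat. (\<forall>i \<in> I. \<chi> i \<in> lhom (P i) U \<rightarrow> {..<r}) \<Longrightarrow> (\<exists>g \<in> lhom T U.
      \<forall>i \<in> I. \<forall>f \<in> lhom (P i) T. \<forall>f' \<in> lhom (P i) T. \<chi> i (lcomp U (P i) g f) = \<chi> i (lcomp U (P i) g f'))"
    using insert.IH[OF PI] by (elim exE conjE) (rule that, blast+)
  obtain V where V: "ltree V" and homV: "\<And>\<chi> :: lmor \<Rightarrow> nat. \<chi> \<in> lhom (P i) V \<rightarrow> {..<r} \<Longrightarrow> \<exists>g \<in> lhom U V.
    \<forall>f \<in> lhom (P i) U. \<forall>f' \<in> lhom (P i) U. \<chi> (lcomp V (P i) g f) = \<chi> (lcomp V (P i) g f')"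
    using dual_Ramsey_ltree[OF Pi U assms(4)] by (elim exE conjE) (rule that, blast+)
  show ?case
  proof (intro exI[of _ V] conjI allI impI)
    show "ltree V" by fact
    fix \<chi> assume chi: "\<forall>k \<in> insert i I. \<chi> k \<in> lhom (P k) V \<rightarrow> {..<r}"
    obtain g1 where g1: "g1 \<in> lhom U V"
      and hom1: "\<And>f f'. f \<in> lhom (P i) U \<Longrightarrow> f' \<in> lhom (P i) U \<Longrightarrow> \<chi> i (lcomp V (P i) g1 f) = \<chi> i (lcomp V (P i) g1 f')"
      using homV[of "\<chi> i"] chi by blast
    have "\<forall>k \<in> I. (\<lambda>f. \<chi> k (lcomp V (P k) g1 f)) \<in> lhom (P k) U \<rightarrow> {..<r}"
      using lcomp_pi[OF bspec[OF PI] U g1] chi by blast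
    from homU[OF this] obtain g2 where g2: "g2 \<in> lhom T U"
      and hom2: "\<And>k f f'. k \<in> I \<Longrightarrow> f \<in> lhom (P k) T \<Longrightarrow> f' \<in> lhom (P k) T \<Longrightarrow>
        \<chi> k (lcomp V (P k) g1 (lcomp U (P k) g2 f)) = \<chi> k (lcomp V (P k) g1 (lcomp U (P k) g2 f'))"
      by blast
    let ?g = "lcomp V T g1 g2"
    have as: "lcomp V (P k) ?g f = lcomp V (P k) g1 (lcomp U (P k) g2 f)" if "k \<in> insert i I" "f \<in> lhom (P k) T" for k f
      using lcomp_assoc[OF bspec[OF insert.prems that(1)] assms(3) U that(2) g2 g1] by simp
    have "\<chi> k (lcomp V (P k) ?g f) = \<chi> k (lcomp V (P k) ?g f')"
      if k: "k \<in> insert i I" and f: "f \<in> lhom (P k) T" "f' \<in> lhom (P k) T" for k f f'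
    proof (cases "k = i")
      case True
      have "lcomp U (P k) g2 f \<in> lhom (P k) U" "lcomp U (P k) g2 f' \<in> lhom (P k) U"
        using lcomp_in_lhom[OF bspec[OF insert.prems k] assms(3) _ g2] f by blast+
      then show ?thesis unfolding as[OF k f(1)] as[OF k f(2)] using hom1 True by blast
    next
      case False
      then show ?thesis unfolding as[OF k f(1)] as[OF k f(2)] using hom2[OF _ f] k by blast
    qed
    then show "\<exists>g \<in> lhom T V. \<forall>i \<in> insert i I. \<forall>f \<in> lhom (P i) T. \<forall>f' \<in> lhom (P i) T.
        \<chi> i (lcomp V (P i) g f) = \<chi> i (lcomp V (P i) g f')"
      using lcomp_in_lhom[OF assms(3) U g2 g1] by blast
  qed
qed

section \<open>Ordered trees as trees of lists\<close>

text \<open>\<open>e\<close> translates the vertices of \<open>T\<close> into lists, and \<open>d\<close> translates back.\<close>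

locale coded =
  fixes T :: "'a otree" and e :: "'a \<Rightarrow> nat list" and d :: "nat list \<Rightarrow> 'a" and C :: "nat list set"
  assumes ltree: "ltree C"
    and e_in: "x \<in> verts T \<Longrightarrow> e x \<in> C" and d_e: "x \<in> verts T \<Longrightarrow> d (e x) = x"
    and d_in: "c \<in> C \<Longrightarrow> d c \<in> verts T" and e_d: "c \<in> C \<Longrightarrow> e (d c) = c"
    and ord_iff: "(x, y) \<in> ord T \<longleftrightarrow> x \<in> verts T \<and> y \<in> verts T \<and> prefix (e x) (e y)"
    and sib_iff: "y \<in> isucc T x \<Longrightarrow> z \<in> isucc T x \<Longrightarrow> (y, z) \<in> sib T x \<longleftrightarrow> e y \<le> e z"
begin

lemma e_eq_iff: "x \<in> verts T \<Longrightarrow> y \<in> verts T \<Longrightarrow> e x = e y \<longleftrightarrow> x = y"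
  by (metis d_e)

lemma isucc_iff:
  assumes x: "x \<in> verts T"
  shows "y \<in> isucc T x \<longleftrightarrow> y \<in> verts T \<and> (\<exists>c. e y = e x @ [c])"
proof
  assume y: "y \<in> isucc T x"
  then have y': "y \<in> verts T" "prefix (e x) (e y)" "x \<noteq> y" by (auto simp: isucc_def ord_iff)
  then have "strict_prefix (e x) (e y)" using e_eq_iff x by (auto simp: strict_prefix_def)
  then obtain c q where q: "e y = e x @ c # q" by (auto elim!: strict_prefixE')
  let ?z = "d (e x @ [c])"
  have C: "e x @ [c] \<in> C" by (rule ltreeD(3)[OF ltree e_in[OF y'(1)]]) (simp add: q)
  have "?z = x \<or> ?z = y"
    using y d_in[OF C] x y'(1) unfolding isucc_def by (auto simp: ord_iff e_d[OF C] q)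
  then have "e x @ [c] = e x \<or> e x @ [c] = e y" using e_d[OF C] by metis
  then have "e y = e x @ [c]" by simp
  then show "y \<in> verts T \<and> (\<exists>c. e y = e x @ [c])" using y'(1) by blast
next
  assume "y \<in> verts T \<and> (\<exists>c. e y = e x @ [c])"
  then obtain c where y: "y \<in> verts T" "e y = e x @ [c]" by blast
  have "z = x \<or> z = y" if "z \<in> verts T" "prefix (e x) (e z)" "prefix (e z) (e y)" for z
  proof -
    have "e z = e x \<or> e z = e y"
      using that y(2) by (auto simp: prefix_snoc prefix_order.antisym)
    then show ?thesis using e_eq_iff that x y by blast
  qed
  then show "y \<in> isucc T x" using x y by (auto simp: isucc_def ord_iff)
qed

text \<open>For the associated embedding of a rigid surjection: its value at \<open>x\<close>
  belongs to the fibre over \<open>x\<close>, so the meet of the fibre is a least element.\<close>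

lemma Meet_member:
  assumes "m \<in> verts T" "m \<in> X" "\<forall>x \<in> X. x \<in> verts T \<and> prefix (e m) (e x)"
  shows "Meet T X = m"
  unfolding Meet_def
proof (rule the_equality)
  show "m \<in> verts T \<and> (\<forall>x \<in> X. (m, x) \<in> ord T) \<and>
    (\<forall>w \<in> verts T. (\<forall>x \<in> X. (w, x) \<in> ord T) \<longrightarrow> (w, m) \<in> ord T)"
    using assms by (auto simp: ord_iff)
  fix u assume "u \<in> verts T \<and> (\<forall>x \<in> X. (u, x) \<in> ord T) \<and>
    (\<forall>w \<in> verts T. (\<forall>x \<in> X. (w, x) \<in> ord T) \<longrightarrow> (w, u) \<in> ord T)"
  then have "u \<in> verts T" "prefix (e u) (e m)" "prefix (e m) (e u)" using assms by (auto simp: ord_iff)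
  then show "u = m" using assms(1) e_eq_iff prefix_order.antisym by blast
qed

lemma meet_eq:
  assumes "v \<in> verts T" "w \<in> verts T"
  shows "meet T v w = d (lcp (e v) (e w))" "meet T v w \<in> verts T" "e (meet T v w) = lcp (e v) (e w)"
proof -
  have C: "lcp (e v) (e w) \<in> C" using ltree_lcp[OF ltree e_in[OF assms(1)]] .
  let ?m = "d (lcp (e v) (e w))"
  have m: "?m \<in> verts T" "e ?m = lcp (e v) (e w)" using d_in[OF C] e_d[OF C] by auto
  show "meet T v w = ?m"
    unfolding Meet_def
  proof (rule the_equality)
    show "?m \<in> verts T \<and> (\<forall>x \<in> {v, w}. (?m, x) \<in> ord T) \<and>
      (\<forall>u \<in> verts T. (\<forall>x \<in> {v, w}. (u, x) \<in> ord T) \<longrightarrow> (u, ?m) \<in> ord T)"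
      using m assms longest_common_prefix_max_prefix by (auto simp: ord_iff)
    fix u assume u: "u \<in> verts T \<and> (\<forall>x \<in> {v, w}. (u, x) \<in> ord T) \<and>
      (\<forall>x \<in> verts T. (\<forall>y \<in> {v, w}. (x, y) \<in> ord T) \<longrightarrow> (x, u) \<in> ord T)"
    then have "(?m, u) \<in> ord T" using m assms by (auto simp: ord_iff)
    then have "prefix (e ?m) (e u)" "prefix (e u) (e ?m)"
      using u m(2) longest_common_prefix_max_prefix by (auto simp: ord_iff)
    then show "u = ?m" using u m(1) e_eq_iff prefix_order.antisym by blast
  qed
  then show "meet T v w \<in> verts T" "e (meet T v w) = lcp (e v) (e w)" using m by auto
qed

lemma root_eq: "root T = d []" "root T \<in> verts T" "e (root T) = []"
proof -
  have C: "[] \<in> C" using ltreeD(2)[OF ltree] .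
  show "root T = d []"
    unfolding root_def
  proof (rule the_equality)
    show "d [] \<in> verts T \<and> (\<forall>x \<in> verts T. (d [], x) \<in> ord T)"
      using d_in[OF C] e_d[OF C] by (auto simp: ord_iff)
    fix r assume "r \<in> verts T \<and> (\<forall>x \<in> verts T. (r, x) \<in> ord T)"
    then show "r = d []" using d_in[OF C] e_d[OF C] by (auto simp: ord_iff) (metis d_e prefix_Nil)
  qed
  then show "root T \<in> verts T" "e (root T) = []" using d_in[OF C] e_d[OF C] by auto
qed

lemma diverge_tle:
  assumes v: "v \<in> verts T" "e v = p @ a # q" and w: "w \<in> verts T" "e w = p @ c # q'" and ac: "a \<noteq> c"
  shows "tle T v w \<longleftrightarrow> a < c"
proof -
  have m: "e (meet T v w) = p" "meet T v w \<in> verts T"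
    using meet_eq[OF v(1) w(1)] v w ac by auto
  have C: "p @ [a] \<in> C" "p @ [c] \<in> C"
    using ltreeD(3)[OF ltree e_in[OF v(1)]] ltreeD(3)[OF ltree e_in[OF w(1)]] v w by auto
  let ?A = "d (p @ [a])" and ?B = "d (p @ [c])"
  have A: "?A \<in> isucc T (meet T v w)" "?B \<in> isucc T (meet T v w)" "e ?A = p @ [a]" "e ?B = p @ [c]"
    using isucc_iff[OF m(2)] m(1) d_in C e_d by auto
  have uniq: "x = d (p @ [b])" if "x \<in> isucc T (meet T v w)" "(x, u) \<in> ord T" "e u = p @ b # r" for x u b r
    using that isucc_iff[OF m(2), of x] m(1) d_e[of x] by (auto simp: ord_iff)
  have "tle T v w \<longleftrightarrow> (?A, ?B) \<in> sib T (meet T v w)"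
  proof
    assume "tle T v w"
    then have "(v, w) \<in> ord T \<or> (\<exists>x \<in> isucc T (meet T v w). \<exists>y \<in> isucc T (meet T v w).
         (x, v) \<in> ord T \<and> (y, w) \<in> ord T \<and> x \<noteq> y \<and> (x, y) \<in> sib T (meet T v w))"
      unfolding tle_def by blast
    then show "(?A, ?B) \<in> sib T (meet T v w)"
    proof
      assume "(v, w) \<in> ord T"
      then show ?thesis using v w ac by (simp add: ord_iff)
    qed (use uniq v(2) w(2) in blast)
  next
    assume s: "(?A, ?B) \<in> sib T (meet T v w)"
    have "(w, v) \<notin> ord T" using v w ac by (simp add: ord_iff)
    moreover have "(?A, v) \<in> ord T" "(?B, w) \<in> ord T" using A v w d_in C by (simp_all add: ord_iff)
    moreover have "?A \<noteq> ?B" using A ac by (metis append1_eq_conv)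
    ultimately show "tle T v w" unfolding tle_def using A(1,2) s v(1) w(1) by blast
  qed
  also have "\<dots> \<longleftrightarrow> p @ [a] \<le> p @ [c]" using sib_iff[OF A(1,2)] A(3,4) by simp
  finally show ?thesis using ac by auto
qed

lemma tle_iff: "tle T v w \<longleftrightarrow> v \<in> verts T \<and> w \<in> verts T \<and> e v \<le> e w"
proof (cases "v \<in> verts T \<and> w \<in> verts T")
  case True
  then have v: "v \<in> verts T" and w: "w \<in> verts T" by auto
  consider "prefix (e v) (e w)" | "strict_prefix (e w) (e v)"
    | p a b q q' where "e v = p @ a # q" "e w = p @ b # q'" "a \<noteq> b"
    by (metis less_cases linorder_less_linear nat_neq_iff prefix_order.eq_iff strict_prefix_def)
  then show ?thesis
  proof cases
    case 1
    then show ?thesis using v w prefix_imp_le by (auto simp: tle_def ord_iff)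
  next
    case 2
    then have "\<not> tle T v w" using v w by (auto simp: tle_def ord_iff strict_prefix_def dest: prefix_order.antisym)
    then show ?thesis using strict_prefix_imp_less[OF 2] by auto
  next
    case 3
    then show ?thesis using diverge_tle[OF v 3(1) w 3(2,3)] v w by auto
  qed
qed (auto simp: tle_def)

lemma tless_iff: "tless T v w \<longleftrightarrow> v \<in> verts T \<and> w \<in> verts T \<and> e v < e w"
  unfolding tless_def tle_iff using e_eq_iff by (auto simp: order_less_le)

lemma verts_init: "v \<in> verts T \<Longrightarrow> verts (init_subtree T v) = {y \<in> verts T. e y \<le> e v}"
  by (auto simp: init_subtree_def Let_def tle_iff)

lemma coded_init:
  assumes v: "v \<in> verts T"
  shows "coded (init_subtree T v) e d (below C (e v))"
proof
  let ?X = "{y \<in> verts T. tle T y v}"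
  note vI = verts_init[OF v]
  have X: "?X = verts (init_subtree T v)" by (simp add: init_subtree_def Let_def)
  have ordI: "(x, y) \<in> ord (init_subtree T v) \<longleftrightarrow> (x, y) \<in> ord T \<and> x \<in> ?X \<and> y \<in> ?X" for x y
    by (auto simp: init_subtree_def Let_def)
  show "ltree (below C (e v))" using ltree_below[OF ltree] .
  show "x \<in> verts (init_subtree T v) \<Longrightarrow> e x \<in> below C (e v)" for x using vI e_in by auto
  show "x \<in> verts (init_subtree T v) \<Longrightarrow> d (e x) = x" for x using vI d_e by auto
  show "c \<in> below C (e v) \<Longrightarrow> d c \<in> verts (init_subtree T v)" for c using vI d_in e_d by auto
  show "c \<in> below C (e v) \<Longrightarrow> e (d c) = c" for c using e_d by auto
  show "((x, y) \<in> ord (init_subtree T v)) =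
    (x \<in> verts (init_subtree T v) \<and> y \<in> verts (init_subtree T v) \<and> prefix (e x) (e y))" for x y
    unfolding ordI X ord_iff using vI by auto
  \<comment> \<open>A vertex of \<open>T\<close> between \<open>x\<close> and \<open>y\<close>
    precedes \<open>y\<close> in the linear order and so lies in the initial subtree; passing to the
    subtree creates no new immediate successors.\<close>
  have sub: "y \<in> isucc T x" if "y \<in> isucc (init_subtree T v) x" for x y
  proof -
    have y: "y \<in> ?X" "(x, y) \<in> ord T" "x \<noteq> y" "x \<in> ?X"
      using that unfolding isucc_def ordI X[symmetric] by auto
    have "z = x \<or> z = y" if z: "z \<in> verts T" "(x, z) \<in> ord T" "(z, y) \<in> ord T" for z
    proof -
      have "e z \<le> e y" using z(3) prefix_imp_le by (auto simp: ord_iff)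
      then have "z \<in> ?X" using z(1) y(1) v by (auto simp: tle_iff)
      then show ?thesis
        using \<open>y \<in> isucc (init_subtree T v) x\<close> z y unfolding isucc_def ordI X[symmetric] by blast
    qed
    then show ?thesis using y unfolding isucc_def by blast
  qed
  fix x y z assume yz: "y \<in> isucc (init_subtree T v) x" "z \<in> isucc (init_subtree T v) x"
  then have "y \<in> ?X" "z \<in> ?X" unfolding isucc_def X[symmetric] by auto
  then have "(y, z) \<in> sib (init_subtree T v) x \<longleftrightarrow> (y, z) \<in> sib T x"
    by (auto simp: init_subtree_def Let_def)
  then show "((y, z) \<in> sib (init_subtree T v) x) = (e y \<le> e z)" using sib_iff[OF sub sub] yz by blast
qed

text \<open>A vertex above the lexicographically largest one would be larger still, so the largest
  vertex is a leaf, and it is the largest leaf.\<close>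

lemma max_leaf_eq: "max_leaf T = d (Max C)" "max_leaf T \<in> verts T" "e (max_leaf T) = Max C"
proof -
  have M: "Max C \<in> C" "\<And>c. c \<in> C \<Longrightarrow> c \<le> Max C" using ltree_Max[OF ltree] by auto
  let ?l = "d (Max C)"
  have l: "?l \<in> verts T" "e ?l = Max C" using M d_in e_d by auto
  have leaf: "?l \<in> leaves T"
    unfolding leaves_def
  proof (intro CollectI conjI ballI impI l)
    fix y assume y: "y \<in> verts T" "(?l, y) \<in> ord T"
    then have "prefix (Max C) (e y)" using l by (simp add: ord_iff)
    then have "Max C \<le> e y" "e y \<le> Max C" using prefix_imp_le M(2) e_in y by auto
    then show "y = ?l" using e_eq_iff[OF y(1) l(1)] l(2) by simp
  qed
  show "max_leaf T = ?l"
    unfolding max_leaf_def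
  proof (rule the_equality)
    show "?l \<in> leaves T \<and> (\<forall>m \<in> leaves T. tle T m ?l)"
      using leaf l M(2) e_in by (auto simp: tle_iff leaves_def)
    fix m assume m: "m \<in> leaves T \<and> (\<forall>m' \<in> leaves T. tle T m' m)"
    then have "Max C \<le> e m" "m \<in> verts T" using leaf l by (auto simp: tle_iff)
    then show "m = ?l" using M(2)[OF e_in, of m] e_eq_iff[of m ?l] l by simp
  qed
  then show "max_leaf T \<in> verts T" "e (max_leaf T) = Max C" using l by auto
qed

text \<open>Consequently a connection on the initial subtree of \<open>v\<close> is strong exactly
  if \<open>i\<close> sends the largest leaf to \<open>v\<close>.\<close>

lemma max_leaf_init: "v \<in> verts T \<Longrightarrow> max_leaf (init_subtree T v) = v"
proof -
  assume v: "v \<in> verts T"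
  have "Max (below C (e v)) = e v"
    using e_in[OF v] ltreeD(1)[OF ltree_below[OF ltree]] by (intro Max_eqI) auto
  then show ?thesis using coded.max_leaf_eq(1)[OF coded_init[OF v]] d_e[OF v] by simp
qed

end

section \<open>Morphisms of \<open>PSC\<close> in terms of lists\<close>

lemma embedding_iff:
  assumes S: "coded S e d C" and T: "coded T f g D"
  shows "embedding S T i \<longleftrightarrow> i \<in> verts S \<rightarrow>\<^sub>E verts T \<and> lemb C (\<lambda>c. f (i (d c)))"
proof (cases "i \<in> verts S \<rightarrow>\<^sub>E verts T")
  case True
  interpret S: coded S e d C by fact
  interpret T: coded T f g D by fact
  have i: "i x \<in> verts T" if "x \<in> verts S" for x using True that by auto
  have id: "i (d c) \<in> verts T" if "c \<in> C" for c using i S.d_in[OF that] .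
  have root: "i (root S) = root T \<longleftrightarrow> f (i (d [])) = []"
    using T.e_eq_iff[OF i[OF S.root_eq(2)] T.root_eq(2)] S.root_eq(1) T.root_eq(3) by simp
  have less: "(\<forall>x \<in> verts S. \<forall>y \<in> verts S. tless S x y \<longrightarrow> tless T (i x) (i y)) \<longleftrightarrow>
      (\<forall>x \<in> C. \<forall>y \<in> C. x < y \<longrightarrow> f (i (d x)) < f (i (d y)))" (is "?L \<longleftrightarrow> ?R")
  proof
    assume L: ?L
    show ?R
    proof (intro ballI impI)
      fix x y assume "x \<in> C" "y \<in> C" "x < y"
      then have "tless S (d x) (d y)" using S.d_in S.e_d by (simp add: S.tless_iff)
      then have "tless T (i (d x)) (i (d y))" using L S.d_in \<open>x \<in> C\<close> \<open>y \<in> C\<close> by blast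
      then show "f (i (d x)) < f (i (d y))" by (simp add: T.tless_iff)
    qed
  next
    assume R: ?R
    show ?L
    proof (intro ballI impI)
      fix x y assume xy: "x \<in> verts S" "y \<in> verts S" "tless S x y"
      then have "f (i (d (e x))) < f (i (d (e y)))" using R S.e_in by (simp add: S.tless_iff)
      then show "tless T (i x) (i y)" using xy i S.d_e by (simp add: T.tless_iff)
    qed
  qed
  have meets: "(\<forall>x \<in> verts S. \<forall>y \<in> verts S. i (meet S x y) = meet T (i x) (i y)) \<longleftrightarrow>
      (\<forall>x \<in> C. \<forall>y \<in> C. f (i (d (lcp x y))) = lcp (f (i (d x))) (f (i (d y))))" (is "?L \<longleftrightarrow> ?R")
  proof -
    have m: "i (meet S x y) = meet T (i x) (i y) \<longleftrightarrow> f (i (d (lcp (e x) (e y)))) = lcp (f (i x)) (f (i y))"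
      if "x \<in> verts S" "y \<in> verts S" for x y
      using T.e_eq_iff[OF i[OF S.meet_eq(2)[OF that]] T.meet_eq(2)[OF i[OF that(1)] i[OF that(2)]]]
        T.meet_eq(3)[OF i[OF that(1)] i[OF that(2)]] S.meet_eq(1)[OF that] by simp
    show ?thesis
    proof
      assume L: ?L
      show ?R
      proof (intro ballI)
        fix x y assume "x \<in> C" "y \<in> C"
        then show "f (i (d (lcp x y))) = lcp (f (i (d x))) (f (i (d y)))"
          using L m[OF S.d_in S.d_in, of x y] S.d_in S.e_d by simp
      qed
    next
      assume R: ?R
      show ?L
      proof (intro ballI)
        fix x y assume xy: "x \<in> verts S" "y \<in> verts S"
        then show "i (meet S x y) = meet T (i x) (i y)"
          using R S.e_in[OF xy(1)] S.e_in[OF xy(2)] m[OF xy] S.d_e by simp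
      qed
    qed
  qed
  show ?thesis
    unfolding embedding_def lemb_def root less meets using True by simp
qed (simp add: embedding_def)

text \<open>Here \<open>k\<close> plays the role of the embedding \<open>i\<^sub>s\<close>.\<close>

definition lconn :: "nat list set \<Rightarrow> nat list set \<Rightarrow> nat list \<Rightarrow> (nat list \<Rightarrow> nat list) \<Rightarrow>
    (nat list \<Rightarrow> nat list) \<Rightarrow> (nat list \<Rightarrow> nat list) \<Rightarrow> bool" where
  "lconn C D v s k i \<longleftrightarrow> lemb C k \<and> lemb C i \<and>
     (\<forall>x \<in> C. k x \<in> below D v \<and> i x \<in> below D v \<and> s (k x) = x \<and> s (i x) = x) \<and>
     (\<forall>y \<in> below D v. s y \<in> C \<and> prefix (k (s y)) y) \<and>
     (\<forall>x \<in> C. \<forall>y \<in> below D v. y < i x \<longrightarrow> s y \<le> x) \<and> i (Max C) = v"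

lemma psc_homD:
  assumes S: "coded S e d C" and T: "coded T f g D" and h: "(v, s, i) \<in> psc_hom S T"
  shows "v \<in> verts T" "s \<in> verts (init_subtree T v) \<rightarrow>\<^sub>E verts S" "i \<in> verts S \<rightarrow>\<^sub>E verts (init_subtree T v)"
    "\<exists>k. lconn C D (f v) (\<lambda>y. e (s (g y))) k (\<lambda>x. f (i (d x))) \<and>
       (\<forall>x \<in> verts S. assoc_emb (init_subtree T v) s x = g (k (e x)))"
proof -
  interpret S: coded S e d C by fact
  interpret T: coded T f g D by fact
  show v: "v \<in> verts T" using h by (simp add: psc_hom_def)
  let ?I = "init_subtree T v"
  interpret I: coded ?I f g "below D (f v)" using T.coded_init[OF v] .
  have con: "connection ?I S s i" and end_i: "i (max_leaf S) = max_leaf ?I"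
    using h by (auto simp: psc_hom_def strong_connection_def)
  then obtain i' where rs: "s \<in> verts ?I \<rightarrow>\<^sub>E verts S" and i': "embedding S ?I i'"
      "\<forall>x \<in> verts S. s (i' x) = x" "\<forall>y \<in> verts ?I. (i' (s y), y) \<in> ord ?I"
      and i: "embedding S ?I i" and si: "\<forall>x \<in> verts S. s (i x) = x"
      and le: "\<forall>x \<in> verts S. \<forall>y \<in> verts ?I. tless ?I y (i x) \<longrightarrow> tle S (s y) x"
    unfolding connection_def rigid_surjection_def by blast
  show "s \<in> verts ?I \<rightarrow>\<^sub>E verts S" by fact
  note E = embedding_iff[OF S I.coded_axioms]
  have i_in: "i x \<in> verts ?I" "i' x \<in> verts ?I" if "x \<in> verts S" for x using i i' E that by auto
  show "i \<in> verts S \<rightarrow>\<^sub>E verts ?I" using i E by blast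
  let ?k = "\<lambda>x. f (i' (d x))"
  have "lconn C D (f v) (\<lambda>y. e (s (g y))) ?k (\<lambda>x. f (i (d x)))"
    unfolding lconn_def
  proof (intro conjI ballI impI)
    show "lemb C ?k" "lemb C (\<lambda>x. f (i (d x)))" using i i' E by blast+
  next
    fix x assume x: "x \<in> C"
    show "?k x \<in> below D (f v)" "f (i (d x)) \<in> below D (f v)"
      using I.e_in i_in S.d_in[OF x] by blast+
    show "e (s (g (?k x))) = x" "e (s (g (f (i (d x))))) = x"
      using i_in[OF S.d_in[OF x]] I.d_e i'(2) si S.d_in[OF x] S.e_d[OF x] by simp_all
  next
    fix y assume y: "y \<in> below D (f v)"
    have gy: "g y \<in> verts ?I" using I.d_in[OF y] .
    then have sg: "s (g y) \<in> verts S" using rs by blast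
    then show "e (s (g y)) \<in> C" by (rule S.e_in)
    have "(i' (s (g y)), g y) \<in> ord ?I" using i'(3) gy by blast
    then show "prefix (?k (e (s (g y)))) y" using S.d_e[OF sg] I.e_d[OF y] by (simp add: I.ord_iff)
  next
    fix x y assume x: "x \<in> C" and y: "y \<in> below D (f v)" "y < f (i (d x))"
    have gy: "g y \<in> verts ?I" using I.d_in[OF y(1)] .
    have "tless ?I (g y) (i (d x))" using gy i_in[OF S.d_in[OF x]] y(2) I.e_d[OF y(1)] by (simp add: I.tless_iff)
    then have "tle S (s (g y)) (d x)" using le gy S.d_in[OF x] by blast
    then show "e (s (g y)) \<le> x" using S.e_d[OF x] by (simp add: S.tle_iff)
  next
    show "f (i (d (Max C))) = f v" using end_i S.max_leaf_eq(1) T.max_leaf_init[OF v] by simp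
  qed
  moreover have "assoc_emb ?I s x = g (?k (e x))" if x: "x \<in> verts S" for x
  proof -
    have "assoc_emb ?I s x = i' x"
      unfolding assoc_emb_def
      using i_in(2)[OF x] i'(2,3) x by (intro I.Meet_member) (auto simp: I.ord_iff)
    then show ?thesis using S.d_e[OF x] I.d_e[OF i_in(2)[OF x]] by simp
  qed
  ultimately show "\<exists>k. lconn C D (f v) (\<lambda>y. e (s (g y))) k (\<lambda>x. f (i (d x))) \<and>
       (\<forall>x \<in> verts S. assoc_emb ?I s x = g (k (e x)))"
    by blast
qed

lemma psc_homI:
  assumes S: "coded S e d C" and T: "coded T f g D"
    and v: "v \<in> verts T" and s: "s \<in> verts (init_subtree T v) \<rightarrow>\<^sub>E verts S" and i: "i \<in> verts S \<rightarrow>\<^sub>E verts (init_subtree T v)"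
    and L: "lconn C D (f v) (\<lambda>y. e (s (g y))) k (\<lambda>x. f (i (d x)))"
  shows "(v, s, i) \<in> psc_hom S T"
proof -
  interpret S: coded S e d C by fact
  interpret T: coded T f g D by fact
  let ?I = "init_subtree T v"
  interpret I: coded ?I f g "below D (f v)" using T.coded_init[OF v] .
  note E = embedding_iff[OF S I.coded_axioms]
  have i_in: "i x \<in> verts ?I" if "x \<in> verts S" for x using i that by auto
  have s_in: "s y \<in> verts S" if "y \<in> verts ?I" for y using s that by auto
  define i' where "i' = (\<lambda>x \<in> verts S. g (k (e x)))"
  have k: "k x \<in> below D (f v)" "e (s (g (k x))) = x" "e (s (g (f (i (d x))))) = x" if "x \<in> C" for x
    using L that unfolding lconn_def by blast+
  have i'_in: "i' x \<in> verts ?I" if "x \<in> verts S" for x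
    using that k(1)[OF S.e_in[OF that]] I.d_in by (simp add: i'_def)
  have fi': "f (i' (d c)) = k c" if "c \<in> C" for c
    using that S.d_in S.e_d I.e_d k(1) by (simp add: i'_def)
  have "lemb C k" using L by (simp add: lconn_def)
  then have "lemb C (\<lambda>c. f (i' (d c)))" using lemb_cong[OF S.ltree, of k "\<lambda>c. f (i' (d c))"] fi' by simp
  then have e1: "embedding S ?I i'" unfolding E using i'_in by (auto simp: i'_def)
  have e2: "embedding S ?I i" unfolding E using i L by (simp add: lconn_def)
  have si': "s (i' x) = x" if x: "x \<in> verts S" for x
    using k(2)[OF S.e_in[OF x]] x S.e_eq_iff[OF s_in[OF i'_in[OF x]] x] by (simp add: i'_def)
  have si: "s (i x) = x" if x: "x \<in> verts S" for x
    using k(3)[OF S.e_in[OF x]] x S.e_eq_iff[OF s_in[OF i_in[OF x]] x] S.d_e[OF x] I.d_e[OF i_in[OF x]] by simp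
  have le: "(i' (s y), y) \<in> ord ?I" if y: "y \<in> verts ?I" for y
  proof -
    have "prefix (k (e (s (g (f y))))) (f y)" using L I.e_in[OF y] unfolding lconn_def by blast
    then have "prefix (f (i' (s y))) (f y)"
      using I.d_e[OF y] fi'[OF S.e_in[OF s_in[OF y]]] S.d_e[OF s_in[OF y]] by simp
    then show ?thesis using y i'_in[OF s_in[OF y]] by (simp add: I.ord_iff)
  qed
  have "rigid_surjection ?I S s"
    unfolding rigid_surjection_def using s e1 si' le by blast
  moreover have "tle S (s y) x" if x: "x \<in> verts S" and y: "y \<in> verts ?I" and less: "tless ?I y (i x)" for x y
  proof -
    have "f y < f (i (d (e x)))" using less S.d_e[OF x] by (simp add: I.tless_iff)
    then have "e (s (g (f y))) \<le> e x" using L S.e_in[OF x] I.e_in[OF y] unfolding lconn_def by blast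
    then show ?thesis using x s_in[OF y] I.d_e[OF y] by (simp add: S.tle_iff)
  qed
  moreover have "i (max_leaf S) = max_leaf ?I"
  proof -
    have "f (i (d (Max C))) = f v" using L by (simp add: lconn_def)
    moreover have "i (max_leaf S) \<in> verts T" using i_in[OF S.max_leaf_eq(2)] T.verts_init[OF v] by blast
    ultimately show ?thesis
      using T.e_eq_iff[OF _ v] S.max_leaf_eq(1) T.max_leaf_init[OF v] by metis
  qed
  ultimately show ?thesis
    using v e2 si by (simp add: psc_hom_def strong_connection_def connection_def)
qed

section \<open>Coding a vertex by the ranks along its path from the root\<close>

locale finite_otree =
  fixes T :: "'a otree"
  assumes ordered_tree: "ordered_tree T"
begin

lemma fin: "finite (verts T)"
  using ordered_tree by (simp add: ordered_tree_def)

lemma ord_verts: "(x, y) \<in> ord T \<Longrightarrow> x \<in> verts T \<and> y \<in> verts T"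
  and ord_refl: "x \<in> verts T \<Longrightarrow> (x, x) \<in> ord T"
  and ord_trans: "(x, y) \<in> ord T \<Longrightarrow> (y, z) \<in> ord T \<Longrightarrow> (x, z) \<in> ord T"
  and ord_antisym: "(x, y) \<in> ord T \<Longrightarrow> (y, x) \<in> ord T \<Longrightarrow> x = y"
proof -
  have po: "partial_order_on (verts T) (ord T)" using ordered_tree by (simp add: ordered_tree_def)
  note D = partial_order_onD[OF po]
  show "(x, y) \<in> ord T \<Longrightarrow> x \<in> verts T \<and> y \<in> verts T" using D(4) by blast
  show "x \<in> verts T \<Longrightarrow> (x, x) \<in> ord T" using D(1) by (simp add: refl_on_def)
  show "(x, y) \<in> ord T \<Longrightarrow> (y, z) \<in> ord T \<Longrightarrow> (x, z) \<in> ord T" using D(2) by (rule transD)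
  show "(x, y) \<in> ord T \<Longrightarrow> (y, x) \<in> ord T \<Longrightarrow> x = y" using D(3) by (rule antisymD)
qed

lemma ord_chain: "(x, z) \<in> ord T \<Longrightarrow> (y, z) \<in> ord T \<Longrightarrow> (x, y) \<in> ord T \<or> (y, x) \<in> ord T"
proof -
  assume xz: "(x, z) \<in> ord T" and yz: "(y, z) \<in> ord T"
  have "z \<in> verts T" "x \<in> verts T" using ord_verts xz by blast+
  then have "total_on {y. (y, z) \<in> ord T} (ord T)" and "(x, x) \<in> ord T"
    using ordered_tree ord_refl unfolding ordered_tree_def by simp_all
  then show ?thesis using xz yz unfolding total_on_def by (cases "x = y") auto
qed

lemma root_vert: "root T \<in> verts T" "x \<in> verts T \<Longrightarrow> (root T, x) \<in> ord T"
proof -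
  obtain r where r: "r \<in> verts T" "\<forall>x \<in> verts T. (r, x) \<in> ord T"
    using ordered_tree unfolding ordered_tree_def by blast
  have "root T = r"
    unfolding root_def
  proof (rule the_equality)
    fix u assume "u \<in> verts T \<and> (\<forall>x \<in> verts T. (u, x) \<in> ord T)"
    then show "u = r" using r ord_antisym[of u r] by blast
  qed (use r in blast)
  then show "root T \<in> verts T" "x \<in> verts T \<Longrightarrow> (root T, x) \<in> ord T" using r by auto
qed

definition depth :: "'a \<Rightarrow> nat" where
  "depth x = card {y. (y, x) \<in> ord T}"

lemma finite_below: "finite {y. (y, x) \<in> ord T}"
  by (rule finite_subset[OF _ fin]) (use ord_verts in blast)

lemma depth_less: "(x, y) \<in> ord T \<Longrightarrow> x \<noteq> y \<Longrightarrow> depth x < depth y"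
proof -
  assume xy: "(x, y) \<in> ord T" "x \<noteq> y"
  have "y \<in> {z. (z, y) \<in> ord T}" using ord_refl ord_verts[OF xy(1)] by blast
  moreover have "y \<notin> {z. (z, x) \<in> ord T}" using ord_antisym[OF xy(1)] xy(2) by blast
  moreover have "{z. (z, x) \<in> ord T} \<subseteq> {z. (z, y) \<in> ord T}" using ord_trans xy(1) by blast
  ultimately show "depth x < depth y" unfolding depth_def by (intro psubset_card_mono[OF finite_below]) blast
qed

lemma isuccD:
  assumes "x \<in> isucc T p"
  shows "x \<in> verts T" "p \<in> verts T" "(p, x) \<in> ord T" "p \<noteq> x"
    "(p, z) \<in> ord T \<Longrightarrow> (z, x) \<in> ord T \<Longrightarrow> z = p \<or> z = x"
  using assms ord_verts unfolding isucc_def by blast+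

lemma parent_exists:
  assumes x: "x \<in> verts T" "x \<noteq> root T"
  obtains p where "x \<in> isucc T p"
proof -
  let ?P = "{y. (y, x) \<in> ord T \<and> y \<noteq> x}"
  have fP: "finite ?P" by (rule finite_subset[OF _ finite_below[of x]]) blast
  have "root T \<in> ?P" using root_vert(2)[OF x(1)] x(2) by simp
  then have "Max (depth ` ?P) \<in> depth ` ?P" using fP by (intro Max_in) auto
  then obtain p where p: "(p, x) \<in> ord T" "p \<noteq> x" "depth p = Max (depth ` ?P)" by auto
  have "z = p \<or> z = x" if z: "(p, z) \<in> ord T" "(z, x) \<in> ord T" for z
  proof (rule ccontr)
    assume n: "\<not> (z = p \<or> z = x)"
    then have "depth z \<le> depth p" using z(2) fP p(3) by (auto intro!: Max_ge)
    moreover have "depth p < depth z" using depth_less z(1) n by blast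
    ultimately show False by simp
  qed
  then have "x \<in> isucc T p" using p(1,2) x(1) unfolding isucc_def by blast
  then show thesis by (rule that)
qed

lemma parent_unique: "x \<in> isucc T p \<Longrightarrow> x \<in> isucc T q \<Longrightarrow> p = q"
  using ord_chain[OF isuccD(3) isuccD(3)] isuccD by metis

lemma below_parent: "x \<in> isucc T p \<Longrightarrow> (y, x) \<in> ord T \<Longrightarrow> y \<noteq> x \<Longrightarrow> (y, p) \<in> ord T"
proof -
  assume x: "x \<in> isucc T p" and y: "(y, x) \<in> ord T" "y \<noteq> x"
  have "(y, p) \<in> ord T \<or> (p, y) \<in> ord T" using ord_chain[OF y(1) isuccD(3)[OF x]] .
  then show ?thesis using isuccD(5)[OF x _ y(1)] y(2) ord_refl isuccD(2)[OF x] by blast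
qed

definition par :: "'a \<Rightarrow> 'a" where
  "par x = (THE p. x \<in> isucc T p)"

lemma par_eq: "x \<in> isucc T p \<Longrightarrow> par x = p"
  unfolding par_def using parent_unique by (intro the_equality) blast+

definition rank :: "'a \<Rightarrow> nat" where
  "rank x = card {z \<in> isucc T (par x). (z, x) \<in> sib T (par x)}"

lemma rank_le_iff:
  assumes y: "y \<in> isucc T p" and z: "z \<in> isucc T p"
  shows "(y, z) \<in> sib T p \<longleftrightarrow> rank y \<le> rank z" "rank y = rank z \<Longrightarrow> y = z"
proof -
  have lo: "linear_order_on (isucc T p) (sib T p)"
    using ordered_tree isuccD(2)[OF y] by (simp add: ordered_tree_def)
  then have po: "partial_order_on (isucc T p) (sib T p)" and tot: "total_on (isucc T p) (sib T p)"
    by (auto simp: linear_order_on_def)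
  note D = partial_order_onD[OF po]
  have fi: "finite {w \<in> isucc T p. (w, x) \<in> sib T p}" for x
    by (rule finite_subset[OF _ fin]) (use isuccD(1) in blast)
  have le: "rank u \<le> rank v" if "(u, v) \<in> sib T p" "u \<in> isucc T p" "v \<in> isucc T p" for u v
    unfolding rank_def par_eq[OF that(2)] par_eq[OF that(3)]
    using that(1) transD[OF D(2)] by (intro card_mono fi) blast
  have less: "rank u < rank v" if "(u, v) \<in> sib T p" "u \<noteq> v" "u \<in> isucc T p" "v \<in> isucc T p" for u v
  proof -
    have "v \<in> {w \<in> isucc T p. (w, v) \<in> sib T p}" using D(1) that(4) by (simp add: refl_on_def)
    moreover have "v \<notin> {w \<in> isucc T p. (w, u) \<in> sib T p}" using that(1,2) antisymD[OF D(3)] by blast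
    moreover have "{w \<in> isucc T p. (w, u) \<in> sib T p} \<subseteq> {w \<in> isucc T p. (w, v) \<in> sib T p}"
      using that(1) transD[OF D(2)] by blast
    ultimately show ?thesis
      unfolding rank_def par_eq[OF that(3)] par_eq[OF that(4)] by (intro psubset_card_mono[OF fi]) blast
  qed
  have "y = z \<or> (y, z) \<in> sib T p \<or> (z, y) \<in> sib T p" using tot y z unfolding total_on_def by blast
  moreover have "(z, z) \<in> sib T p" using D(1) z by (simp add: refl_on_def)
  ultimately show "(y, z) \<in> sib T p \<longleftrightarrow> rank y \<le> rank z" "rank y = rank z \<Longrightarrow> y = z"
    using le[OF _ y z] less[OF _ _ z y] less[OF _ _ y z] by fastforce+
qed

text \<open>The number is fuel for the recursion through parents. The value \<open>depth x\<close>
  suffices, since it counts the vertices up to and including \<open>x\<close>, one more than the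
  steps to the root.\<close>

primrec path :: "nat \<Rightarrow> 'a \<Rightarrow> nat list" where
  "path 0 x = []"
| "path (Suc n) x = (if x = root T then [] else path n (par x) @ [rank x])"

definition code :: "'a \<Rightarrow> nat list" where
  "code x = path (depth x) x"

lemma path_stable: "x \<in> verts T \<Longrightarrow> depth x \<le> n \<Longrightarrow> depth x \<le> m \<Longrightarrow> path n x = path m x"
proof (induction n arbitrary: x m)
  case 0
  have "x \<in> {y. (y, x) \<in> ord T}" using ord_refl 0(1) by simp
  then have "depth x > 0" unfolding depth_def using finite_below by (metis card_gt_0_iff empty_iff)
  then show ?case using 0 by simp
next
  case (Suc n)
  show ?case
  proof (cases "x = root T")
    case True
    then show ?thesis by (cases m) simp_all
  next
    case False
    obtain p where p: "x \<in> isucc T p" using parent_exists[OF Suc.prems(1) False] .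
    have d: "depth p < depth x" using depth_less isuccD[OF p] by blast
    then obtain m' where m: "m = Suc m'" using Suc.prems(3) by (cases m) auto
    have "path n p = path m' p" using Suc.IH[OF isuccD(2)[OF p]] d Suc.prems m by simp
    then show ?thesis using False m par_eq[OF p] by simp
  qed
qed

lemma code_root: "code (root T) = []"
  unfolding code_def by (cases "depth (root T)") simp_all

lemma code_child: "x \<in> isucc T p \<Longrightarrow> code x = code p @ [rank x]"
proof -
  assume x: "x \<in> isucc T p"
  have d: "depth p < depth x" using depth_less isuccD[OF x] by blast
  then obtain n where n: "depth x = Suc n" by (cases "depth x") auto
  have "x \<noteq> root T" using isuccD[OF x] root_vert(2) ord_antisym by blast
  then show ?thesis
    using n d path_stable[OF isuccD(2)[OF x], of "depth p" n] par_eq[OF x] by (simp add: code_def)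
qed

lemma tree_induct [consumes 1, case_names root child]:
  assumes "x \<in> verts T" "P (root T)" "\<And>x p. x \<in> isucc T p \<Longrightarrow> P p \<Longrightarrow> P x"
  shows "P x"
  using assms(1)
proof (induction "depth x" arbitrary: x rule: less_induct)
  case less
  show ?case
  proof (cases "x = root T")
    case False
    obtain p where p: "x \<in> isucc T p" using parent_exists[OF less.prems False] .
    then show ?thesis using assms(3)[OF p] less.hyps[of p] depth_less isuccD[OF p] by blast
  qed (use assms(2) in simp)
qed

lemma code_mono: "(x, y) \<in> ord T \<Longrightarrow> prefix (code x) (code y)"
proof -
  assume xy: "(x, y) \<in> ord T"
  then have "y \<in> verts T" using ord_verts by blast
  then show ?thesis using xy
  proof (induction y rule: tree_induct)
    case root
    then have "x = root T" using root_vert(2) ord_antisym ord_verts by blast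
    then show ?case by simp
  next
    case (child y p)
    show ?case
    proof (cases "x = y")
      case False
      then have "prefix (code x) (code p)" using child below_parent by blast
      then show ?thesis using code_child[OF child(1)] by simp
    qed simp
  qed
qed

lemma code_inj: "x \<in> verts T \<Longrightarrow> y \<in> verts T \<Longrightarrow> code x = code y \<Longrightarrow> x = y"
proof (induction x arbitrary: y rule: tree_induct)
  case root
  show ?case
  proof (rule ccontr)
    assume "root T \<noteq> y"
    then obtain p where "y \<in> isucc T p" using parent_exists root(1) by metis
    then show False using code_child[of y p] root code_root by simp
  qed
next
  case (child x p)
  have "y \<noteq> root T" using child code_root code_child[OF child(1)] by auto
  then obtain q where q: "y \<in> isucc T q" using parent_exists child by metis
  have "code p = code q" "rank x = rank y" using child code_child[OF child(1)] code_child[OF q] by simp_all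
  then have "p = q" using child(2) isuccD(2)[OF q] by blast
  then show ?case using rank_le_iff(2)[of x p y] child(1) q \<open>rank x = rank y\<close> by simp
qed

lemma code_prefix: "y \<in> verts T \<Longrightarrow> prefix c (code y) \<Longrightarrow> \<exists>x. (x, y) \<in> ord T \<and> code x = c"
proof (induction y rule: tree_induct)
  case root
  then show ?case using code_root ord_refl[OF root_vert(1)] by auto
next
  case (child y p)
  show ?case
  proof (cases "c = code y")
    case True
    then show ?thesis using ord_refl isuccD[OF child(1)] by blast
  next
    case False
    then have "prefix c (code p)" using child(3) code_child[OF child(1)] by (simp add: prefix_snoc)
    then show ?thesis using child(2) ord_trans isuccD(3)[OF child(1)] by blast
  qed
qed

theorem coded_code: "coded T code (inv_into (verts T) code) (code ` verts T)"
proof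
  have inj: "inj_on code (verts T)" using code_inj by (auto intro: inj_onI)
  show "ltree (code ` verts T)"
    unfolding ltree_def
  proof (intro conjI ballI allI impI)
    show "finite (code ` verts T)" using fin by simp
    show "[] \<in> code ` verts T" using root_vert(1) code_root by force
    fix c d assume "c \<in> code ` verts T" "prefix d c"
    then show "d \<in> code ` verts T" using code_prefix ord_verts by blast
  qed
  show "x \<in> verts T \<Longrightarrow> code x \<in> code ` verts T" for x by simp
  show "x \<in> verts T \<Longrightarrow> inv_into (verts T) code (code x) = x" for x using inj by simp
  show "c \<in> code ` verts T \<Longrightarrow> inv_into (verts T) code c \<in> verts T" for c by (rule inv_into_into)
  show "c \<in> code ` verts T \<Longrightarrow> code (inv_into (verts T) code c) = c" for c by (rule f_inv_into_f)
  show "(x, y) \<in> ord T \<longleftrightarrow> x \<in> verts T \<and> y \<in> verts T \<and> prefix (code x) (code y)" for x y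
    using code_mono code_prefix code_inj ord_verts by metis
  show "(y, z) \<in> sib T x \<longleftrightarrow> code y \<le> code z" if "y \<in> isucc T x" "z \<in> isucc T x" for x y z
    using rank_le_iff(1)[OF that] code_child[OF that(1)] code_child[OF that(2)] by (simp add: order_le_less)
qed

end

text \<open>The sibling orders are filled in by an update because they must be relations on sets of
  immediate successors, which depend only on the vertices and the tree order.\<close>

definition otree_of :: "(nat list \<Rightarrow> 'a) \<Rightarrow> nat list set \<Rightarrow> 'a otree" where
  "otree_of \<nu> C =
    (let T = \<lparr>verts = \<nu> ` C, ord = {(\<nu> x, \<nu> y) |x y. x \<in> C \<and> y \<in> C \<and> prefix x y}, sib = \<lambda>_. {}\<rparr>
     in T\<lparr>sib := \<lambda>p. {(\<nu> x, \<nu> y) |x y. x \<le> y} \<inter> (isucc T p \<times> isucc T p)\<rparr>)"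

lemma otree_of:
  assumes \<nu>: "inj \<nu>" and C: "ltree C"
  shows "ordered_tree (otree_of \<nu> C)" "coded (otree_of \<nu> C) (inv \<nu>) \<nu> C"
proof -
  let ?T = "otree_of \<nu> C"
  have v: "verts ?T = \<nu> ` C" by (simp add: otree_of_def Let_def)
  have o: "(a, c) \<in> ord ?T \<longleftrightarrow> (\<exists>x \<in> C. \<exists>y \<in> C. a = \<nu> x \<and> c = \<nu> y \<and> prefix x y)" for a c
    by (auto simp: otree_of_def Let_def)
  have o': "(\<nu> x, \<nu> y) \<in> ord ?T \<longleftrightarrow> x \<in> C \<and> y \<in> C \<and> prefix x y" for x y
    unfolding o using injD[OF \<nu>] by blast
  have i: "isucc ?T p = isucc \<lparr>verts = \<nu> ` C, ord = {(\<nu> x, \<nu> y) |x y. x \<in> C \<and> y \<in> C \<and> prefix x y}, sib = \<lambda>_. {}\<rparr> p" for p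
    by (simp add: isucc_def otree_of_def Let_def)
  have s: "sib ?T p = {(\<nu> x, \<nu> y) |x y. x \<le> y} \<inter> (isucc ?T p \<times> isucc ?T p)" for p
    unfolding i by (simp add: otree_of_def Let_def)
  have s': "(\<nu> x, \<nu> y) \<in> sib ?T p \<longleftrightarrow> x \<le> y \<and> \<nu> x \<in> isucc ?T p \<and> \<nu> y \<in> isucc ?T p" for x y p
    unfolding s using injD[OF \<nu>] by blast
  have isub: "isucc ?T p \<subseteq> \<nu> ` C" for p by (auto simp: isucc_def v)
  have po: "partial_order_on (verts ?T) (ord ?T)"
    unfolding partial_order_on_def preorder_on_def
  proof (intro conjI)
    show "ord ?T \<subseteq> verts ?T \<times> verts ?T" unfolding v by (auto simp: o)
    show "refl_on (verts ?T) (ord ?T)" unfolding v refl_on_def by (auto simp: o')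
    show "trans (ord ?T)"
    proof (rule transI)
      fix x y z assume "(x, y) \<in> ord ?T" "(y, z) \<in> ord ?T"
      then show "(x, z) \<in> ord ?T" unfolding o using injD[OF \<nu>] prefix_order.trans by metis
    qed
    show "antisym (ord ?T)"
    proof (rule antisymI)
      fix x y assume "(x, y) \<in> ord ?T" "(y, x) \<in> ord ?T"
      then show "x = y" unfolding o using injD[OF \<nu>] prefix_order.antisym by metis
    qed
  qed
  have lin: "linear_order_on (isucc ?T p) (sib ?T p)" for p
    unfolding linear_order_on_def partial_order_on_def preorder_on_def
  proof (intro conjI)
    show "sib ?T p \<subseteq> isucc ?T p \<times> isucc ?T p" unfolding s by blast
    show "refl_on (isucc ?T p) (sib ?T p)" unfolding refl_on_def using isub[of p] by (auto simp: s')
    show "trans (sib ?T p)"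
    proof (rule transI)
      fix x y z assume "(x, y) \<in> sib ?T p" "(y, z) \<in> sib ?T p"
      then obtain a c e where "x = \<nu> a" "y = \<nu> c" "z = \<nu> e" "(\<nu> a, \<nu> c) \<in> sib ?T p" "(\<nu> c, \<nu> e) \<in> sib ?T p"
        unfolding s by blast
      then show "(x, z) \<in> sib ?T p" by (auto simp: s')
    qed
    show "antisym (sib ?T p)"
    proof (rule antisymI)
      fix x y assume "(x, y) \<in> sib ?T p" "(y, x) \<in> sib ?T p"
      then obtain a c where "x = \<nu> a" "y = \<nu> c" "(\<nu> a, \<nu> c) \<in> sib ?T p" "(\<nu> c, \<nu> a) \<in> sib ?T p"
        unfolding s by blast
      then show "x = y" by (auto simp: s')
    qed
    show "total_on (isucc ?T p) (sib ?T p)"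
    proof (rule total_onI)
      fix x y assume xy: "x \<in> isucc ?T p" "y \<in> isucc ?T p"
      then obtain a c where "x = \<nu> a" "y = \<nu> c" using isub by blast
      then show "(x, y) \<in> sib ?T p \<or> (y, x) \<in> sib ?T p" using xy linear[of a c] by (auto simp: s')
    qed
  qed
  show "ordered_tree ?T"
    unfolding ordered_tree_def
  proof (intro conjI ballI po lin)
    show "finite (verts ?T)" using ltreeD(1)[OF C] by (simp add: v)
    show "\<exists>r \<in> verts ?T. \<forall>x \<in> verts ?T. (r, x) \<in> ord ?T"
      using ltreeD(2)[OF C] by (intro bexI[of _ "\<nu> []"]) (auto simp: v o')
    fix x assume "x \<in> verts ?T"
    show "total_on {y. (y, x) \<in> ord ?T} (ord ?T)"
    proof (rule total_onI)
      fix y z assume "y \<in> {y. (y, x) \<in> ord ?T}" "z \<in> {y. (y, x) \<in> ord ?T}"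
      then obtain a c e where "y = \<nu> a" "z = \<nu> c" "x = \<nu> e" "a \<in> C" "c \<in> C" "prefix a e" "prefix c e"
        using injD[OF \<nu>] by (auto simp: o) metis
      then show "(y, z) \<in> ord ?T \<or> (z, y) \<in> ord ?T" using prefix_same_cases by (auto simp: o')
    qed
  qed
  show "coded ?T (inv \<nu>) \<nu> C"
  proof
    show "ltree C" by fact
    show "x \<in> verts ?T \<Longrightarrow> inv \<nu> x \<in> C" "x \<in> verts ?T \<Longrightarrow> \<nu> (inv \<nu> x) = x" for x
      using \<nu> by (auto simp: v)
    show "c \<in> C \<Longrightarrow> \<nu> c \<in> verts ?T" "c \<in> C \<Longrightarrow> inv \<nu> (\<nu> c) = c" for c using \<nu> by (auto simp: v)
    show "(x, y) \<in> ord ?T \<longleftrightarrow> x \<in> verts ?T \<and> y \<in> verts ?T \<and> prefix (inv \<nu> x) (inv \<nu> y)" for x y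
    proof (cases "x \<in> \<nu> ` C \<and> y \<in> \<nu> ` C")
      case True
      then obtain a c where "x = \<nu> a" "y = \<nu> c" "a \<in> C" "c \<in> C" by blast
      then show ?thesis using \<nu> by (auto simp: v o')
    qed (auto simp: v o)
    show "(y, z) \<in> sib ?T x \<longleftrightarrow> inv \<nu> y \<le> inv \<nu> z" if yz: "y \<in> isucc ?T x" "z \<in> isucc ?T x" for x y z
    proof -
      obtain a c where "y = \<nu> a" "z = \<nu> c" using isub yz by blast
      then show ?thesis using yz \<nu> by (simp add: s')
    qed
  qed
qed

lemma infinite_type_inj: "\<exists>\<nu> :: nat list \<Rightarrow> 'a::infinite. inj \<nu>"
proof -
  obtain f :: "nat \<Rightarrow> 'a" where f: "inj f" using infinite_UNIV infinite_countable_subset by blast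
  have "inj (f \<circ> (to_nat :: nat list \<Rightarrow> nat))" by (rule inj_compose[OF f inj_to_nat])
  then show ?thesis by blast
qed

section \<open>Connections as rigid surjections\<close>

lemma lconn_cong:
  assumes "lconn C D v s k i" "ltree C" "\<And>y. y \<in> below D v \<Longrightarrow> s y = s' y" "\<And>x. x \<in> C \<Longrightarrow> i x = i' x"
  shows "lconn C D v s' k i'"
proof -
  have "s' (k x) = x \<and> s' (i' x) = x" if "x \<in> C" for x
  proof -
    have "k x \<in> below D v" "i x \<in> below D v" "s (k x) = x" "s (i x) = x"
      using assms(1) that unfolding lconn_def by blast+
    then show ?thesis using assms(3)[of "k x"] assms(3)[of "i x"] assms(4)[OF that] by simp
  qed
  then show ?thesis
    using assms lemb_cong[OF assms(2), of i i'] ltree_Max(1)[OF assms(2)] unfolding lconn_def by simp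
qed

text \<open>Both embeddings are \<open>j\<close> here: from \<open>y < j x\<close> follows
  \<open>j (t y) < j x\<close>, so \<open>t y\<close> precedes \<open>x\<close> as a connection
  requires.\<close>

lemma lhom_lconn:
  assumes g: "(t, j) \<in> lhom D E" and D: "ltree D"
  shows "lconn D E (j (Max D)) t j j"
proof -
  note gD = lhomD[OF g]
  have "t y \<le> x" if "x \<in> D" "y \<in> E" "y < j x" for x y
    using lhom_pullback_less[OF g D that] by simp
  then show ?thesis
    unfolding lconn_def using gD(1,3,5,6,7) lhom_image_le_end[OF g D]
    by (intro conjI ballI impI) simp_all
qed

text \<open>Both \<open>k\<close> and \<open>i\<close> are followed by the same injective map
  \<open>j\<close>, so composition does not change the set of points at which they differ.\<close>

lemma lconn_comp:
  assumes L: "lconn C D v s k i" and C: "ltree C" and D: "ltree D" and v: "v \<in> D" and g: "(t, j) \<in> lhom D E"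
  shows "lconn C E (j v) (\<lambda>y. s (t y)) (\<lambda>x. j (k x)) (\<lambda>x. j (i x))"
proof -
  note gD = lhomD[OF g]
  have k: "k x \<in> D" "k x \<le> v" "i x \<in> D" "i x \<le> v" "s (k x) = x" "s (i x) = x" if "x \<in> C" for x
    using L that unfolding lconn_def by auto
  have pb: "t y \<in> below D v" "prefix (j (t y)) y" if "y \<in> below E (j v)" for y
    using lhom_pullback_le[OF g D v, of y] that by auto
  show ?thesis
    unfolding lconn_def
  proof (intro conjI ballI impI)
    have "k ` C \<subseteq> D" "i ` C \<subseteq> D" "lemb C k" "lemb C i" using k L by (auto simp: lconn_def)
    then show "lemb C (\<lambda>x. j (k x))" "lemb C (\<lambda>x. j (i x))"
      using lemb_comp[OF _ C _ gD(3)] by blast+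
  next
    fix x assume x: "x \<in> C"
    show "j (k x) \<in> below E (j v)" "j (i x) \<in> below E (j v)"
      using k[OF x] gD(1) lemb_le_iff[OF gD(3) _ v] by auto
    show "s (t (j (k x))) = x" "s (t (j (i x))) = x" using k[OF x] gD(5) by simp_all
  next
    fix y assume y: "y \<in> below E (j v)"
    have "s (t y) \<in> C" "prefix (k (s (t y))) (t y)" using L pb(1)[OF y] unfolding lconn_def by blast+
    then have c: "s (t y) \<in> C" "prefix (k (s (t y))) (t y)" .
    then show "s (t y) \<in> C" by simp
    have "prefix (j (k (s (t y)))) (j (t y))"
      using lemb_prefix_iff[OF gD(3) k(1)[OF c(1)] _ ltree_lcp[OF D k(1)[OF c(1)]]] pb(1)[OF y] c(2) by simp
    then show "prefix (j (k (s (t y)))) y" using pb(2)[OF y] by (rule prefix_order.trans)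
  next
    fix x y assume x: "x \<in> C" and y: "y \<in> below E (j v)" "y < j (i x)"
    have "t y < i x" using lhom_pullback_less[OF g D k(3)[OF x], of y] y by simp
    then show "s (t y) \<le> x" using L x pb(1)[OF y(1)] unfolding lconn_def by blast
  next
    show "j (i (Max C)) = j v" using L by (simp add: lconn_def)
  qed
qed

text \<open>A connection \<open>(s, i)\<close> is a rigid surjection onto the tree in which every vertex \<open>x\<close> with
  \<open>i\<^sub>s x \<noteq> i x\<close> receives an additional successor, the preimage of \<open>i x\<close>.\<close>

definition phi :: "nat list set \<Rightarrow> nat list \<Rightarrow> nat list" where
  "phi B x = concat (map (\<lambda>l. (if take l x \<in> B then [0] else []) @ [x ! l]) [0..<length x])"

lemma phi_simps [simp]:
  "phi B [] = []" "phi B (x @ [c]) = phi B x @ (if x \<in> B then [0] else []) @ [c]"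
  by (simp_all add: phi_def nth_append) (rule arg_cong[of _ _ concat], auto)

definition split_tree :: "nat list set \<Rightarrow> nat list set \<Rightarrow> nat list set" where
  "split_tree C B = phi B ` C \<union> (\<lambda>x. phi B x @ [0]) ` B"

text \<open>The collapse of the split tree onto \<open>C\<close>: a vertex that is not a value of
  \<open>phi B\<close> is new, and removing its last entry gives the old vertex beneath it.\<close>

definition unsplit :: "nat list set \<Rightarrow> nat list set \<Rightarrow> nat list \<Rightarrow> nat list" where
  "unsplit C B w = inv_into C (phi B) (if w \<in> phi B ` C then w else butlast w)"

text \<open>A vertex inserted between \<open>x\<close> and its successor does no harm to meets if
  there is only one successor; two successors would meet in the inserted vertex instead of in the
  image of \<open>x\<close>.\<close>

locale splitting =
  fixes C B :: "nat list set"
  assumes C: "ltree C" and BC: "B \<subseteq> C"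
    and one_child: "x \<in> B \<Longrightarrow> x @ [a] \<in> C \<Longrightarrow> x @ [a'] \<in> C \<Longrightarrow> a = a'"
begin

lemma lemb_phi: "lemb C (phi B)"
proof (rule lemb_label_localI[where lab = "\<lambda>x a. if x \<in> B then 0 else a"])
  fix x a b assume "x @ [a] \<in> C" "x @ [b] \<in> C" "a < (b::nat)"
  then show "(if x \<in> B then 0 else a) < (if x \<in> B then 0 else b)" using one_child[of x a b] by auto
qed (use C in auto)

lemma phi_inj: "x \<in> C \<Longrightarrow> y \<in> C \<Longrightarrow> phi B x = phi B y \<longleftrightarrow> x = y"
  using lemb_eq_iff[OF lemb_phi] .

text \<open>A value of \<open>phi B\<close> properly above \<open>phi B x\<close> runs through the
  value at the child of \<open>x\<close>, which is longer than \<open>phi B x\<close> by two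
  entries.\<close>

lemma phi_new: "x \<in> B \<Longrightarrow> y \<in> C \<Longrightarrow> phi B y \<noteq> phi B x @ [0]"
proof
  assume x: "x \<in> B" and y: "y \<in> C" and eq: "phi B y = phi B x @ [0]"
  have xC: "x \<in> C" using x BC by blast
  have "prefix x y"
    using lemb_prefix_iff[OF lemb_phi xC y ltree_lcp[OF C xC]] eq by simp
  moreover have "x \<noteq> y" using eq by auto
  ultimately obtain c r where y': "y = (x @ [c]) @ r" by (metis append_Cons append_Nil append_assoc neq_Nil_conv prefix_def self_append_conv)
  then have xc: "x @ [c] \<in> C" using ltreeD(3)[OF C y] by simp
  have "prefix (phi B (x @ [c])) (phi B y)"
    using lemb_prefix_iff[OF lemb_phi xc y ltree_lcp[OF C xc]] y' by simp
  then have "length (phi B (x @ [c])) \<le> length (phi B y)" by (rule prefix_length_le)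
  then show False using eq x by simp
qed

lemma unsplit [simp]: "x \<in> C \<Longrightarrow> unsplit C B (phi B x) = x" "x \<in> B \<Longrightarrow> unsplit C B (phi B x @ [0]) = x"
proof -
  have inj: "inj_on (phi B) C" using phi_inj by (auto intro: inj_onI)
  show "x \<in> C \<Longrightarrow> unsplit C B (phi B x) = x" using inj by (simp add: unsplit_def)
  show "unsplit C B (phi B x @ [0]) = x" if x: "x \<in> B"
  proof -
    have "phi B x @ [0] \<notin> phi B ` C" using phi_new[OF x] by force
    then show ?thesis using inj x BC by (auto simp: unsplit_def)
  qed
qed

lemma ltree_split: "ltree (split_tree C B)"
  unfolding ltree_def
proof (intro conjI ballI allI impI)
  show "finite (split_tree C B)"
    using ltreeD(1)[OF C] BC by (auto simp: split_tree_def intro: finite_subset)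
  show "[] \<in> split_tree C B" using ltreeD(2)[OF C] by (force simp: split_tree_def)
  have old: "w \<in> split_tree C B" if "x \<in> C" "prefix w (phi B x)" for x w
    using that
  proof (induction x arbitrary: w rule: rev_induct)
    case Nil
    then show ?case by (force simp: split_tree_def)
  next
    case (snoc c x)
    have x: "x \<in> C" using ltreeD(3)[OF C snoc.prems(1)] by simp
    have "prefix w (phi B x) \<or> w = phi B (x @ [c]) \<or> x \<in> B \<and> w = phi B x @ [0]"
      using snoc.prems(2) by (auto simp: prefix_snoc prefix_append prefix_Cons split: if_splits)
    then show ?case using snoc.IH[OF x] snoc.prems(1) by (auto simp: split_tree_def simp del: phi_simps)
  qed
  fix x w assume x: "x \<in> split_tree C B" and w: "prefix w x"
  show "w \<in> split_tree C B"
  proof (cases "x \<in> phi B ` C")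
    case True
    then show ?thesis using old w by blast
  next
    case False
    then obtain x' where x': "x' \<in> B" "x = phi B x' @ [0]" using x by (auto simp: split_tree_def)
    then show ?thesis using w old[of x'] BC x by (auto simp: prefix_snoc)
  qed
qed

lemma split_child:
  assumes "w @ [a] \<in> split_tree C B"
  obtains (new) x where "x \<in> B" "w = phi B x" "a = 0"
  | (above) x where "x \<in> B" "x @ [a] \<in> C" "w = phi B x @ [0]"
  | (old) x where "x \<in> C" "x \<notin> B" "x @ [a] \<in> C" "w = phi B x"
proof -
  from assms consider y where "y \<in> C" "w @ [a] = phi B y" | x where "x \<in> B" "w @ [a] = phi B x @ [0]"
    by (auto simp: split_tree_def)
  then show thesis
  proof cases
    case 1
    then obtain x c where y: "y = x @ [c]" by (cases y rule: rev_cases) auto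
    have "x \<in> C" using ltreeD(3)[OF C 1(1)] y by simp
    then show thesis using 1 y old above by (auto split: if_splits)
  next
    case 2
    then show thesis using new by auto
  qed
qed

context
  fixes D :: "nat list set" and v :: "nat list" and s k i :: "nat list \<Rightarrow> nat list"
  assumes D: "ltree D" and v: "v \<in> D" and L: "lconn C D v s k i"
    and B: "\<And>x. x \<in> C \<Longrightarrow> x \<in> B \<longleftrightarrow> k x \<noteq> i x"
begin

lemma conn:
  "lemb C k" "lemb C i" "x \<in> C \<Longrightarrow> k x \<in> D" "x \<in> C \<Longrightarrow> k x \<le> v" "x \<in> C \<Longrightarrow> i x \<in> D" "x \<in> C \<Longrightarrow> i x \<le> v"
  "x \<in> C \<Longrightarrow> s (k x) = x" "x \<in> C \<Longrightarrow> s (i x) = x" "y \<in> D \<Longrightarrow> y \<le> v \<Longrightarrow> s y \<in> C"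
  "y \<in> D \<Longrightarrow> y \<le> v \<Longrightarrow> prefix (k (s y)) y" "x \<in> C \<Longrightarrow> y \<in> D \<Longrightarrow> y < i x \<Longrightarrow> y \<le> v \<Longrightarrow> s y \<le> x" "i (Max C) = v"
  using L by (auto simp: lconn_def)

definition split_i :: "nat list \<Rightarrow> nat list" where
  "split_i = (\<lambda>w \<in> split_tree C B. if w \<in> phi B ` C then k (unsplit C B w) else i (unsplit C B w))"

text \<open>The fibre over a point \<open>x\<close> of \<open>B\<close> is divided: what lies above
  \<open>i x\<close> goes to the new vertex, the rest stays with \<open>x\<close>. This makes
  \<open>i x\<close> the least point of the new fibre and leaves \<open>k x\<close> in the old
  one.\<close>

definition split_s :: "nat list \<Rightarrow> nat list" where
  "split_s = (\<lambda>y \<in> below D v. if s y \<in> B \<and> prefix (i (s y)) y then phi B (s y) @ [0] else phi B (s y))"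

lemma prefix_k_i: "x \<in> C \<Longrightarrow> prefix (k x) (i x)"
  using conn(10)[OF conn(5,6)] conn(8) by simp

text \<open>Both points lie below \<open>i (x @ [a])\<close> and are comparable. Were
  \<open>k (x @ [a])\<close> at or before \<open>i x\<close>, the connection condition would give
  \<open>x @ [a] = s (k (x @ [a]))\<close> at most \<open>x\<close>. Hence the new vertex fits
  between \<open>x\<close> and its successor.\<close>

lemma strict_prefix_i_k:
  assumes "x @ [a] \<in> C"
  shows "strict_prefix (i x) (k (x @ [a]))"
proof -
  let ?y = "x @ [a]"
  have x: "x \<in> C" using ltreeD(3)[OF C assms] by simp
  have less: "x < ?y" by simp
  have "prefix (i x) (i ?y)" using lemb_prefix_iff[OF conn(2) x assms ltree_lcp[OF C x]] by simp
  then have "prefix (i x) (k ?y) \<or> prefix (k ?y) (i x)"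
    using prefix_k_i[OF assms] prefix_same_cases by blast
  moreover have "\<not> prefix (k ?y) (i x)"
  proof
    assume "prefix (k ?y) (i x)"
    then have "k ?y \<le> i x" by (rule prefix_imp_le)
    then have "s (k ?y) \<le> x"
      using conn(8)[OF x] conn(11)[OF x conn(3)[OF assms] _ conn(4)[OF assms]] by (cases "k ?y = i x") auto
    then show False using conn(7)[OF assms] less[folded not_le] by simp
  qed
  ultimately show ?thesis by (auto simp: strict_prefix_def)
qed

lemma split_i_simps: "x \<in> C \<Longrightarrow> split_i (phi B x) = k x" "x \<in> B \<Longrightarrow> split_i (phi B x @ [0]) = i x"
proof -
  show "x \<in> C \<Longrightarrow> split_i (phi B x) = k x" by (simp add: split_i_def split_tree_def)
  assume x: "x \<in> B"
  have "phi B x @ [0] \<notin> phi B ` C" using phi_new[OF x] by force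
  then show "split_i (phi B x @ [0]) = i x" using x by (simp add: split_i_def split_tree_def)
qed

text \<open>A split vertex has its new vertex as only child, and this one has at most one child by
  \<open>one_child\<close>. Siblings therefore occur only above old vertices outside
  \<open>B\<close>, where \<open>split_i\<close> is given by \<open>k\<close>.\<close>

lemma lemb_split_i: "lemb (split_tree C B) split_i"
proof (rule lemb_localI)
  show "ltree (split_tree C B)" by (rule ltree_split)
  show "split_i [] = []" using split_i_simps(1)[OF ltreeD(2)[OF C]] lembD(1)[OF conn(1)] by simp
next
  fix w a assume "w @ [a] \<in> split_tree C B"
  then show "strict_prefix (split_i w) (split_i (w @ [a]))"
  proof (cases rule: split_child)
    case (new x)
    then have "x \<in> C" using BC by blast
    then show ?thesis using new prefix_k_i[of x] B[of x] split_i_simps by (simp add: strict_prefix_def)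
  next
    case (above x)
    then have "phi B (x @ [a]) = w @ [a]" by simp
    then show ?thesis using above strict_prefix_i_k[OF above(2)] split_i_simps(1)[OF above(2)] split_i_simps(2) by simp
  next
    case (old x)
    then have e: "phi B (x @ [a]) = w @ [a]" by simp
    have "strict_prefix (k x) (k (x @ [a]))"
      using prefix_k_i[OF old(1)] strict_prefix_i_k[OF old(3)] by (rule prefix_order.le_less_trans)
    then show ?thesis using old split_i_simps(1)[OF old(3)] e split_i_simps(1)[OF old(1)] by simp
  qed
next
  fix w a b assume a: "w @ [a] \<in> split_tree C B" and b: "w @ [b] \<in> split_tree C B" and less: "a < (b::nat)"
  have no_new: False if x: "x \<in> B" "w = phi B x" for x
  proof -
    from b show False
    proof (cases rule: split_child)
      case (above x')
      then show ?thesis using phi_new[of x' x] x BC by auto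
    next
      case (old x')
      then show ?thesis using x BC phi_inj by blast
    qed (use less in simp)
  qed
  from a show "split_i (w @ [a]) < split_i (w @ [b]) \<and> lcp (split_i (w @ [a])) (split_i (w @ [b])) = split_i w"
  proof (cases rule: split_child)
    case (new x)
    then show ?thesis using no_new by blast
  next
    case (above x)
    from b show ?thesis
    proof (cases rule: split_child)
      case (above x')
      have "phi B x = phi B x'" using above(3) \<open>w = phi B x @ [0]\<close> by simp
      then have "x = x'" using phi_inj above(1) \<open>x \<in> B\<close> BC by blast
      then show ?thesis using one_child[OF above(1,2), of a] \<open>x @ [a] \<in> C\<close> less by simp
    next
      case (old x')
      then show ?thesis using phi_new[of x x'] above by auto
    qed (use no_new in blast)
  next
    case (old x)
    from b show ?thesis
    proof (cases rule: split_child)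
      case (above x')
      then show ?thesis using phi_new[of x' x] old by auto
    next
      case old': (old x')
      have x': "x' = x" using phi_inj old old' by metis
      have e: "phi B (x @ [a]) = w @ [a]" "phi B (x @ [b]) = w @ [b]" using old by simp_all
      note xb = old'(3)[unfolded x']
      have "k (x @ [a]) < k (x @ [b])" using lembD(2)[OF conn(1) old(3) xb] less by simp
      moreover have "lcp (k (x @ [a])) (k (x @ [b])) = k x"
        using lembD(3)[OF conn(1) old(3) xb] less by simp
      ultimately show ?thesis
        using split_i_simps(1)[OF old(3)] split_i_simps(1)[OF xb] split_i_simps(1)[OF old(1)] e old(4) by simp
    qed (use no_new in blast)
  qed
qed

lemma split_i_in: "w \<in> split_tree C B \<Longrightarrow> split_i w \<in> D \<and> split_i w \<le> v"
  using conn(3-6) split_i_simps BC by (auto simp: split_tree_def)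

text \<open>The topmost vertex over \<open>Max C\<close>, new or old, is sent to
  \<open>i (Max C) = v\<close>, and no image exceeds \<open>v\<close>. Strength of the connection is
  what makes the encoded surjection have the whole initial subtree as its domain.\<close>

lemma split_end: "split_i (Max (split_tree C B)) = v"
proof -
  let ?l = "Max C"
  have l: "?l \<in> C" using ltree_Max(1)[OF C] .
  define m where "m = (if ?l \<in> B then phi B ?l @ [0] else phi B ?l)"
  have m: "m \<in> split_tree C B" using l by (auto simp: m_def split_tree_def)
  have e: "split_i m = v" using split_i_simps l B[OF l] conn(12) by (auto simp: m_def)
  have "w \<le> m" if "w \<in> split_tree C B" for w
    using split_i_in[OF that] lemb_le_iff[OF lemb_split_i that m] e by simp
  then have "Max (split_tree C B) = m" using ltreeD(1)[OF ltree_split] m by (intro Max_eqI) auto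
  then show ?thesis using e by simp
qed

lemma split_lhom: "(split_s, split_i) \<in> lhom (split_tree C B) D"
proof (rule lhomI)
  show "split_i \<in> extensional (split_tree C B)" by (simp add: split_i_def)
  show "lemb (split_tree C B) split_i" by (rule lemb_split_i)
  show "split_s \<in> extensional (below D (split_i (Max (split_tree C B))))" unfolding split_end by (simp add: split_s_def)
  show "split_i w \<in> D" if "w \<in> split_tree C B" for w using split_i_in[OF that] by simp
  show "split_s (split_i w) = w" if w: "w \<in> split_tree C B" for w
  proof (cases "w \<in> phi B ` C")
    case True
    then obtain x where x: "x \<in> C" "w = phi B x" by blast
    \<comment> \<open>For \<open>x\<close> in \<open>B\<close> the point \<open>k x\<close> is a
      proper prefix of \<open>i x\<close>, so it is not moved to the new vertex.\<close>
    have "\<not> (x \<in> B \<and> prefix (i x) (k x))"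
      using prefix_k_i[OF x(1)] B[OF x(1)] prefix_order.antisym by blast
    then show ?thesis using x split_i_simps(1) conn(3,4,7) by (simp add: split_s_def)
  next
    case False
    then obtain x where x: "x \<in> B" "w = phi B x @ [0]" using w by (auto simp: split_tree_def)
    then have "x \<in> C" using BC by blast
    then show ?thesis using x split_i_simps(2) conn(5,6,8) by (simp add: split_s_def)
  qed
  show "split_s y \<in> split_tree C B \<and> prefix (split_i (split_s y)) y" if y: "y \<in> D" "y \<le> split_i (Max (split_tree C B))" for y
  proof -
    have y': "y \<le> v" using y split_end by simp
    have s: "s y \<in> C" "prefix (k (s y)) y" using conn(9,10) y y' by blast+
    show ?thesis using s y y' split_i_simps by (auto simp: split_s_def split_tree_def)
  qed
qed

lemma unsplit_s: "y \<in> D \<Longrightarrow> y \<le> v \<Longrightarrow> unsplit C B (split_s y) = s y"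
  using conn(9) by (simp add: split_s_def)

lemma split_i_emb: "x \<in> C \<Longrightarrow> split_i (if x \<in> B then phi B x @ [0] else phi B x) = i x"
  using split_i_simps B by auto

end

end

text \<open>As for single successors, \<open>i x\<close> is a prefix of the values of
  \<open>k\<close> at both successors; these meet in \<open>k x\<close>, so \<open>i x\<close> is a
  prefix of \<open>k x\<close>.\<close>

lemma lconn_branching:
  assumes L: "lconn C D v s k i" and C: "ltree C" and a: "x @ [a] \<in> C" "x @ [a'] \<in> C" "a \<noteq> a'"
  shows "k x = i x"
proof -
  have k: "lemb C k" "lemb C i" and x: "x \<in> C" using L ltreeD(3)[OF C a(1)] by (auto simp: lconn_def)
  have pre: "prefix (i x) (k (x @ [a]))" if a: "x @ [a] \<in> C" for a
  proof -
    let ?y = "x @ [a]"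
    have m: "i x \<in> below D v" "k ?y \<in> below D v" "s (i x) = x" "s (k ?y) = ?y" "i ?y \<in> below D v" "s (i ?y) = ?y"
      using L x a unfolding lconn_def by blast+
    have "prefix (i x) (i ?y)" using lemb_prefix_iff[OF k(2) x a ltree_lcp[OF C x]] by simp
    moreover have "prefix (k ?y) (i ?y)" using L m(5,6) unfolding lconn_def by metis
    ultimately have "prefix (i x) (k ?y) \<or> prefix (k ?y) (i x)" using prefix_same_cases by blast
    moreover have "\<not> k ?y < i x"
    proof
      assume "k ?y < i x"
      then have "s (k ?y) \<le> x" using L x m(2) unfolding lconn_def by blast
      then show False using m(4) less_append_Cons[of x a "[]", folded not_le] by simp
    qed
    ultimately show ?thesis by (auto dest!: prefix_imp_le simp: order_le_less)
  qed
  have "prefix (i x) (lcp (k (x @ [a])) (k (x @ [a'])))"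
    by (intro longest_common_prefix_max_prefix pre a)
  also have "lcp (k (x @ [a])) (k (x @ [a'])) = k x"
    using lembD(3)[OF k(1) a(1,2)] a(3) by simp
  finally have "prefix (i x) (k x)" .
  moreover have "prefix (k x) (i x)" using L x unfolding lconn_def by metis
  ultimately show ?thesis by (simp add: prefix_order.antisym)
qed

section \<open>Transfer of the Ramsey theorem to \<open>PSC\<close>\<close>

lemma ordered_tree_coded:
  assumes "ordered_tree T"
  obtains e d C where "coded T e d C"
proof -
  interpret finite_otree T by unfold_locales (rule assms)
  show thesis using that coded_code .
qed

text \<open>The morphism of \<open>PSC\<close> that a rigid surjection onto a split tree encodes.\<close>

definition decode :: "'a otree \<Rightarrow> 'a otree \<Rightarrow> ('a \<Rightarrow> nat list) \<Rightarrow> (nat list \<Rightarrow> 'a) \<Rightarrow> nat list set \<Rightarrow>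
    ('a \<Rightarrow> nat list) \<Rightarrow> (nat list \<Rightarrow> 'a) \<Rightarrow> nat list set \<Rightarrow> lmor \<Rightarrow> 'a psc_mor" where
  "decode S V e d C e' d' B F = (let v = d' (snd F (Max (split_tree C B))) in
     (v, \<lambda>y \<in> verts (init_subtree V v). d (unsplit C B (fst F (e' y))),
      \<lambda>x \<in> verts S. d' (snd F (if e x \<in> B then phi B (e x) @ [0] else phi B (e x)))))"

text \<open>A rigid surjection between list trees becomes a connection in which \<open>j\<close>
  serves both as the chosen embedding and as the associated one; \<open>l\<close> stands for the
  last vertex of the code tree of \<open>T\<close>.\<close>

definition psc_of :: "'a otree \<Rightarrow> 'a otree \<Rightarrow> ('a \<Rightarrow> nat list) \<Rightarrow> (nat list \<Rightarrow> 'a) \<Rightarrow>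
    ('a \<Rightarrow> nat list) \<Rightarrow> (nat list \<Rightarrow> 'a) \<Rightarrow> nat list \<Rightarrow> lmor \<Rightarrow> 'a psc_mor" where
  "psc_of T V e d e' d' l g = (let w = d' (snd g l) in
     (w, \<lambda>y \<in> verts (init_subtree V w). d (fst g (e' y)), \<lambda>x \<in> verts T. d' (snd g (e x))))"

lemma psc_of_in_hom:
  assumes T: "coded T eT dT D" and V: "coded V eV dV E" and g: "(t, j) \<in> lhom D E"
  shows "psc_of T V eT dT eV dV (Max D) (t, j) \<in> psc_hom T V"
proof -
  interpret T: coded T eT dT D by fact
  interpret V: coded V eV dV E by fact
  note gD = lhomD[OF g]
  define w where "w = dV (j (Max D))"
  define tG where "tG = (\<lambda>y \<in> verts (init_subtree V w). dT (t (eV y)))"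
  define jG where "jG = (\<lambda>x \<in> verts T. dV (j (eT x)))"
  have MD: "Max D \<in> D" using ltree_Max(1)[OF T.ltree] .
  have w: "w \<in> verts V" "eV w = j (Max D)" unfolding w_def using V.d_in[OF gD(1)[OF MD]] V.e_d[OF gD(1)[OF MD]] by auto
  interpret W: coded "init_subtree V w" eV dV "below E (eV w)" using V.coded_init[OF w(1)] .
  have jle: "j x \<le> j (Max D)" if "x \<in> D" for x using lhom_image_le_end[OF g T.ltree that] .
  have t_in: "t y \<in> D" if "y \<in> below E (eV w)" for y using gD(6) that w(2) by simp
  have tG: "tG \<in> verts (init_subtree V w) \<rightarrow>\<^sub>E verts T"
    using t_in[OF W.e_in] T.d_in by (auto simp: tG_def)
  have jG: "jG \<in> verts T \<rightarrow>\<^sub>E verts (init_subtree V w)"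
  proof -
    have "dV (j (eT x)) \<in> verts (init_subtree V w)" if "x \<in> verts T" for x
      using W.d_in gD(1)[OF T.e_in[OF that]] jle[OF T.e_in[OF that]] w(2) by simp
    then show ?thesis by (auto simp: jG_def)
  qed
  have j_eq: "eV (jG (dT x)) = j x" if "x \<in> D" for x
    using that T.d_in T.e_d gD(1) V.e_d by (simp add: jG_def)
  have t_eq: "eT (tG (dV y)) = t y" if "y \<in> below E (eV w)" for y
    using that W.d_in[OF that] V.e_d T.e_d[OF t_in[OF that]] by (simp add: tG_def)
  have "lconn D E (eV w) (\<lambda>y. eT (tG (dV y))) j (\<lambda>x. eV (jG (dT x)))"
    using lhom_lconn[OF g T.ltree] unfolding w(2)[symmetric]
    by (rule lconn_cong[OF _ T.ltree]) (simp_all add: t_eq j_eq del: below_iff)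
  then have "(w, tG, jG) \<in> psc_hom T V"
    by (rule psc_homI[OF T V w(1) tG jG])
  then show ?thesis by (simp add: psc_of_def Let_def w_def tG_def jG_def)
qed

text \<open>The second part lets homogeneity pass to \<open>PSC\<close>: composing with
  \<open>(t, j)\<close> after encoding by \<open>F\<close> and decoding at the end gives the
  composite in \<open>PSC\<close>.\<close>

lemma psc_comp_in_hom:
  assumes S: "coded S eS dS C" and T: "coded T eT dT D" and V: "coded V eV dV E"
    and g: "(t, j) \<in> lhom D E" and f: "(v, s, i) \<in> psc_hom S T"
  defines "G \<equiv> psc_of T V eT dT eV dV (Max D) (t, j)"
  shows "psc_comp S T V G (v, s, i) \<in> psc_hom S V"
    and "\<lbrakk>splitting C B; lconn C D (eT v) (\<lambda>y. eS (s (dT y))) k (\<lambda>x. eT (i (dS x)));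
        \<And>x. x \<in> C \<Longrightarrow> x \<in> B \<longleftrightarrow> k x \<noteq> eT (i (dS x))\<rbrakk> \<Longrightarrow>
      \<exists>F \<in> lhom (split_tree C B) D.
        decode S V eS dS C eV dV B (lcomp E (split_tree C B) (t, j) F) = psc_comp S T V G (v, s, i)"
proof -
  interpret S: coded S eS dS C by fact
  interpret T: coded T eT dT D by fact
  interpret V: coded V eV dV E by fact
  note gD = lhomD[OF g]
  define w where "w = dV (j (Max D))"
  define tG where "tG = (\<lambda>y \<in> verts (init_subtree V w). dT (t (eV y)))"
  define jG where "jG = (\<lambda>x \<in> verts T. dV (j (eT x)))"
  have G: "G = (w, tG, jG)" by (simp add: G_def psc_of_def Let_def w_def tG_def jG_def)
  have MD: "Max D \<in> D" using ltree_Max(1)[OF T.ltree] .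
  have w: "w \<in> verts V" "eV w = j (Max D)" unfolding w_def using V.d_in[OF gD(1)[OF MD]] V.e_d[OF gD(1)[OF MD]] by auto
  interpret W: coded "init_subtree V w" eV dV "below E (eV w)" using V.coded_init[OF w(1)] .
  have j_eq: "eV (jG (dT x)) = j x" if "x \<in> D" for x
    using that T.d_in T.e_d gD(1) V.e_d by (simp add: jG_def)
  note fD = psc_homD[OF S T f]
  let ?u = "jG v"
  have u: "?u \<in> verts V" "eV ?u = j (eT v)"
    using V.d_in[OF gD(1)[OF T.e_in[OF fD(1)]]] V.e_d[OF gD(1)[OF T.e_in[OF fD(1)]]] fD(1) by (simp_all add: jG_def)
  interpret U: coded "init_subtree V ?u" eV dV "below E (eV ?u)" using V.coded_init[OF u(1)] .
  interpret Tv: coded "init_subtree T v" eT dT "below D (eT v)" using T.coded_init[OF fD(1)] .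
  have pb: "y \<in> below E (eV w)" "t y \<in> below D (eT v)" if "y \<in> below E (eV ?u)" for y
    using lhom_pullback_le[OF g T.ltree T.e_in[OF fD(1)], of y] that u(2) w(2) by auto
  have i_in: "i x \<in> verts T" "eT (i x) \<le> eT v" if "x \<in> verts S" for x
    using fD(3) that T.verts_init[OF fD(1)] by auto
  have s_in: "s y \<in> verts S" if "y \<in> verts (init_subtree T v)" for y using fD(2) that by auto
  let ?s = "compose (verts (init_subtree V ?u)) s tG" and ?i = "compose (verts S) jG i"
  have comp: "psc_comp S T V G (v, s, i) = (?u, ?s, ?i)" by (simp add: G)
  have tG_eq: "tG y = dT (t (eV y))" "dT (t (eV y)) \<in> verts (init_subtree T v)" if "y \<in> verts (init_subtree V ?u)" for y
  proof -
    note p = pb[OF U.e_in[OF that]]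
    have "y \<in> verts (init_subtree V w)" using W.d_in[OF p(1)] U.d_e[OF that] by simp
    then show "tG y = dT (t (eV y))" by (simp add: tG_def)
    show "dT (t (eV y)) \<in> verts (init_subtree T v)" using Tv.d_in[OF p(2)] .
  qed
  have s_PiE: "?s \<in> verts (init_subtree V ?u) \<rightarrow>\<^sub>E verts S"
    using tG_eq s_in by (auto simp: compose_def)
  have i_PiE: "?i \<in> verts S \<rightarrow>\<^sub>E verts (init_subtree V ?u)"
  proof -
    have "jG (i x) \<in> verts (init_subtree V ?u)" if x: "x \<in> verts S" for x
    proof -
      have "j (eT (i x)) \<le> j (eT v)"
        using lemb_le_iff[OF gD(3) T.e_in[OF i_in(1)[OF x]] T.e_in[OF fD(1)]] i_in(2)[OF x] by simp
      then show ?thesis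
        using U.d_in[of "j (eT (i x))"] gD(1)[OF T.e_in[OF i_in(1)[OF x]]] u(2) i_in(1)[OF x] by (simp add: jG_def)
    qed
    then show ?thesis by (auto simp: compose_def)
  qed
  obtain k' where k': "lconn C D (eT v) (\<lambda>y. eS (s (dT y))) k' (\<lambda>x. eT (i (dS x)))" using fD(4) by blast
  have L: "lconn C E (eV ?u) (\<lambda>y. eS (s (dT (t y)))) (\<lambda>x. j (k' x)) (\<lambda>x. j (eT (i (dS x))))"
    unfolding u(2) using lconn_comp[OF k' S.ltree T.ltree T.e_in[OF fD(1)] g] .
  have "lconn C E (eV ?u) (\<lambda>y. eS (?s (dV y))) (\<lambda>x. j (k' x)) (\<lambda>x. eV (?i (dS x)))"
  proof (rule lconn_cong[OF L S.ltree])
    fix y assume y: "y \<in> below E (eV ?u)"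
    show "eS (s (dT (t y))) = eS (?s (dV y))"
      using U.d_in[OF y] tG_eq(1)[OF U.d_in[OF y]] U.e_d[OF y] by (simp add: compose_def)
  next
    fix x assume x: "x \<in> C"
    have "eV (jG (i (dS x))) = j (eT (i (dS x)))"
      using j_eq[OF T.e_in[OF i_in(1)[OF S.d_in[OF x]]]] T.d_e[OF i_in(1)[OF S.d_in[OF x]]] by simp
    then show "j (eT (i (dS x))) = eV (?i (dS x))" using S.d_in[OF x] by (simp add: compose_def)
  qed
  then show "psc_comp S T V G (v, s, i) \<in> psc_hom S V"
    unfolding comp by (rule psc_homI[OF S V u(1) s_PiE i_PiE])
  assume sp: "splitting C B" and k: "lconn C D (eT v) (\<lambda>y. eS (s (dT y))) k (\<lambda>x. eT (i (dS x)))"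
    and B: "\<And>x. x \<in> C \<Longrightarrow> x \<in> B \<longleftrightarrow> k x \<noteq> eT (i (dS x))"
  interpret splitting C B by fact
  let ?sl = "\<lambda>y. eS (s (dT y))" and ?il = "\<lambda>x. eT (i (dS x))"
  note hyps = T.ltree T.e_in[OF fD(1)] k B
  let ?F = "(split_s D (eT v) ?sl ?il, split_i k ?il)"
  have F: "?F \<in> lhom (split_tree C B) D" by (rule split_lhom[OF hyps])
  have e: "split_i k ?il (Max (split_tree C B)) = eT v" by (rule split_end[OF hyps])
  have M: "Max (split_tree C B) \<in> split_tree C B" using ltree_Max(1)[OF ltree_split] .
  let ?H = "lcomp E (split_tree C B) (t, j) ?F"
  have H1: "snd ?H (Max (split_tree C B)) = eV ?u" using M e u(2) by (simp add: lcomp_def)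
  have fstH: "dS (unsplit C B (fst ?H (eV y))) = ?s y" if y: "y \<in> verts (init_subtree V ?u)" for y
  proof -
    have ey: "eV y \<in> below E (eV ?u)" using U.e_in[OF y] .
    note p = pb[OF ey]
    have "fst ?H (eV y) = split_s D (eT v) ?sl ?il (t (eV y))"
      using ey e u(2) by (simp add: lcomp_def)
    then have "unsplit C B (fst ?H (eV y)) = eS (s (dT (t (eV y))))"
      using unsplit_s[OF hyps, of "t (eV y)"] p(2) by simp
    then show ?thesis using tG_eq[OF y] S.d_e[OF s_in[OF tG_eq(2)[OF y]]] y by (simp add: compose_def)
  qed
  have sndH: "dV (snd ?H (if eS x \<in> B then phi B (eS x) @ [0] else phi B (eS x))) = ?i x" if x: "x \<in> verts S" for x
  proof -
    let ?z = "if eS x \<in> B then phi B (eS x) @ [0] else phi B (eS x)"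
    have "?z \<in> split_tree C B" using S.e_in[OF x] by (simp add: split_tree_def)
    then have "snd ?H ?z = j (split_i k ?il ?z)" by (simp add: lcomp_def)
    also have "\<dots> = j (eT (i x))" using split_i_emb[OF hyps S.e_in[OF x]] S.d_e[OF x] by simp
    finally show ?thesis using x i_in(1)[OF x] by (simp add: compose_def jG_def)
  qed
  have "decode S V eS dS C eV dV B ?H = (?u, ?s, ?i)"
    unfolding decode_def Let_def H1 V.d_e[OF u(1)]
    using fstH sndH by (auto simp: compose_def fun_eq_iff restrict_def)
  then show "\<exists>F \<in> lhom (split_tree C B) D.
        decode S V eS dS C eV dV B (lcomp E (split_tree C B) (t, j) F) = psc_comp S T V G (v, s, i)"
    unfolding comp using F by blast
qed

lemma colour_pts_splitting:
  assumes S: "coded S e d C" and fin: "finite (verts S)" and B: "B \<subseteq> colour_pts S"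
  shows "splitting C (e ` B)"
proof
  interpret S: coded S e d C by fact
  show "ltree C" by (rule S.ltree)
  show "e ` B \<subseteq> C" using B S.e_in by (auto simp: colour_pts_def)
  fix x a a' assume x: "x \<in> e ` B" and C: "x @ [a] \<in> C" "x @ [a'] \<in> C"
  obtain y where y: "y \<in> verts S" "card (isucc S y) \<le> 1" "x = e y" using x B by (auto simp: colour_pts_def)
  have "d (x @ [a]) \<in> isucc S y" "d (x @ [a']) \<in> isucc S y"
    using S.isucc_iff[OF y(1)] S.d_in S.e_d C y(3) by auto
  moreover have "finite (isucc S y)" by (rule finite_subset[OF _ fin]) (auto simp: isucc_def)
  ultimately have "d (x @ [a]) = d (x @ [a'])" using y(2) by (metis One_nat_def card_le_Suc0_iff_eq)
  then have "x @ [a] = x @ [a']" using S.e_d C by metis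
  then show "a = a'" by simp
qed

text \<open>Outside \<open>colour_pts\<close> the two embeddings agree: at the root both take the
  root as value, and at a vertex with several successors this is \<open>lconn_branching\<close>. So
  restricting \<open>diff_set\<close> to \<open>colour_pts\<close> loses no point where they
  differ.\<close>

lemma diff_set_iff:
  assumes S: "coded S e d C" and T: "coded T f g D" and h: "(v, s, i) \<in> psc_hom S T"
    and k: "lconn C D (f v) (\<lambda>y. e (s (g y))) k (\<lambda>x. f (i (d x)))"
    and ae: "\<forall>x \<in> verts S. assoc_emb (init_subtree T v) s x = g (k (e x))" and x: "x \<in> C"
  shows "x \<in> e ` diff_set S T (v, s, i) \<longleftrightarrow> k x \<noteq> f (i (d x))"
proof -
  interpret S: coded S e d C by fact
  interpret T: coded T f g D by fact
  note fD = psc_homD[OF S T h]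
  let ?a = "d x"
  have a: "?a \<in> verts S" "e ?a = x" using S.d_in[OF x] S.e_d[OF x] by auto
  have ia: "i ?a \<in> verts T" using fD(3) a(1) T.verts_init[OF fD(1)] by auto
  have kx: "k x \<in> D" using k x by (auto simp: lconn_def)
  have neq: "assoc_emb (init_subtree T v) s ?a \<noteq> i ?a \<longleftrightarrow> k x \<noteq> f (i ?a)"
    using ae a kx ia T.e_d T.d_e by metis
  have "x \<in> e ` diff_set S T (v, s, i) \<longleftrightarrow> ?a \<in> diff_set S T (v, s, i)"
  proof
    assume "x \<in> e ` diff_set S T (v, s, i)"
    then obtain y where y: "y \<in> diff_set S T (v, s, i)" "x = e y" by blast
    then have "y \<in> verts S" by (simp add: colour_pts_def)
    then show "?a \<in> diff_set S T (v, s, i)" using y S.d_e by simp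
  next
    assume "?a \<in> diff_set S T (v, s, i)"
    then have "e ?a \<in> e ` diff_set S T (v, s, i)" by (rule imageI)
    then show "x \<in> e ` diff_set S T (v, s, i)" by (simp only: a(2))
  qed
  also have "\<dots> \<longleftrightarrow> ?a \<in> colour_pts S \<and> k x \<noteq> f (i ?a)" using neq by simp
  also have "\<dots> \<longleftrightarrow> k x \<noteq> f (i ?a)"
  proof -
    have "k x = f (i ?a)" if "?a \<notin> colour_pts S"
    proof (cases "?a = root S")
      case True
      then have "x = []" using a S.root_eq(3) by simp
      moreover have "k [] = []" "f (i (d [])) = []" using k lembD(1) unfolding lconn_def by blast+
      ultimately show ?thesis by simp
    next
      case False
      then have "\<not> card (isucc S ?a) \<le> 1" using that a by (simp add: colour_pts_def)
      then obtain p q where pq: "p \<in> isucc S ?a" "q \<in> isucc S ?a" "p \<noteq> q"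
        by (metis One_nat_def card.infinite card_le_Suc0_iff_eq le_zero_eq nat_le_linear not_less_eq_eq)
      then obtain b c where "e p = x @ [b]" "e q = x @ [c]" "p \<in> verts S" "q \<in> verts S"
        using S.isucc_iff[OF a(1)] a(2) by auto
      moreover from this have "b \<noteq> c" using S.e_eq_iff pq(3) by metis
      ultimately show ?thesis using lconn_branching[OF k S.ltree, of x b c] S.e_in by metis
    qed
    then show ?thesis by blast
  qed
  finally show ?thesis .
qed

text \<open>Each set \<open>B\<close> of colour points yields a colouring of the surjections onto
  its split tree by decoding. One morphism of list trees makes all these finitely many colourings
  constant, and a morphism of \<open>PSC\<close> is coloured through its own set
  \<open>B\<close>.\<close>

lemma psc_Ramsey:
  fixes S T :: "'a::infinite otree"
  assumes S: "ordered_tree S" and T: "ordered_tree T" and r: "r > (0::nat)"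
  shows "\<exists>V :: 'a otree. ordered_tree V \<and>
    (\<forall>\<chi> \<in> Hom PSC S V \<rightarrow> {..<r}. \<exists>g \<in> Hom PSC T V.
       \<forall>f \<in> Hom PSC S T. \<forall>f' \<in> Hom PSC S T.
         diff_set S T f = diff_set S T f' \<longrightarrow>
         \<chi> (Comp PSC S T V g f) = \<chi> (Comp PSC S T V g f'))"
proof -
  obtain eS dS C where cS: "coded S eS dS C" using ordered_tree_coded[OF S] .
  obtain eT dT D where cT: "coded T eT dT D" using ordered_tree_coded[OF T] .
  interpret S: coded S eS dS C by fact
  interpret T: coded T eT dT D by fact
  have finS: "finite (verts S)" using S by (simp add: ordered_tree_def)
  let ?I = "Pow (colour_pts S)"
  define P where "P B = split_tree C (eS ` B)" for B
  have finI: "finite ?I" using finS by (simp add: colour_pts_def)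
  have sp: "splitting C (eS ` B)" if "B \<in> ?I" for B
    using colour_pts_splitting[OF cS finS] that by blast
  have lt: "\<forall>B \<in> ?I. ltree (P B)" unfolding P_def using splitting.ltree_split[OF sp] by blast
  obtain E where E: "ltree E"
    and hom: "\<forall>\<chi>. (\<forall>B \<in> ?I. \<chi> B \<in> lhom (P B) E \<rightarrow> {..<r}) \<longrightarrow> (\<exists>g \<in> lhom D E.
      \<forall>B \<in> ?I. \<forall>f \<in> lhom (P B) D. \<forall>f' \<in> lhom (P B) D. \<chi> B (lcomp E (P B) g f) = \<chi> B (lcomp E (P B) g f'))"
    using dual_Ramsey_ltree_family[OF finI lt T.ltree r] by (elim exE conjE) (rule that)
  \<comment> \<open>The Ramsey tree consists of lists; an injection into the infinite vertex type
    turns it into an object of \<open>PSC\<close>.\<close>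
  obtain \<nu> :: "nat list \<Rightarrow> 'a" where \<nu>: "inj \<nu>" using infinite_type_inj by blast
  define V where "V = otree_of \<nu> E"
  have V: "ordered_tree V" and cV: "coded V (inv \<nu>) \<nu> E" unfolding V_def using otree_of[OF \<nu> E] by auto
  show ?thesis
  proof (intro exI[of _ V] conjI ballI V)
    fix \<chi> assume chi: "\<chi> \<in> Hom PSC S V \<rightarrow> {..<r}"
    define dec where "dec B F = decode S V eS dS C (inv \<nu>) \<nu> (eS ` B) F" for B F
    \<comment> \<open>Where decoding does not give a morphism the default 0 keeps the values below
      \<open>r\<close>; for composites of encoded morphisms decoding is correct.\<close>
    define \<chi>' where "\<chi>' B F = (if dec B F \<in> psc_hom S V then \<chi> (dec B F) else 0)" for B F
    have "\<forall>B \<in> ?I. \<chi>' B \<in> lhom (P B) E \<rightarrow> {..<r}"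
      using chi r by (auto simp: \<chi>'_def PSC_def dest: funcset_mem)
    then obtain g0 where g0: "g0 \<in> lhom D E"
      and mono: "\<And>B f f'. B \<in> ?I \<Longrightarrow> f \<in> lhom (P B) D \<Longrightarrow> f' \<in> lhom (P B) D \<Longrightarrow>
        \<chi>' B (lcomp E (P B) g0 f) = \<chi>' B (lcomp E (P B) g0 f')"
      using hom by blast
    obtain t j where tj: "g0 = (t, j)" by (metis surj_pair)
    note g = g0[unfolded tj]
    define G where "G = psc_of T V eT dT (inv \<nu>) \<nu> (Max D) (t, j)"
    have Gh: "G \<in> psc_hom T V" unfolding G_def by (rule psc_of_in_hom[OF cT cV g])
    show "\<exists>g \<in> Hom PSC T V. \<forall>f \<in> Hom PSC S T. \<forall>f' \<in> Hom PSC S T.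
         diff_set S T f = diff_set S T f' \<longrightarrow> \<chi> (Comp PSC S T V g f) = \<chi> (Comp PSC S T V g f')"
    proof -
      have key: "\<exists>F \<in> lhom (P (diff_set S T f)) D.
          \<chi> (psc_comp S T V G f) = \<chi>' (diff_set S T f) (lcomp E (P (diff_set S T f)) g0 F)"
        if f: "f \<in> psc_hom S T" for f
      proof -
        obtain v s i where fe: "f = (v, s, i)" by (metis surj_pair)
        note f' = f[unfolded fe]
        let ?B = "diff_set S T f"
        have B: "?B \<in> ?I" by (auto simp: fe)
        note M = psc_comp_in_hom[OF cS cT cV g f', folded G_def]
        obtain k where k: "lconn C D (eT v) (\<lambda>y. eS (s (dT y))) k (\<lambda>x. eT (i (dS x)))"
          "\<forall>x \<in> verts S. assoc_emb (init_subtree T v) s x = dT (k (eS x))"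
          using psc_homD(4)[OF cS cT f'] by blast
        note d = diff_set_iff[OF cS cT f' k, folded fe]
        obtain F where F: "F \<in> lhom (P ?B) D" "dec ?B (lcomp E (P ?B) g0 F) = psc_comp S T V G f"
          using M(2)[OF sp[OF B] k(1) d] unfolding P_def dec_def tj fe by blast
        then have "\<chi> (psc_comp S T V G f) = \<chi>' ?B (lcomp E (P ?B) g0 F)"
          using M(1) by (simp add: \<chi>'_def fe)
        then show ?thesis using F(1) by blast
      qed
      have same: "\<chi> (psc_comp S T V G f) = \<chi> (psc_comp S T V G f')"
        if f: "f \<in> psc_hom S T" "f' \<in> psc_hom S T" and eq: "diff_set S T f = diff_set S T f'" for f f'
      proof -
        have "diff_set S T f' \<in> ?I" by (cases f') auto
        moreover obtain F where "F \<in> lhom (P (diff_set S T f')) D"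
          "\<chi> (psc_comp S T V G f) = \<chi>' (diff_set S T f') (lcomp E (P (diff_set S T f')) g0 F)"
          using key[OF f(1)] unfolding eq by blast
        moreover obtain F' where "F' \<in> lhom (P (diff_set S T f')) D"
          "\<chi> (psc_comp S T V G f') = \<chi>' (diff_set S T f') (lcomp E (P (diff_set S T f')) g0 F')"
          using key[OF f(2)] by blast
        ultimately show ?thesis by (simp only: mono[of "diff_set S T f'" F F'])
      qed
      have H: "Hom PSC = psc_hom" "Comp PSC = psc_comp" by (simp_all add: PSC_def)
      show ?thesis
        unfolding H
      proof (intro bexI[of _ G] ballI impI Gh)
        fix f f' assume "f \<in> psc_hom S T" "f' \<in> psc_hom S T" "diff_set S T f = diff_set S T f'"
        then show "\<chi> (psc_comp S T V G f) = \<chi> (psc_comp S T V G f')" by (rule same)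
      qed
    qed
  qed
qed

theorem theorem5p3:
  fixes S :: "'a::infinite otree"
  assumes "ordered_tree S"
  shows "(\<forall>T :: 'a otree. \<forall>r :: nat. ordered_tree T \<and> r > 0 \<longrightarrow>
            (\<exists>V :: 'a otree. ordered_tree V \<and>
              (\<forall>\<chi> \<in> Hom PSC S V \<rightarrow> {..<r}. \<exists>g \<in> Hom PSC T V.
                 \<forall>f \<in> Hom PSC S T. \<forall>f' \<in> Hom PSC S T.
                   diff_set S T f = diff_set S T f' \<longrightarrow>
                   \<chi> (Comp PSC S T V g f) = \<chi> (Comp PSC S T V g f')))) \<and>
         rd PSC S \<le> enat (card (Pow (colour_pts S)))"
proof (intro conjI allI impI)
  fix T :: "'a otree" and r :: nat
  assume "ordered_tree T \<and> r > 0"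
  then show "\<exists>V :: 'a otree. ordered_tree V \<and>
              (\<forall>\<chi> \<in> Hom PSC S V \<rightarrow> {..<r}. \<exists>g \<in> Hom PSC T V.
                 \<forall>f \<in> Hom PSC S T. \<forall>f' \<in> Hom PSC S T.
                   diff_set S T f = diff_set S T f' \<longrightarrow>
                   \<chi> (Comp PSC S T V g f) = \<chi> (Comp PSC S T V g f'))"
    using psc_Ramsey[OF assms] by blast
next
  let ?k = "card (Pow (colour_pts S))"
  have fin: "finite (Pow (colour_pts S))" using assms by (simp add: ordered_tree_def colour_pts_def)
  have rb: "ramsey_bound PSC S T ?k" if T: "T \<in> Obj PSC" for T :: "'a otree"
    unfolding ramsey_bound_def
  proof (intro allI impI)
    fix r :: nat assume r: "r > 0"
    have "ordered_tree T" using T by (simp add: PSC_def)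
    from psc_Ramsey[OF assms this r] obtain V :: "'a otree" where V: "ordered_tree V"
      and hom: "\<forall>\<chi> \<in> Hom PSC S V \<rightarrow> {..<r}. \<exists>g \<in> Hom PSC T V.
       \<forall>f \<in> Hom PSC S T. \<forall>f' \<in> Hom PSC S T. diff_set S T f = diff_set S T f' \<longrightarrow>
         \<chi> (Comp PSC S T V g f) = \<chi> (Comp PSC S T V g f')"
      by (elim exE conjE) (rule that)
    have "\<exists>g \<in> Hom PSC T V. card (\<chi> ` Comp PSC S T V g ` Hom PSC S T) \<le> ?k"
      if chi: "\<chi> \<in> Hom PSC S V \<rightarrow> {..<r}" for \<chi>
    proof -
      obtain g where g: "g \<in> Hom PSC T V"
        and eq: "\<And>f f'. f \<in> Hom PSC S T \<Longrightarrow> f' \<in> Hom PSC S T \<Longrightarrow> diff_set S T f = diff_set S T f' \<Longrightarrow>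
          \<chi> (Comp PSC S T V g f) = \<chi> (Comp PSC S T V g f')"
        using hom chi by blast
      let ?c = "\<lambda>f. \<chi> (Comp PSC S T V g f)"
      \<comment> \<open>One colour is chosen for each set \<open>B\<close>, so the colours that
        occur are values of \<open>G\<close> on the subsets of \<open>colour_pts S\<close>.\<close>
      define G where "G B = (SOME y. \<exists>f \<in> Hom PSC S T. diff_set S T f = B \<and> ?c f = y)" for B
      have "?c f = G (diff_set S T f)" if f: "f \<in> Hom PSC S T" for f
      proof -
        have "\<exists>y. \<exists>h \<in> Hom PSC S T. diff_set S T h = diff_set S T f \<and> ?c h = y" using f by blast
        then have "\<exists>h \<in> Hom PSC S T. diff_set S T h = diff_set S T f \<and> ?c h = G (diff_set S T f)"
          unfolding G_def by (rule someI_ex)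
        then show ?thesis using eq[OF f] by metis
      qed
      moreover have "diff_set S T f \<in> Pow (colour_pts S)" for f by (cases f) auto
      ultimately have "\<chi> ` Comp PSC S T V g ` Hom PSC S T \<subseteq> G ` Pow (colour_pts S)"
        by (auto simp: image_image)
      then have "card (\<chi> ` Comp PSC S T V g ` Hom PSC S T) \<le> card (G ` Pow (colour_pts S))"
        using fin by (intro card_mono) auto
      also have "\<dots> \<le> ?k" using fin by (rule card_image_le)
      finally show ?thesis using g by blast
    qed
    moreover have "V \<in> Obj PSC" using V by (simp add: PSC_def)
    ultimately show "\<exists>D \<in> Obj PSC. \<forall>\<chi> \<in> Hom PSC S D \<rightarrow> {..<r}. \<exists>f \<in> Hom PSC T D.
        card (\<chi> ` Comp PSC S T D f ` Hom PSC S T) \<le> ?k"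
      by blast
  qed
  show "rd PSC S \<le> enat ?k"
    unfolding rd_def rd2_def using rb by (intro SUP_least INF_lower2[of ?k]) auto
qed

end
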